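(* Let $\Omega\subset\mathbb{R}^{n+1}$ be a convex body with smooth boundary of positive Gauss curvature, containing the origin, with $V(\Omega)=V(B(1))$, and let $u$ be its support function with respect to the origin. Assume $u$ is a soliton, i.e. $u=K$ on $\mathbb{S}^n$. Then: (i) the origin is the entropy point of $\Omega$; (ii) the polar dual $\Omega^*_0$ of $\Omega$ with respect to the origin satisfies $V(\Omega^*_0)\ge V(B(1))$. In particular, if the origin is the Santaló point of $\Omega$, then $\Omega=B(1)$.
   Context: $V$ is Lebesgue measure on $\mathbb{R}^{n+1}$, $B(1)$ the closed unit ball centered at the origin, $d\theta$ the surface measure on $\mathbb{S}^n$ and $\omega_n$ its total mass. For $z_0\in\Omega$, $u_{z_0}(x)=\max_{z\in\Omega}\langle x,z-z_0\rangle$, $x\in\mathbb{S}^n$. $K$ denotes the Gauss curvature of $\partial\Omega$, viewed as a function on $\mathbb{S}^n$ via the inverse Gauss map; equivalently $u=K$ means $u\det(\bar\nabla^2u+u\,\bar g)=1$ on $\mathbb{S}^n$ with its standard metric $\bar g$. The entropy point of $\Omega$ is the unique point $z_e$ (it lies in $\operatorname{Int}(\Omega)$) at which $z_0\mapsto\frac1{\omega_n}\int_{\mathbb{S}^n}\log u_{z_0}\,d\theta$ attains its maximum over $z_0 \in \Omega$. For $z_0\in\operatorname{Int}(\Omega)$ the polar dual with respect to $z_0$ is $\Omega^*_{z_0}=\{y+z_0:\max_{z\in\Omega}\langle y,z-z_0\rangle\le1\}$, and the Santaló point of $\Omega$ is the unique $z_0\in\operatorname{Int}(\Omega)$ minimizing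 $V(\Omega^*_{z_0})$. *)

theory Defs
  imports "HOL-Analysis.Analysis"
begin

text \<open>
  The ambient space \<open>\<real>\<^sup>n\<^sup>+\<^sup>1\<close> is \<open>real ^ 'n\<close>, so \<open>CARD('n)\<close> plays the role of \<open>n + 1\<close>
  and the unit sphere is \<open>sphere 0 1\<close>.
\<close>

subsection \<open>Convex bodies with smooth boundary\<close>

definition convex_body :: "(real ^ 'n) set \<Rightarrow> bool" where
  "convex_body \<Omega> \<longleftrightarrow> compact \<Omega> \<and> convex \<Omega> \<and> interior \<Omega> \<noteq> {}"

text \<open>On an open set, \<open>C_k_on k f U\<close> says that \<open>f\<close> is \<open>k\<close> times continuously differentiable.\<close>

fun C_k_on :: "nat \<Rightarrow> (real ^ 'n \<Rightarrow> real) \<Rightarrow> (real ^ 'n) set \<Rightarrow> bool" where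
  "C_k_on 0 f U \<longleftrightarrow> continuous_on U f"
| "C_k_on (Suc k) f U \<longleftrightarrow>
     (\<forall>x\<in>U. f differentiable (at x)) \<and> (\<forall>v. C_k_on k (\<lambda>x. frechet_derivative f (at x) v) U)"

definition smooth_fun_on :: "(real ^ 'n \<Rightarrow> real) \<Rightarrow> (real ^ 'n) set \<Rightarrow> bool" where
  "smooth_fun_on f U \<longleftrightarrow> (\<forall>k. C_k_on k f U)"

text \<open>The boundary is an embedded smooth hypersurface: locally a regular level set.\<close>

definition smooth_boundary :: "(real ^ 'n) set \<Rightarrow> bool" where
  "smooth_boundary \<Omega> \<longleftrightarrow>
     (\<forall>p\<in>frontier \<Omega>. \<exists>U f. open U \<and> p \<in> U \<and> smooth_fun_on f U \<and>
        frontier \<Omega> \<inter> U = {x \<in> U. f x = 0} \<and>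
        (\<forall>x\<in>U. frechet_derivative f (at x) \<noteq> (\<lambda>v. 0)))"

subsection \<open>Gauss map and Gauss curvature\<close>

text \<open>
  The Gauss map sends a boundary point to its outward unit normal, which is unique if \<open>\<Omega>\<close> is a
  convex body with smooth boundary.
\<close>

definition gauss_map :: "(real ^ 'n) set \<Rightarrow> real ^ 'n \<Rightarrow> real ^ 'n" where
  "gauss_map \<Omega> p = (THE \<nu>. norm \<nu> = 1 \<and> (\<forall>z\<in>\<Omega>. \<nu> \<bullet> (z - p) \<le> 0))"

text \<open>
  The Gauss curvature is the determinant of the differential of the Gauss map on the tangent space
  \<open>\<nu>\<^sup>\<bottom>\<close> at \<open>p\<close> (so it is \<open>1\<close> for the unit ball). The derivative is taken within \<open>frontier \<Omega>\<close>,
  which determines it on \<open>\<nu>\<^sup>\<bottom>\<close> only; it is therefore composed with the orthogonal projection to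
  \<open>\<nu>\<^sup>\<bottom>\<close>. It maps \<open>\<nu>\<^sup>\<bottom>\<close> to itself, and extending it by the identity on the normal line does not
  change the determinant.
\<close>

definition gauss_curvature :: "(real ^ 'n) set \<Rightarrow> real ^ 'n \<Rightarrow> real" where
  "gauss_curvature \<Omega> p =
     (let \<nu> = gauss_map \<Omega> p; D = frechet_derivative (gauss_map \<Omega>) (at p within frontier \<Omega>)
      in det (matrix (\<lambda>v. D (v - (v \<bullet> \<nu>) *\<^sub>R \<nu>) + (v \<bullet> \<nu>) *\<^sub>R \<nu>)))"

definition gauss_curvature_on_sphere :: "(real ^ 'n) set \<Rightarrow> real ^ 'n \<Rightarrow> real" where
  "gauss_curvature_on_sphere \<Omega> x =
     gauss_curvature \<Omega> (the_inv_into (frontier \<Omega>) (gauss_map \<Omega>) x)"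

subsection \<open>Support function, polar dual, Santalo point\<close>

text \<open>
  For compact nonempty \<open>\<Omega>\<close> the supremum is attained. The formula is used on the sphere, and for
  the polar dual on the whole space.
\<close>

definition support_fun :: "(real ^ 'n) set \<Rightarrow> real ^ 'n \<Rightarrow> real ^ 'n \<Rightarrow> real" where
  "support_fun \<Omega> z0 x = (SUP z\<in>\<Omega>. x \<bullet> (z - z0))"

definition polar_dual :: "(real ^ 'n) set \<Rightarrow> real ^ 'n \<Rightarrow> (real ^ 'n) set" where
  "polar_dual \<Omega> z0 = {y + z0 | y. support_fun \<Omega> z0 y \<le> 1}"

definition is_santalo_point :: "(real ^ 'n) set \<Rightarrow> real ^ 'n \<Rightarrow> bool" where
  "is_santalo_point \<Omega> z \<longleftrightarrow> z \<in> interior \<Omega> \<and>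
     (\<forall>w\<in>interior \<Omega>. w \<noteq> z \<longrightarrow>
        measure lebesgue (polar_dual \<Omega> z) < measure lebesgue (polar_dual \<Omega> w))"

subsection \<open>Surface measure on the sphere and entropy point\<close>

text \<open>
  Surface measure by polar coordinates: the measure of \<open>A \<subseteq> sphere 0 1\<close> is \<open>n + 1\<close> times the
  volume of the cone over \<open>A\<close> with apex \<open>0\<close>. Here \<open>sgn x = x / norm x\<close>.
\<close>

definition sphere_measure :: "(real ^ 'n) measure" where
  "sphere_measure =
     density
       (distr (restrict_space lborel (cball 0 1 - {0})) (restrict_space borel (sphere 0 1)) sgn)
       (\<lambda>_. of_nat CARD('n))"

text \<open>
  The function \<open>support_fun \<Omega> z0\<close> is bounded and nonnegative on the sphere for \<open>z0 \<in> \<Omega>\<close>, so its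
  logarithm has a well-defined integral in \<open>[-\<infinity>, \<infinity>)\<close>. In HOL \<open>ln 0 = 0\<close>, and a Bochner
  integral is \<open>0\<close> if the integrand is not integrable, hence the case distinction.
\<close>

definition entropy :: "(real ^ 'n) set \<Rightarrow> real ^ 'n \<Rightarrow> ereal" where
  "entropy \<Omega> z0 =
     (if (AE x in sphere_measure. 0 < support_fun \<Omega> z0 x) \<and>
         integrable sphere_measure (\<lambda>x. ln (support_fun \<Omega> z0 x))
      then ereal (1 / measure sphere_measure (sphere 0 1 :: (real ^ 'n) set) *
             (\<integral>x. ln (support_fun \<Omega> z0 x) \<partial>sphere_measure))
      else -\<infinity>)"

definition is_entropy_point :: "(real ^ 'n) set \<Rightarrow> real ^ 'n \<Rightarrow> bool" where
  "is_entropy_point \<Omega> z \<longleftrightarrow> z \<in> \<Omega> \<and> (\<forall>w\<in>\<Omega>. w \<noteq> z \<longrightarrow> entropy \<Omega> w < entropy \<Omega> z)"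

end

(*
A soliton is transported to the unit ball by the 1-homogeneous extension Phi of the Gauss map,
Phi x = g x * nu (x / g x), where g is the gauge of Omega and h its support function. Its
Jacobian determinant is K / h = 1, so Phi preserves volume. Three consequences:

* The gradient of g at x is nu / h, and it integrates to 0 over Omega because max 0 (1 - g) is
  Lipschitz with compact support. Transported by Phi, the integral of x / h over the sphere
  vanishes, and ln t <= t - 1 with t = (h - <x,w>) / h gives the entropy inequality.

* In polar coordinates the volume of the polar body is the integral of (1 / h)^N over the ball,
  hence by Phi the integral of (1 / <nu, q>)^N over Omega, q being the boundary point on the ray of
  x. The volume of the ball is the integral of (1 / |q|)^N over Omega, so <nu, q> <= |q| suffices.
  Equality forces nu to be radial, which makes g / |x| locally constant.

* If the origin is the Santalo point, the Blaschke-Santalo inequality gives the reverse inequality.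
  It follows from its functional form, proved by induction on the dimension (after Lehec): bisect
  by a hyperplane, shear along the line through the barycenters of the two halves, apply the
  half-line case (Prekopa-Leindler in logarithmic coordinates) on each fibre and the induction
  hypothesis to the resulting marginals.
*)
theory Submission
  imports Defs "HOL-Probability.Probability" "HOL-Real_Asymp.Real_Asymp"
begin

section \<open>The one-dimensional Prekopa-Leindler inequality\<close>

text \<open>The obstacle is that surface integrals over the sphere and the boundary would call for
  regularity of the inverse Gauss map. Instead each of them is written as a volume integral over
  cones, and only \<open>\<Phi>\<close>, built from the forward Gauss map, is differentiated. The
  Jacobian K / h has a direct reason: at a boundary point q with normal \<nu> the differential of
  \<open>\<Phi>\<close> sends q to \<nu> and acts on the tangent space as the differential of the
  Gauss map, while q rises above that space only by <q, \<nu>> = h. The vanishing integral of x / h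
  is the stationarity of the entropy at the origin, which concavity of the logarithm turns into a
  strict maximum.

  The Blaschke-Santalo inequality is proved at the barycenter, where the functional form can be
  centered; minimality of the polar volume carries the bound to the Santalo point. Gaussians of the
  gauge and of the support function are used because the ball gives equality for them, so that the
  constant (2 pi)^N turns into the squared volume of the ball.\<close>

lemma emeasure_midpoints_bounded:
  fixes A B C :: "real set"
  assumes [measurable]: "A \<in> sets borel" "B \<in> sets borel" "C \<in> sets borel"
    and ne: "A \<noteq> {}" "B \<noteq> {}" and bdd: "bdd_above A" "bdd_below B"
    and mid: "\<And>a b. a \<in> A \<Longrightarrow> b \<in> B \<Longrightarrow> (a + b) / 2 \<in> C"
  shows "emeasure lborel A + emeasure lborel B \<le> 2 * emeasure lborel C"
proof (rule ennreal_le_epsilon)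
  fix e :: real assume "0 < e"
  then obtain a where a: "a \<in> A" "Sup A - e / 2 < a"
    using less_cSupE[of "Sup A - e/2" A] ne by auto
  obtain b where b: "b \<in> B" "b < Inf B + e / 2"
    using cInf_lessD[of B "Inf B + e/2"] \<open>0 < e\<close> ne by auto
  \<comment> \<open>The translates \<open>A + b\<close> and \<open>B + a\<close> both lie in
    \<open>2 C\<close>. Since \<open>a\<close> is close to \<open>Sup A\<close> and \<open>b\<close>
    to \<open>Inf B\<close>, they meet only inside \<open>S\<close>, whose length is at most
    \<open>e\<close>.\<close>
  define S where "S = {a + Inf B .. Sup A + b}"
  have le: "indicator A (x - b) + indicator B (x - a) \<le> (indicator C (x / 2) + indicator S x :: ennreal)" for x
  proof -
    have "x / 2 \<in> C" if "x - b \<in> A" using mid[OF that b(1)] by simp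
    moreover have "x / 2 \<in> C" if "x - a \<in> B" using mid[OF a(1) that] by simp
    moreover have "x \<in> S" if "x - b \<in> A" "x - a \<in> B"
      using cSup_upper[OF that(1) bdd(1)] cInf_lower[OF that(2) bdd(2)] by (auto simp: S_def)
    ultimately show ?thesis by (auto simp: indicator_def)
  qed
  have "emeasure lborel A = (\<integral>\<^sup>+x. indicator A (x - b) \<partial>lborel)"
    using nn_integral_real_affine[where c=1 and t="-b" and f="indicator A"] by simp
  moreover have "emeasure lborel B = (\<integral>\<^sup>+x. indicator B (x - a) \<partial>lborel)"
    using nn_integral_real_affine[where c=1 and t="-a" and f="indicator B"] by simp
  moreover have "2 * emeasure lborel C = (\<integral>\<^sup>+x. indicator C (x / 2) \<partial>lborel)"
  proof -
    have "(\<integral>\<^sup>+x. indicator C (x / 2) \<partial>lborel) = ennreal 2 * (\<integral>\<^sup>+x. indicator C ((0 + 2 * x) / 2) \<partial>lborel)"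
      by (subst nn_integral_real_affine[where c=2 and t=0]) auto
    then show ?thesis by simp
  qed
  ultimately have "emeasure lborel A + emeasure lborel B
      = (\<integral>\<^sup>+x. indicator A (x - b) + indicator B (x - a) \<partial>lborel)"
    by (simp add: nn_integral_add)
  also have "\<dots> \<le> (\<integral>\<^sup>+x. indicator C (x / 2) + indicator S x \<partial>lborel)"
    by (intro nn_integral_mono le)
  also have "\<dots> = 2 * emeasure lborel C + emeasure lborel S"
    using \<open>2 * emeasure lborel C = _\<close> by (simp add: nn_integral_add S_def)
  also have "emeasure lborel S \<le> ennreal e"
    using a b by (auto simp: S_def emeasure_lborel_Icc_eq intro!: ennreal_leI)
  finally show "emeasure lborel A + emeasure lborel B \<le> 2 * emeasure lborel C + ennreal e"
    by (simp add: add_left_mono)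
qed

lemma emeasure_midpoints:
  fixes A B C :: "real set"
  assumes [measurable]: "A \<in> sets borel" "B \<in> sets borel" "C \<in> sets borel"
    and ne: "A \<noteq> {}" "B \<noteq> {}"
    and mid: "\<And>a b. a \<in> A \<Longrightarrow> b \<in> B \<Longrightarrow> (a + b) / 2 \<in> C"
  shows "emeasure lborel A + emeasure lborel B \<le> 2 * emeasure lborel C"
proof -
  obtain a b where ab: "a \<in> A" "b \<in> B" using ne by auto
  \<comment> \<open>The offset \<open>k\<close> keeps the fixed points \<open>a\<close> and
    \<open>b\<close> in every truncation, so no truncated set is empty.\<close>
  obtain k where k: "\<bar>a\<bar> + \<bar>b\<bar> \<le> real k" using real_arch_simple by blast
  define I where "I i = {- real (i + k) .. real (i + k)}" for i
  have sup: "emeasure lborel X = (SUP i. emeasure lborel (X \<inter> I i))" if [measurable]: "X \<in> sets borel" for X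
  proof -
    have "(\<Union>i. X \<inter> I i) = X"
    proof (intro equalityI subsetI)
      fix x assume "x \<in> X"
      obtain i where "\<bar>x\<bar> \<le> real i" using real_arch_simple by blast
      then show "x \<in> (\<Union>i. X \<inter> I i)" using \<open>x \<in> X\<close> by (auto simp: I_def intro!: exI[of _ i])
    qed auto
    moreover have "(SUP i. emeasure lborel (X \<inter> I i)) = emeasure lborel (\<Union>i. X \<inter> I i)"
      by (rule SUP_emeasure_incseq) (auto simp: I_def incseq_def)
    ultimately show ?thesis by simp
  qed
  have "emeasure lborel A + emeasure lborel B
      = (SUP i. emeasure lborel (A \<inter> I i) + emeasure lborel (B \<inter> I i))"
    unfolding sup[of A, OF assms(1)] sup[of B, OF assms(2)]
    by (subst ennreal_SUP_add) (auto simp: incseq_def I_def intro!: emeasure_mono)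
  also have "\<dots> \<le> 2 * emeasure lborel C"
  proof (rule SUP_least)
    fix i
    have "a \<in> A \<inter> I i" "b \<in> B \<inter> I i" using ab k by (auto simp: I_def)
    then show "emeasure lborel (A \<inter> I i) + emeasure lborel (B \<inter> I i) \<le> 2 * emeasure lborel C"
      by (intro emeasure_midpoints_bounded)
         (auto simp: I_def intro!: mid bdd_aboveI[of _ "real (i + k)"] bdd_belowI[of _ "- real (i + k)"])
  qed
  finally show ?thesis .
qed

lemma nn_integral_layer_cake:
  fixes f :: "real \<Rightarrow> real"
  assumes [measurable]: "f \<in> borel_measurable borel" and "\<And>x. 0 \<le> f x"
  shows "(\<integral>\<^sup>+x. f x \<partial>lborel) = (\<integral>\<^sup>+t. indicator {0<..} t * emeasure lborel {x. t < f x} \<partial>lborel)"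
proof -
  have "ennreal (f x) = (\<integral>\<^sup>+t. indicator {0<..} t * indicator {x. t < f x} x \<partial>lborel)" for x
  proof -
    have "(\<integral>\<^sup>+t. indicator {0<..} t * indicator {x. t < f x} x \<partial>lborel)
        = (\<integral>\<^sup>+t. indicator {0<..<f x} t \<partial>lborel)"
      by (intro nn_integral_cong) (auto simp: indicator_def)
    then show ?thesis using assms(2)[of x] by simp
  qed
  then have "(\<integral>\<^sup>+x. f x \<partial>lborel)
      = (\<integral>\<^sup>+x. (\<integral>\<^sup>+t. indicator {0<..} t * indicator {x. t < f x} x \<partial>lborel) \<partial>lborel)" by simp
  also have "\<dots> = (\<integral>\<^sup>+t. (\<integral>\<^sup>+x. indicator {0<..} t * indicator {x. t < f x} x \<partial>lborel) \<partial>lborel)"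
    by (intro lborel_pair.Fubini') measurable
  also have "\<dots> = (\<integral>\<^sup>+t. indicator {0<..} t * emeasure lborel {x. t < f x} \<partial>lborel)"
    by (intro nn_integral_cong) (subst nn_integral_cmult, auto)
  finally show ?thesis .
qed

text \<open>With both suprema equal to 1, the level sets of \<open>f\<close> and \<open>g\<close>
  are nonempty exactly up to the same height. Hence the midpoint inequality applies to the level
  sets at every height between 0 and 1, and integration over the height gives the additive
  form.\<close>

lemma prekopa_leindler_normalized:
  fixes f g k :: "real \<Rightarrow> real"
  assumes [measurable]: "f \<in> borel_measurable borel" "g \<in> borel_measurable borel" "k \<in> borel_measurable borel"
    and f: "\<And>x. 0 \<le> f x" "\<And>x. f x \<le> 1" "\<And>t. t < 1 \<Longrightarrow> \<exists>x. t < f x"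
    and g: "\<And>x. 0 \<le> g x" "\<And>x. g x \<le> 1" "\<And>t. t < 1 \<Longrightarrow> \<exists>x. t < g x"
    and k: "\<And>x. 0 \<le> k x"
    and le: "\<And>a b. f a * g b \<le> (k ((a + b) / 2))\<^sup>2"
  shows "(\<integral>\<^sup>+x. f x \<partial>lborel) + (\<integral>\<^sup>+x. g x \<partial>lborel) \<le> 2 * (\<integral>\<^sup>+x. k x \<partial>lborel)"
proof -
  have *: "indicator {0<..} t * emeasure lborel {x. t < f x} + indicator {0<..} t * emeasure lborel {x. t < g x}
      \<le> 2 * (indicator {0<..} t * emeasure lborel {x. t < k x})" for t :: real
  proof (cases "0 < t \<and> t < 1")
    case True
    have "t < k ((a + b) / 2)" if "t < f a" "t < g b" for a b
    proof -
      have "t\<^sup>2 < f a * g b" unfolding power2_eq_square using that True by (intro mult_strict_mono) auto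
      then have "t\<^sup>2 < (k ((a + b) / 2))\<^sup>2" using le order_less_le_trans by blast
      then show ?thesis using k power_less_imp_less_base by blast
    qed
    then have "emeasure lborel {x. t < f x} + emeasure lborel {x. t < g x} \<le> 2 * emeasure lborel {x. t < k x}"
      using f(3)[of t] g(3)[of t] True by (intro emeasure_midpoints) auto
    then show ?thesis using True by simp
  next
    case False
    then have "t \<le> 0 \<or> {x. t < f x} = {} \<and> {x. t < g x} = {}"
      using f(2) g(2) by (auto simp: not_less intro: order_trans)
    then show ?thesis by auto
  qed
  show ?thesis
    unfolding nn_integral_layer_cake[of f, OF assms(1) f(1)] nn_integral_layer_cake[of g, OF assms(2) g(1)]
      nn_integral_layer_cake[of k, OF assms(3) k]
    by (subst nn_integral_add[symmetric], measurable, subst nn_integral_cmult[symmetric], measurable)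
       (intro nn_integral_mono *)
qed

lemma ennreal_four_mult_le_add_square: "4 * (x * y) \<le> (x + y)\<^sup>2" for x y :: ennreal
proof (cases x y rule: ennreal2_cases)
  case (real_real a b)
  have "4 * (a * b) \<le> (a + b)\<^sup>2" using sum_squares_ge_zero[of "a - b" 0] by (simp add: power2_eq_square algebra_simps)
  then have "ennreal (4 * (a * b)) \<le> ennreal ((a + b)\<^sup>2)" by (rule ennreal_leI)
  then show ?thesis using real_real by (simp add: ennreal_mult ennreal_power flip: ennreal_plus)
qed (auto simp: power2_eq_square ennreal_mult_top ennreal_top_mult)

text \<open>The bound on \<open>k\<close> forces \<open>f\<close> and \<open>g\<close> to be bounded
  unless one of them vanishes. Both can then be rescaled to supremum 1, and the arithmetic-geometric
  mean inequality turns the additive form into the multiplicative one.\<close>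

lemma prekopa_leindler:
  fixes f g k :: "real \<Rightarrow> real"
  assumes [measurable]: "f \<in> borel_measurable borel" "g \<in> borel_measurable borel" "k \<in> borel_measurable borel"
    and f: "\<And>x. 0 \<le> f x" and g: "\<And>x. 0 \<le> g x" and k: "\<And>x. 0 \<le> k x" "\<And>x. k x \<le> K"
    and le: "\<And>a b. f a * g b \<le> (k ((a + b) / 2))\<^sup>2"
  shows "(\<integral>\<^sup>+x. f x \<partial>lborel) * (\<integral>\<^sup>+x. g x \<partial>lborel) \<le> (\<integral>\<^sup>+x. k x \<partial>lborel)\<^sup>2"
proof (cases "(\<exists>a. f a > 0) \<and> (\<exists>b. g b > 0)")
  case False
  then have "(\<forall>x. f x = 0) \<or> (\<forall>x. g x = 0)" using f g by (metis order_le_less)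
  then show ?thesis by auto
next
  case True
  then obtain a0 b0 where a0: "0 < f a0" and b0: "0 < g b0" by blast
  have fg: "f a * g b \<le> K\<^sup>2" for a b
    using le[of a b] power_mono[OF k(2) k(1), of "(a+b)/2" 2] by simp
  have bddf: "bdd_above (range f)" using fg[of _ b0] b0 by (auto intro!: bdd_aboveI[of _ "K\<^sup>2 / g b0"] simp: field_simps)
  have bddg: "bdd_above (range g)" using fg[of a0] a0 by (auto intro!: bdd_aboveI[of _ "K\<^sup>2 / f a0"] simp: field_simps)
  define \<alpha> \<beta> where "\<alpha> = (SUP x. f x)" and "\<beta> = (SUP x. g x)"
  have fle: "f x \<le> \<alpha>" for x unfolding \<alpha>_def by (intro cSUP_upper bddf) auto
  have gle: "g x \<le> \<beta>" for x unfolding \<beta>_def by (intro cSUP_upper bddg) auto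
  have pos: "0 < \<alpha>" "0 < \<beta>" using a0 b0 fle[of a0] gle[of b0] by auto
  \<comment> \<open>The scale for \<open>k\<close> is forced by the pointwise hypothesis: dividing
    \<open>f\<close> by \<alpha> and \<open>g\<close> by \<beta> divides the square of
    \<open>k\<close> by \<alpha> \<beta>.\<close>
  define s where "s = sqrt (\<alpha> * \<beta>)"
  have s: "0 < s" "s\<^sup>2 = \<alpha> * \<beta>" using pos by (auto simp: s_def)
  have "(\<integral>\<^sup>+x. ennreal (f x / \<alpha>) \<partial>lborel) + (\<integral>\<^sup>+x. ennreal (g x / \<beta>) \<partial>lborel) \<le> 2 * (\<integral>\<^sup>+x. ennreal (k x / s) \<partial>lborel)"
  proof (rule prekopa_leindler_normalized)
    show "\<exists>x. t < f x / \<alpha>" if "t < 1" for t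
    proof -
      have "t * \<alpha> < \<alpha>" using that pos by simp
      then obtain x where "t * \<alpha> < f x" unfolding \<alpha>_def using less_cSUP_iff[OF _ bddf] by auto
      then show ?thesis using pos by (auto simp: field_simps)
    qed
    show "\<exists>x. t < g x / \<beta>" if "t < 1" for t
    proof -
      have "t * \<beta> < \<beta>" using that pos by simp
      then obtain x where "t * \<beta> < g x" unfolding \<beta>_def using less_cSUP_iff[OF _ bddg] by auto
      then show ?thesis using pos by (auto simp: field_simps)
    qed
    show "f a / \<alpha> * (g b / \<beta>) \<le> (k ((a + b) / 2) / s)\<^sup>2" for a b
      using le[of a b] pos by (simp add: power_divide s(2) divide_right_mono)
  qed (use pos f g k s fle gle in auto)
  moreover have "(\<integral>\<^sup>+x. ennreal (h x / c) \<partial>lborel) = ennreal (1/c) * (\<integral>\<^sup>+x. h x \<partial>lborel)"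
    if [measurable]: "h \<in> borel_measurable borel" and "\<And>x. 0 \<le> h x" "0 < c" for h :: "real \<Rightarrow> real" and c
  proof -
    have "(\<integral>\<^sup>+x. ennreal (h x / c) \<partial>lborel) = (\<integral>\<^sup>+x. ennreal (1/c) * ennreal (h x) \<partial>lborel)"
      using that by (intro nn_integral_cong) (simp flip: ennreal_mult)
    then show ?thesis by (simp add: nn_integral_cmult)
  qed
  ultimately have *: "ennreal (1/\<alpha>) * (\<integral>\<^sup>+x. f x \<partial>lborel) + ennreal (1/\<beta>) * (\<integral>\<^sup>+x. g x \<partial>lborel)
      \<le> 2 * (ennreal (1/s) * (\<integral>\<^sup>+x. k x \<partial>lborel))"
    using f g k pos s by simp
  define F G H where "F = (\<integral>\<^sup>+x. ennreal (f x) \<partial>lborel)" and "G = (\<integral>\<^sup>+x. ennreal (g x) \<partial>lborel)" and "H = (\<integral>\<^sup>+x. ennreal (k x) \<partial>lborel)"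
  have "4 * ((ennreal (1/\<alpha>) * F) * (ennreal (1/\<beta>) * G)) \<le> (ennreal (1/\<alpha>) * F + ennreal (1/\<beta>) * G)\<^sup>2"
    by (rule ennreal_four_mult_le_add_square)
  also have "\<dots> \<le> (2 * (ennreal (1/s) * H))\<^sup>2" using * unfolding F_def G_def H_def by (intro power_mono) auto
  also have "\<dots> = 4 * (ennreal (1/s\<^sup>2) * H\<^sup>2)"
    using s by (simp add: power_mult_distrib ennreal_power power_one_over)
  also have "ennreal (1/s\<^sup>2) = ennreal (1/\<alpha>) * ennreal (1/\<beta>)"
    using pos by (simp add: s(2) flip: ennreal_mult)
  finally have "4 * (ennreal (1/\<alpha>) * ennreal (1/\<beta>)) * (F * G) \<le> 4 * (ennreal (1/\<alpha>) * ennreal (1/\<beta>)) * H\<^sup>2"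
    by (simp only: mult_ac)
  moreover have "4 * (ennreal (1/\<alpha>) * ennreal (1/\<beta>)) = ennreal (4 / (\<alpha> * \<beta>))"
    using pos by (simp flip: ennreal_mult ennreal_numeral)
  ultimately have "F * G \<le> H\<^sup>2"
    using pos by (simp add: ennreal_mult_le_mult_iff)
  then show ?thesis by (simp add: F_def G_def H_def)
qed

section \<open>The Santalo inequality on the half line\<close>

lemma nn_integral_exp_substitution:
  fixes f :: "real \<Rightarrow> ennreal"
  assumes [measurable]: "f \<in> borel_measurable borel"
  shows "(\<integral>\<^sup>+s. indicator {0<..} s * f s \<partial>lborel) = (\<integral>\<^sup>+a. f (exp a) * ennreal (exp a) \<partial>lborel)"
proof -
  \<comment> \<open>Substitution is carried out on the compact intervals \<open>I i\<close>, with
    images \<open>J i\<close> under the exponential; monotone convergence passes to the half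
    line.\<close>
  define I where "I i = {- real (Suc i) .. real (Suc i)}" for i
  define J where "J i = {exp (- real (Suc i)) .. exp (real (Suc i))}" for i
  have I: "incseq I" "(\<Union>i. I i) = UNIV"
  proof -
    show "incseq I" by (auto simp: incseq_def I_def)
    show "(\<Union>i. I i) = UNIV"
    proof (intro equalityI subsetI)
      fix x :: real
      obtain i where "\<bar>x\<bar> \<le> real i" using real_arch_simple by blast
      then have "x \<in> I i" by (auto simp: I_def)
      then show "x \<in> (\<Union>i. I i)" by blast
    qed simp
  qed
  have JI: "J i = exp ` I i" for i
  proof (intro equalityI subsetI)
    fix x assume "x \<in> J i"
    then have "0 < x" by (auto simp: J_def intro: less_le_trans[OF exp_gt_zero])
    then have "ln x \<in> I i" using \<open>x \<in> J i\<close> ln_le_cancel_iff[of x "exp (real (Suc i))"]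
      by (simp add: J_def I_def ln_ge_iff del: of_nat_Suc)
    then show "x \<in> exp ` I i" using \<open>0 < x\<close> by (metis exp_ln imageI)
  next
    fix x assume "x \<in> exp ` I i"
    then show "x \<in> J i" unfolding J_def I_def by (auto simp del: of_nat_Suc)
  qed
  have J: "incseq J" "(\<Union>i. J i) = {0<..}"
  proof -
    show "incseq J" using I(1) unfolding JI incseq_def by blast
    have "(\<Union>i. J i) = range exp" unfolding JI using I(2) by (simp flip: image_UN)
    also have "\<dots> = {0::real<..}"
    proof (intro equalityI subsetI)
      fix x :: real assume "x \<in> {0<..}"
      then have "x = exp (ln x)" by simp
      then show "x \<in> range exp" by blast
    qed auto
    finally show "(\<Union>i. J i) = {0<..}" .
  qed
  have sup: "(\<integral>\<^sup>+x. g x * indicator (\<Union>i. X i) x \<partial>lborel) = (SUP i. (\<integral>\<^sup>+x. g x * indicator (X i) x \<partial>lborel))"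
    if [measurable]: "g \<in> borel_measurable borel" "\<And>i. X i \<in> sets borel" and X: "incseq X"
    for g :: "real \<Rightarrow> ennreal" and X :: "nat \<Rightarrow> real set"
  proof -
    have "g x * indicator (\<Union>i. X i) x = (SUP i. g x * indicator (X i) x)" for x
    proof (cases "x \<in> (\<Union>i. X i)")
      case True
      then obtain j where j: "x \<in> X j" by blast
      show ?thesis
        by (rule antisym) (use True j in \<open>auto intro!: SUP_upper2[of j] SUP_least simp: indicator_def\<close>)
    qed (auto simp: indicator_def)
    moreover have "incseq (\<lambda>i x. g x * indicator (X i) x)"
      using X by (auto simp: incseq_def le_fun_def indicator_def)
    ultimately show ?thesis
      by (simp add: nn_integral_monotone_convergence_SUP)
  qed
  have "(\<integral>\<^sup>+s. indicator {0<..} s * f s \<partial>lborel) = (SUP i. (\<integral>\<^sup>+x. f x * indicator (J i) x \<partial>lborel))"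
    using sup[of f J] J by (simp add: J_def mult.commute)
  also have "\<dots> = (SUP i. (\<integral>\<^sup>+x. f (exp x) * ennreal (exp x) * indicator (I i) x \<partial>lborel))"
    unfolding J_def I_def
    by (intro SUP_cong refl nn_integral_substitution_aux)
       (auto intro!: derivative_eq_intros continuous_intros)
  also have "\<dots> = (\<integral>\<^sup>+a. f (exp a) * ennreal (exp a) \<partial>lborel)"
    using sup[of "\<lambda>x. f (exp x) * ennreal (exp x)" I] I by (simp add: I_def)
  finally show ?thesis .
qed

lemma nn_integral_half_gaussian:
  "(\<integral>\<^sup>+s. indicator {0<..} s * ennreal (exp (- (s\<^sup>2 / 2))) \<partial>lborel) = ennreal (sqrt (pi / 2))"
proof -
  have "(\<integral>\<^sup>+s. indicator {0<..} s * ennreal (exp (- (s\<^sup>2 / 2))) \<partial>lborel)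
      = ennreal (sqrt 2) * (\<integral>\<^sup>+s. indicator {0<..} (sqrt 2 * s) * ennreal (exp (- ((sqrt 2 * s)\<^sup>2 / 2))) \<partial>lborel)"
    by (subst nn_integral_real_affine[where c="sqrt 2" and t=0]) auto
  also have "(\<integral>\<^sup>+s. indicator {0<..} (sqrt 2 * s) * ennreal (exp (- ((sqrt 2 * s)\<^sup>2 / 2))) \<partial>lborel)
      = (\<integral>\<^sup>+s. ennreal (indicator {0..} s *\<^sub>R exp (- s\<^sup>2)) \<partial>lborel)"
  proof (rule nn_integral_cong_AE, rule AE_mp[OF AE_lborel_singleton[of 0]], rule AE_I2, rule impI)
    fix s :: real assume "s \<noteq> 0"
    have "(sqrt 2 * s)\<^sup>2 / 2 = s\<^sup>2" by (simp add: power_mult_distrib)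
    moreover have "indicator {0<..} (sqrt 2 * s) = (indicator {0..} s :: ennreal)"
      using \<open>s \<noteq> 0\<close> by (auto simp: indicator_def zero_less_mult_iff)
    ultimately show "indicator {0<..} (sqrt 2 * s) * ennreal (exp (- ((sqrt 2 * s)\<^sup>2 / 2)))
        = ennreal (indicator {0..} s *\<^sub>R exp (- s\<^sup>2))"
      by (simp only:) (simp add: indicator_def)
  qed
  also have "\<dots> = ennreal (sqrt pi / 2)"
    using gaussian_moment_0 nn_integral_eq_integral[of lborel "\<lambda>x::real. indicator {0..} x *\<^sub>R exp (- x\<^sup>2)"]
    by (simp add: has_bochner_integral_iff)
  also have "ennreal (sqrt 2) * \<dots> = ennreal (sqrt 2 * (sqrt pi / 2))"
    by (rule ennreal_mult[symmetric]) auto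
  also have "sqrt 2 * (sqrt pi / 2) = sqrt (pi / 2)"
  proof -
    have "(sqrt 2 * (sqrt pi / 2))\<^sup>2 = pi / 2" by (simp add: power_mult_distrib power_divide)
    then show ?thesis by (intro real_sqrt_unique[symmetric]) auto
  qed
  finally show ?thesis .
qed

text \<open>In the coordinates s = exp a, t = exp b the geometric mean of s and t becomes the
  exponential of the midpoint of a and b. The hypothesis then is that of Prekopa-Leindler, with the
  half Gaussian as the middle function; pi / 2 is the square of its integral.\<close>

lemma half_line_santalo:
  fixes f g :: "real \<Rightarrow> ennreal"
  assumes [measurable]: "f \<in> borel_measurable borel" "g \<in> borel_measurable borel"
    and le: "\<And>s t. 0 < s \<Longrightarrow> 0 < t \<Longrightarrow> f s * g t \<le> c * ennreal (exp (- (s * t)))"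
  shows "(\<integral>\<^sup>+s. indicator {0<..} s * f s \<partial>lborel) * (\<integral>\<^sup>+t. indicator {0<..} t * g t \<partial>lborel)
       \<le> c * ennreal (pi / 2)"
proof (cases c)
  case top
  then show ?thesis by (simp add: ennreal_top_mult)
next
  case (real c')
  define u where "u a = f (exp a) * ennreal (exp a)" for a
  define v where "v a = g (exp a) * ennreal (exp a)" for a
  define k where "k a = sqrt c' * (exp (- (exp a)\<^sup>2 / 2) * exp a)" for a :: real
  have meas[measurable]: "u \<in> borel_measurable borel" "v \<in> borel_measurable borel" "k \<in> borel_measurable borel"
    unfolding u_def v_def k_def by measurable
  have uv: "u a * v b \<le> ennreal ((k ((a + b) / 2))\<^sup>2)" for a b
  proof -
    have eq: "(exp ((a + b) / 2))\<^sup>2 = exp a * exp b"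
      by (metis exp_add exp_double field_sum_of_halves mult_2)
    have eq': "(exp (- (exp a * exp b) / 2))\<^sup>2 = exp (- (exp a * exp b))"
      by (simp flip: exp_double)
    have "u a * v b = (f (exp a) * g (exp b)) * ennreal (exp a * exp b)"
      by (simp add: u_def v_def ennreal_mult mult_ac)
    also have "\<dots> \<le> c * ennreal (exp (- (exp a * exp b))) * ennreal (exp a * exp b)"
      by (intro mult_right_mono le) auto
    also have "\<dots> = ennreal (c' * exp (- (exp a * exp b)) * (exp a * exp b))"
      using real by (simp add: ennreal_mult)
    also have "c' * exp (- (exp a * exp b)) * (exp a * exp b) = (k ((a + b) / 2))\<^sup>2"
      using real by (simp only: k_def power_mult_distrib eq eq') simp
    finally show ?thesis .
  qed
  have eq: "(\<integral>\<^sup>+s. indicator {0<..} s * f s \<partial>lborel) = integral\<^sup>N lborel u"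
    "(\<integral>\<^sup>+s. indicator {0<..} s * g s \<partial>lborel) = integral\<^sup>N lborel v"
    unfolding u_def v_def by (simp_all add: nn_integral_exp_substitution)
  have k: "(\<integral>\<^sup>+a. k a \<partial>lborel)\<^sup>2 = c * ennreal (pi / 2)"
  proof -
    have "(\<integral>\<^sup>+a. k a \<partial>lborel) = ennreal (sqrt c') * (\<integral>\<^sup>+a. ennreal (exp (- (exp a)\<^sup>2 / 2)) * ennreal (exp a) \<partial>lborel)"
      unfolding k_def using real by (subst nn_integral_cmult[symmetric]) (auto simp: ennreal_mult)
    also have "(\<integral>\<^sup>+a. ennreal (exp (- (exp a)\<^sup>2 / 2)) * ennreal (exp a) \<partial>lborel) = ennreal (sqrt (pi / 2))"
      using nn_integral_half_gaussian by (subst (asm) nn_integral_exp_substitution) auto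
    finally show ?thesis using real
      by (simp add: power_mult_distrib ennreal_power)
  qed
  show ?thesis
  proof (cases "(\<forall>a. u a \<noteq> \<infinity>) \<and> (\<forall>a. v a \<noteq> \<infinity>)")
    case True
    then have uvr: "u a = ennreal (enn2real (u a))" "v a = ennreal (enn2real (v a))" for a
      by (auto simp: less_top)
    have "(\<integral>\<^sup>+a. enn2real (u a) \<partial>lborel) * (\<integral>\<^sup>+a. enn2real (v a) \<partial>lborel) \<le> (\<integral>\<^sup>+a. k a \<partial>lborel)\<^sup>2"
    proof (rule prekopa_leindler)
      show "enn2real (u a) * enn2real (v b) \<le> (k ((a + b) / 2))\<^sup>2" for a b
        using uv[of a b] by (subst (asm) uvr(1), subst (asm) uvr(2)) (simp flip: ennreal_mult)
      show "0 \<le> k a" for a using real by (simp add: k_def)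
      show "k a \<le> sqrt c'" for a
      proof -
        have "exp a \<le> 1 + (exp a)\<^sup>2 / 2"
          using zero_le_power2[of "exp a - 1"] by (simp add: power2_diff)
        also have "\<dots> \<le> exp ((exp a)\<^sup>2 / 2)" by (rule exp_ge_add_one_self)
        finally have "exp (- (exp a)\<^sup>2 / 2) * exp a \<le> exp (- (exp a)\<^sup>2 / 2) * exp ((exp a)\<^sup>2 / 2)"
          by (rule mult_left_mono) simp
        also have "\<dots> = 1" by (simp flip: exp_add)
        finally have "sqrt c' * (exp (- (exp a)\<^sup>2 / 2) * exp a) \<le> sqrt c' * 1"
          using real by (intro mult_left_mono) auto
        then show ?thesis by (simp add: k_def)
      qed
    qed auto
    then show ?thesis unfolding eq k using uvr by simp
  next
    case False
    \<comment> \<open>One infinite value of \<open>u\<close> or \<open>v\<close> forces the other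
      function to vanish identically, because \<open>uv\<close> bounds every product by a finite
      number.\<close>
    have "(\<forall>a. u a = 0) \<or> (\<forall>b. v b = 0)"
      using False uv by (metis ennreal_mult_eq_top_iff ennreal_neq_top infinity_ennreal_def top.extremum_unique)
    then have "integral\<^sup>N lborel u = 0 \<or> integral\<^sup>N lborel v = 0"
      by (simp add: nn_integral_0_iff_AE) blast
    then show ?thesis unfolding eq by auto
  qed
qed

section \<open>The functional Santalo inequality by induction on the dimension\<close>

lemma space_PiM_lborel: "space (\<Pi>\<^sub>M i\<in>I. lborel :: real measure) = extensional I"
  by (auto simp: space_PiM PiE_def)

lemma nn_integral_PiM_lborel_translate:
  fixes f :: "('i \<Rightarrow> real) \<Rightarrow> ennreal" and c :: "'i \<Rightarrow> real"
  assumes "finite I" "f \<in> borel_measurable (\<Pi>\<^sub>M i\<in>I. lborel)"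
  shows "(\<integral>\<^sup>+x. f (\<lambda>i\<in>I. x i + c i) \<partial>(\<Pi>\<^sub>M i\<in>I. lborel)) = (\<integral>\<^sup>+x. f x \<partial>(\<Pi>\<^sub>M i\<in>I. lborel))"
  using assms
proof (induction I arbitrary: f rule: finite_induct)
  case empty
  then show ?case by (simp add: PiM_empty nn_integral_count_space_finite)
next
  case (insert j I)
  interpret product_sigma_finite "\<lambda>_::'i. lborel :: real measure" by standard
  note [measurable] = insert.prems and [simp] = insert.hyps
  have [measurable]: "(\<lambda>x. \<lambda>i\<in>insert j I. x i + c i) \<in> (\<Pi>\<^sub>M i\<in>insert j I. lborel) \<rightarrow>\<^sub>M (\<Pi>\<^sub>M i\<in>insert j I. lborel)"
    by (intro measurable_restrict) simp
  have "(\<integral>\<^sup>+x. f (\<lambda>i\<in>insert j I. x i + c i) \<partial>(\<Pi>\<^sub>M i\<in>insert j I. lborel))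
      = (\<integral>\<^sup>+x. (\<integral>\<^sup>+y. f (\<lambda>i\<in>insert j I. (x(j := y)) i + c i) \<partial>lborel) \<partial>(\<Pi>\<^sub>M i\<in>I. lborel))"
    by (rule product_nn_integral_insert) auto
  also have "\<dots> = (\<integral>\<^sup>+x. (\<integral>\<^sup>+y. f ((\<lambda>i\<in>I. x i + c i)(j := y)) \<partial>lborel) \<partial>(\<Pi>\<^sub>M i\<in>I. lborel))"
  proof (rule nn_integral_cong)
    fix x :: "'i \<Rightarrow> real"
    have eq: "(\<lambda>i\<in>insert j I. (x(j := y)) i + c i) = (\<lambda>i\<in>I. x i + c i)(j := c j + 1 * y)" for y
      using insert.hyps by (auto simp: fun_eq_iff)
    have [measurable]: "(\<lambda>y. f ((\<lambda>i\<in>I. x i + c i)(j := y))) \<in> borel_measurable borel"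
    proof -
      have "(\<lambda>y. (\<lambda>i\<in>I. x i + c i)(j := y)) \<in> lborel \<rightarrow>\<^sub>M (\<Pi>\<^sub>M i\<in>insert j I. lborel)"
        using insert.hyps by (intro measurable_component_update) (auto simp: space_PiM_lborel extensional_def)
      from measurable_compose[OF this insert.prems] show ?thesis by (simp only: measurable_lborel2)
    qed
    show "(\<integral>\<^sup>+y. f (\<lambda>i\<in>insert j I. (x(j := y)) i + c i) \<partial>lborel) = (\<integral>\<^sup>+y. f ((\<lambda>i\<in>I. x i + c i)(j := y)) \<partial>lborel)"
      unfolding eq
      using nn_integral_real_affine[where c=1 and t="c j" and f="\<lambda>y. f ((\<lambda>i\<in>I. x i + c i)(j := y))"]
        \<open>(\<lambda>y. f ((\<lambda>i\<in>I. x i + c i)(j := y))) \<in> borel_measurable borel\<close> by simp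
  qed
  also have "\<dots> = (\<integral>\<^sup>+x. (\<integral>\<^sup>+y. f (x(j := y)) \<partial>lborel) \<partial>(\<Pi>\<^sub>M i\<in>I. lborel))"
  proof (rule insert.IH)
    have [measurable]: "(\<lambda>p. (fst p)(j := snd p)) \<in> (\<Pi>\<^sub>M i\<in>I. lborel) \<Otimes>\<^sub>M lborel \<rightarrow>\<^sub>M (\<Pi>\<^sub>M i\<in>insert j I. lborel :: real measure)"
      using measurable_add_dim[of j I "\<lambda>_. lborel :: real measure"] by (simp add: split_beta')
    show "(\<lambda>x. \<integral>\<^sup>+y. f (x(j := y)) \<partial>lborel) \<in> borel_measurable (\<Pi>\<^sub>M i\<in>I. lborel)"
      using measurable_compose[OF \<open>(\<lambda>p. (fst p)(j := snd p)) \<in> _\<close> insert.prems]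
      by (intro lborel.borel_measurable_nn_integral) (simp add: split_beta')
  qed
  also have "\<dots> = (\<integral>\<^sup>+x. f x \<partial>(\<Pi>\<^sub>M i\<in>insert j I. lborel))"
    by (rule product_nn_integral_insert[symmetric]) auto
  finally show ?case .
qed

text \<open>By Fubini the integral over \<open>s\<close> can be taken last; for fixed
  \<open>s\<close> the shear is a translation of the remaining coordinates.\<close>

lemma nn_integral_PiM_lborel_shear:
  fixes H :: "('i \<Rightarrow> real) \<Rightarrow> ennreal" and c :: "real \<Rightarrow> 'i \<Rightarrow> real"
  assumes I: "finite I" "j \<notin> I" and [measurable]: "H \<in> borel_measurable (\<Pi>\<^sub>M i\<in>insert j I. lborel)"
    and [measurable]: "\<And>i. (\<lambda>s. c s i) \<in> borel_measurable borel"
  shows "(\<integral>\<^sup>+y. (\<integral>\<^sup>+s. H ((\<lambda>i\<in>I. y i + c s i)(j := s)) \<partial>lborel) \<partial>(\<Pi>\<^sub>M i\<in>I. lborel))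
       = (\<integral>\<^sup>+x. H x \<partial>(\<Pi>\<^sub>M i\<in>insert j I. lborel))"
proof -
  interpret product_sigma_finite "\<lambda>_::'i. lborel :: real measure" by standard
  interpret pair_sigma_finite "\<Pi>\<^sub>M i\<in>I. lborel :: real measure" "lborel :: real measure"
    using sigma_finite[OF I(1)] by (simp add: pair_sigma_finite_def lborel.sigma_finite_measure_axioms)
  have [measurable]: "(\<lambda>p. (\<lambda>i\<in>I. fst p i + c (snd p) i)(j := snd p))
      \<in> (\<Pi>\<^sub>M i\<in>I. lborel) \<Otimes>\<^sub>M lborel \<rightarrow>\<^sub>M (\<Pi>\<^sub>M i\<in>insert j I. lborel)"
  proof -
    have "(\<lambda>p. (\<lambda>i\<in>I. fst p i + c (snd p) i)(j := snd p))
        = (\<lambda>p. \<lambda>i\<in>insert j I. if i = j then snd p else fst p i + c (snd p) i)"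
      using I by (auto simp: fun_eq_iff)
    moreover have "\<dots> \<in> (\<Pi>\<^sub>M i\<in>I. lborel) \<Otimes>\<^sub>M lborel \<rightarrow>\<^sub>M (\<Pi>\<^sub>M i\<in>insert j I. lborel)"
      by (intro measurable_restrict) auto
    ultimately show ?thesis by simp
  qed
  have "(\<integral>\<^sup>+y. (\<integral>\<^sup>+s. H ((\<lambda>i\<in>I. y i + c s i)(j := s)) \<partial>lborel) \<partial>(\<Pi>\<^sub>M i\<in>I. lborel))
      = (\<integral>\<^sup>+s. (\<integral>\<^sup>+y. H ((\<lambda>i\<in>I. y i + c s i)(j := s)) \<partial>(\<Pi>\<^sub>M i\<in>I. lborel)) \<partial>lborel)"
    using Fubini'[of "\<lambda>y s. H ((\<lambda>i\<in>I. y i + c s i)(j := s))"] by (simp add: split_beta')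
  also have "\<dots> = (\<integral>\<^sup>+s. (\<integral>\<^sup>+y. H (y(j := s)) \<partial>(\<Pi>\<^sub>M i\<in>I. lborel)) \<partial>lborel)"
    using I by (intro nn_integral_cong nn_integral_PiM_lborel_translate) auto
  also have "\<dots> = (\<integral>\<^sup>+x. H x \<partial>(\<Pi>\<^sub>M i\<in>insert j I. lborel))"
    using I by (intro product_nn_integral_insert_rev[symmetric]) auto
  finally show ?thesis .
qed

text \<open>The sign \<sigma> selects one of the two half-lines ending at \<open>m\<close>, so that
  both halves of a bisected function are treated by the same argument.\<close>

lemma nn_integral_half_line_affine:
  fixes f :: "real \<Rightarrow> ennreal"
  assumes [measurable]: "f \<in> borel_measurable borel" and \<sigma>: "\<bar>\<sigma>\<bar> = 1"
  shows "(\<integral>\<^sup>+s. indicator {0<..} s * f (m + \<sigma> * s) \<partial>lborel) = (\<integral>\<^sup>+x. indicator {x. 0 < \<sigma> * (x - m)} x * f x \<partial>lborel)"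
proof -
  have "\<sigma> * \<sigma> = 1" using \<sigma> by (metis abs_mult_self_eq mult_1)
  then have "\<sigma> * (m + \<sigma> * s - m) = s" for s by (simp flip: mult.assoc)
  then have "(\<lambda>s. indicator {x. 0 < \<sigma> * (x - m)} (m + \<sigma> * s) * f (m + \<sigma> * s)) = (\<lambda>s. indicator {0<..} s * f (m + \<sigma> * s))"
    by (simp only: indicator_def mem_Collect_eq greaterThan_iff)
  then show ?thesis
    using \<sigma> by (subst (2) nn_integral_real_affine[where c=\<sigma> and t=m]) auto
qed

text \<open>The functional Santalo inequality in the coordinates \<open>I\<close>, with
  \<open>F\<close> alone centered. Centering is expressed by exponential tilts: the trivial tilt has
  the least integral. For integrable \<open>F\<close> with finite exponential moments this says that
  the barycenter is the origin, but the condition makes sense for every measurable \<open>F\<close>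
  and passes directly to marginals along sheared lines.\<close>

definition santalo_on :: "'i set \<Rightarrow> bool" where
  "santalo_on I \<longleftrightarrow> (\<forall>F G c.
     F \<in> borel_measurable (\<Pi>\<^sub>M i\<in>I. lborel) \<longrightarrow> G \<in> borel_measurable (\<Pi>\<^sub>M i\<in>I. lborel) \<longrightarrow>
     (\<forall>x\<in>extensional I. \<forall>y\<in>extensional I. F x * G y \<le> c * ennreal (exp (- (\<Sum>i\<in>I. x i * y i)))) \<longrightarrow>
     (\<forall>z. (\<integral>\<^sup>+x. F x \<partial>(\<Pi>\<^sub>M i\<in>I. lborel)) \<le> (\<integral>\<^sup>+x. F x * ennreal (exp (\<Sum>i\<in>I. z i * x i)) \<partial>(\<Pi>\<^sub>M i\<in>I. lborel))) \<longrightarrow>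
     (\<integral>\<^sup>+x. F x \<partial>(\<Pi>\<^sub>M i\<in>I. lborel)) * (\<integral>\<^sup>+x. G x \<partial>(\<Pi>\<^sub>M i\<in>I. lborel)) \<le> c * ennreal ((2 * pi) ^ card I))"

text \<open>The half-space is fibred by half-lines parallel to the vector with coordinates
  \<open>v\<close> on \<open>I\<close> and 1 at \<open>j\<close>. The dual half-space consists of
  the \<open>y\<close> whose pairing with that vector has the sign \<sigma>, and is fibred parallel
  to the \<open>j\<close>-axis. In these parameters the pairing splits into \<open>s * t\<close>
  plus the pairing of the base points, so the half-line inequality bounds \<open>F1 x * G1 y\<close>
  at the cost of a factor pi / 2. The hypothesis \<open>cent\<close> is the centering of
  \<open>F1\<close> that the induction hypothesis asks for.\<close>

lemma santalo_half_space:
  fixes F G :: "('i \<Rightarrow> real) \<Rightarrow> ennreal" and v z :: "'i \<Rightarrow> real"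
  assumes I: "finite I" "j \<notin> I" and P: "santalo_on I" and \<sigma>: "\<bar>\<sigma>\<bar> = 1"
    and F[measurable]: "F \<in> borel_measurable (\<Pi>\<^sub>M i\<in>insert j I. lborel)"
    and G[measurable]: "G \<in> borel_measurable (\<Pi>\<^sub>M i\<in>insert j I. lborel)"
    and le: "\<And>x y. x \<in> extensional (insert j I) \<Longrightarrow> y \<in> extensional (insert j I) \<Longrightarrow>
      F x * G y \<le> c * ennreal (exp (- (\<Sum>i\<in>insert j I. (x i - z i) * y i)))"
    and cent: "\<And>\<zeta>. (\<integral>\<^sup>+x. indicator {x. 0 < \<sigma> * (x j - z j)} x * F x \<partial>(\<Pi>\<^sub>M i\<in>insert j I. lborel))
      \<le> (\<integral>\<^sup>+x. indicator {x. 0 < \<sigma> * (x j - z j)} x * F x *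
            ennreal (exp (\<Sum>i\<in>I. \<zeta> i * (x i - z i - (x j - z j) * v i))) \<partial>(\<Pi>\<^sub>M i\<in>insert j I. lborel))"
  shows "(\<integral>\<^sup>+x. indicator {x. 0 < \<sigma> * (x j - z j)} x * F x \<partial>(\<Pi>\<^sub>M i\<in>insert j I. lborel)) *
      (\<integral>\<^sup>+y. indicator {y. 0 < \<sigma> * (y j + (\<Sum>i\<in>I. v i * y i))} y * G y \<partial>(\<Pi>\<^sub>M i\<in>insert j I. lborel))
      \<le> c * ennreal (pi / 2) * ennreal ((2 * pi) ^ card I)"
proof -
  interpret product_sigma_finite "\<lambda>_::'i. lborel :: real measure" by standard
  have ss: "\<sigma> * \<sigma> = 1" using \<sigma> by (metis abs_mult_self_eq mult_1)
  \<comment> \<open>Not the logarithm: \<open>ln y\<close> is the line through the translate of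
    \<open>y\<close> by \<open>z\<close> with direction \<open>v\<close> on \<open>I\<close> and 1
    at \<open>j\<close>, parametrized by its \<open>j\<close>-th coordinate.\<close>
  define ln where "ln y s = (\<lambda>i\<in>I. y i + (z i + (s - z j) * v i))(j := s)" for y :: "'i \<Rightarrow> real" and s
  have ln_ext: "ln y s \<in> extensional (insert j I)" for y s by (auto simp: ln_def extensional_def)
  have ln_meas[measurable]: "(\<lambda>p. ln (fst p) (snd p)) \<in> (\<Pi>\<^sub>M i\<in>I. lborel) \<Otimes>\<^sub>M lborel \<rightarrow>\<^sub>M (\<Pi>\<^sub>M i\<in>insert j I. lborel)"
  proof -
    have "(\<lambda>p. ln (fst p) (snd p))
        = (\<lambda>p. \<lambda>i\<in>insert j I. if i = j then snd p else fst p i + (z i + (snd p - z j) * v i))"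
      using I by (auto simp: fun_eq_iff ln_def)
    moreover have "\<dots> \<in> (\<Pi>\<^sub>M i\<in>I. lborel) \<Otimes>\<^sub>M lborel \<rightarrow>\<^sub>M (\<Pi>\<^sub>M i\<in>insert j I. lborel)"
      by (intro measurable_restrict) auto
    ultimately show ?thesis by simp
  qed
  have ln_meas1[measurable]: "ln y \<in> borel \<rightarrow>\<^sub>M (\<Pi>\<^sub>M i\<in>insert j I. lborel)" if "y \<in> extensional I" for y
    using measurable_compose[OF measurable_Pair1' ln_meas, of y] that by (simp add: space_PiM_lborel)
  have upd_meas1[measurable]: "(\<lambda>t. y(j := t)) \<in> borel \<rightarrow>\<^sub>M (\<Pi>\<^sub>M i\<in>insert j I. lborel)" if "y \<in> extensional I" for y :: "'i \<Rightarrow> real"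
    using measurable_component_update[of y I "\<lambda>_. lborel" j] that I by (simp add: space_PiM_lborel)
  have upd_ext: "y(j := t) \<in> extensional (insert j I)" if "y \<in> extensional I" for y :: "'i \<Rightarrow> real" and t
    using that by (auto simp: extensional_def)
  define F1 where "F1 y = (\<integral>\<^sup>+s. indicator {s. 0 < \<sigma> * (s - z j)} s * F (ln y s) \<partial>lborel)" for y
  define G1 where "G1 y = (\<integral>\<^sup>+t. indicator {t. 0 < \<sigma> * (t + (\<Sum>i\<in>I. v i * y i))} t * G (y(j := t)) \<partial>lborel)" for y
  have [measurable]: "F1 \<in> borel_measurable (\<Pi>\<^sub>M i\<in>I. lborel)" "G1 \<in> borel_measurable (\<Pi>\<^sub>M i\<in>I. lborel)"
    unfolding F1_def G1_def by measurable
  have shear: "(\<integral>\<^sup>+y. (\<integral>\<^sup>+s. H (ln y s) \<partial>lborel) \<partial>(\<Pi>\<^sub>M i\<in>I. lborel)) = (\<integral>\<^sup>+x. H x \<partial>(\<Pi>\<^sub>M i\<in>insert j I. lborel))"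
    if [measurable]: "H \<in> borel_measurable (\<Pi>\<^sub>M i\<in>insert j I. lborel)" for H
    unfolding ln_def by (rule nn_integral_PiM_lborel_shear[OF I]) auto
  have intF: "(\<integral>\<^sup>+y. F1 y \<partial>(\<Pi>\<^sub>M i\<in>I. lborel)) = (\<integral>\<^sup>+x. indicator {x. 0 < \<sigma> * (x j - z j)} x * F x \<partial>(\<Pi>\<^sub>M i\<in>insert j I. lborel))"
    by (subst shear[symmetric], measurable) (simp add: F1_def[abs_def] ln_def indicator_def)
  have intG: "(\<integral>\<^sup>+y. G1 y \<partial>(\<Pi>\<^sub>M i\<in>I. lborel)) = (\<integral>\<^sup>+y. indicator {y. 0 < \<sigma> * (y j + (\<Sum>i\<in>I. v i * y i))} y * G y \<partial>(\<Pi>\<^sub>M i\<in>insert j I. lborel))"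
  proof -
    have sum_eq: "(\<Sum>i\<in>I. v i * (if i = j then t else y i)) = (\<Sum>i\<in>I. v i * y i)" for y :: "'i \<Rightarrow> real" and t
      using I by (intro sum.cong) auto
    show ?thesis
      using I by (subst product_nn_integral_insert) (auto simp: G1_def[abs_def] indicator_def sum_eq)
  qed
  have intFe: "(\<integral>\<^sup>+y. F1 y * ennreal (exp (\<Sum>i\<in>I. \<zeta> i * y i)) \<partial>(\<Pi>\<^sub>M i\<in>I. lborel))
      = (\<integral>\<^sup>+x. indicator {x. 0 < \<sigma> * (x j - z j)} x * F x *
            ennreal (exp (\<Sum>i\<in>I. \<zeta> i * (x i - z i - (x j - z j) * v i))) \<partial>(\<Pi>\<^sub>M i\<in>insert j I. lborel))" for \<zeta>
  proof (subst shear[symmetric], measurable, rule nn_integral_cong)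
    fix y :: "'i \<Rightarrow> real" assume "y \<in> space (\<Pi>\<^sub>M i\<in>I. lborel)"
    then have y: "y \<in> extensional I" by (simp add: space_PiM_lborel)
    have "(\<Sum>i\<in>I. \<zeta> i * (ln y s i - z i - (ln y s j - z j) * v i)) = (\<Sum>i\<in>I. \<zeta> i * y i)" for s
      using I by (intro sum.cong) (auto simp: ln_def)
    then show "F1 y * ennreal (exp (\<Sum>i\<in>I. \<zeta> i * y i)) =
      (\<integral>\<^sup>+s. indicator {x. 0 < \<sigma> * (x j - z j)} (ln y s) * F (ln y s) *
            ennreal (exp (\<Sum>i\<in>I. \<zeta> i * (ln y s i - z i - (ln y s j - z j) * v i))) \<partial>lborel)"
      unfolding F1_def using y by (subst nn_integral_multc[symmetric]) (auto simp: ln_def indicator_def)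
  qed
  have bound: "F1 x * G1 y \<le> c * ennreal (pi / 2) * ennreal (exp (- (\<Sum>i\<in>I. x i * y i)))"
    if x: "x \<in> extensional I" and y: "y \<in> extensional I" for x y
  proof -
    define w where "w = (\<Sum>i\<in>I. v i * y i)"
    have "F1 x = (\<integral>\<^sup>+s. indicator {0<..} s * F (ln x (z j + \<sigma> * s)) \<partial>lborel)"
      unfolding F1_def using nn_integral_half_line_affine[OF _ \<sigma>, of "\<lambda>s. F (ln x s)" "z j"] x by simp
    moreover have "G1 y = (\<integral>\<^sup>+t. indicator {0<..} t * G (y(j := - w + \<sigma> * t)) \<partial>lborel)"
      unfolding G1_def w_def[symmetric]
      using nn_integral_half_line_affine[OF _ \<sigma>, of "\<lambda>t. G (y(j := t))" "- w"] y by simp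
    moreover have "(\<integral>\<^sup>+s. indicator {0<..} s * F (ln x (z j + \<sigma> * s)) \<partial>lborel) *
        (\<integral>\<^sup>+t. indicator {0<..} t * G (y(j := - w + \<sigma> * t)) \<partial>lborel) \<le> c * ennreal (exp (- (\<Sum>i\<in>I. x i * y i))) * ennreal (pi / 2)"
    proof (rule half_line_santalo)
      fix s t :: real
      \<comment> \<open>Measuring the dual parameter from \<open>- w\<close> cancels the cross term
        between \<open>s\<close> and the pairing of \<open>v\<close> with \<open>y\<close>; since
        \<sigma> squared is 1, only \<open>s * t\<close> remains beside the pairing of the base
        points.\<close>
      have "(\<Sum>i\<in>insert j I. (ln x (z j + \<sigma> * s) i - z i) * (y(j := - w + \<sigma> * t)) i)
          = \<sigma> * s * (- w + \<sigma> * t) + (\<Sum>i\<in>I. (x i + \<sigma> * s * v i) * y i)"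
      proof -
        have "(\<Sum>i\<in>I. (ln x (z j + \<sigma> * s) i - z i) * (y(j := - w + \<sigma> * t)) i) = (\<Sum>i\<in>I. (x i + \<sigma> * s * v i) * y i)"
          using I by (intro sum.cong) (auto simp: ln_def)
        then show ?thesis using I by (simp add: ln_def)
      qed
      also have "\<dots> = (\<Sum>i\<in>I. x i * y i) + (\<sigma> * \<sigma>) * (s * t)"
        by (simp add: w_def algebra_simps sum.distrib sum_distrib_left)
      finally have eq: "(\<Sum>i\<in>insert j I. (ln x (z j + \<sigma> * s) i - z i) * (y(j := - w + \<sigma> * t)) i) = (\<Sum>i\<in>I. x i * y i) + s * t"
        by (simp add: ss)
      show "F (ln x (z j + \<sigma> * s)) * G (y(j := - w + \<sigma> * t)) \<le> c * ennreal (exp (- (\<Sum>i\<in>I. x i * y i))) * ennreal (exp (- (s * t)))"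
        using le[OF ln_ext[of x "z j + \<sigma> * s"] upd_ext[OF y, of "- w + \<sigma> * t"]] unfolding eq
        by (simp add: exp_add exp_diff ennreal_mult[symmetric] mult.assoc exp_minus field_simps)
    qed (use x y in measurable)
    ultimately show ?thesis by (simp add: mult_ac)
  qed
  have "(\<integral>\<^sup>+y. F1 y \<partial>(\<Pi>\<^sub>M i\<in>I. lborel)) * (\<integral>\<^sup>+y. G1 y \<partial>(\<Pi>\<^sub>M i\<in>I. lborel)) \<le> c * ennreal (pi / 2) * ennreal ((2 * pi) ^ card I)"
    using P[unfolded santalo_on_def, rule_format, of F1 G1 "c * ennreal (pi / 2)"] bound cent
    unfolding intF intFe by simp
  then show ?thesis unfolding intF intG .
qed

text \<open>Integrate exp l \<ge> 1 + l over \<open>A\<close>. This turns a vanishing first moment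
  into the tilt form of centering used in \<open>santalo_on\<close>.\<close>

lemma (in finite_measure) emeasure_le_nn_integral_exp:
  fixes l :: "'a \<Rightarrow> real"
  assumes [measurable]: "A \<in> sets M" and l: "integrable M l" and 0: "(\<integral>x. indicator A x * l x \<partial>M) = 0"
  shows "emeasure M A \<le> (\<integral>\<^sup>+x. indicator A x * ennreal (exp (l x)) \<partial>M)"
proof -
  have [measurable]: "l \<in> borel_measurable M" using l by auto
  have eq: "(\<integral>\<^sup>+x. indicator A x * ennreal (exp (l x)) \<partial>M) = (\<integral>\<^sup>+x. ennreal (indicator A x * exp (l x)) \<partial>M)"
    by (intro nn_integral_cong) (simp add: indicator_def)
  show ?thesis
  proof (cases "(\<integral>\<^sup>+x. ennreal (indicator A x * exp (l x)) \<partial>M) = \<infinity>")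
    case False
    then have int: "integrable M (\<lambda>x. indicator A x * exp (l x))"
      by (intro integrableI_nonneg) (auto simp: less_top)
    have int_1: "integrable M (indicat_real A)"
      by (auto simp: less_top[symmetric])
  have int_l: "integrable M (\<lambda>x. indicator A x * l x)"
      using integrable_mult_indicator[OF \<open>A \<in> sets M\<close> l] by simp
    have "measure M A = (\<integral>x. indicator A x + indicator A x * l x \<partial>M)"
      using int_l int_1 0 by (subst Bochner_Integration.integral_add) auto
    also have "\<dots> \<le> (\<integral>x. indicator A x * exp (l x) \<partial>M)"
    proof (rule integral_mono)
      show "integrable M (\<lambda>x. indicator A x + indicator A x * l x)"
        using int_l int_1 by (rule Bochner_Integration.integrable_add[rotated])
      show "indicator A x + indicator A x * l x \<le> indicator A x * exp (l x)" for x
        using exp_ge_add_one_self[of "l x"] by (auto simp: indicator_def)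
    qed (rule int)
    finally show ?thesis
      unfolding eq by (subst nn_integral_eq_integral[OF int]) (auto simp: emeasure_eq_measure intro: ennreal_leI)
  qed (simp add: eq)
qed

text \<open>The distribution function of \<open>X\<close> is continuous because no level carries
  mass, so the intermediate value theorem finds a median that splits the mass exactly.\<close>

lemma (in finite_measure) bisecting_level:
  fixes X :: "'a \<Rightarrow> real"
  assumes [measurable]: "X \<in> borel_measurable M" and nonzero: "emeasure M (space M) \<noteq> 0"
    and atomless: "\<And>s. emeasure M {x \<in> space M. X x = s} = 0"
  obtains m where "measure M {x \<in> space M. X x < m} = measure M (space M) / 2"
    "measure M {x \<in> space M. m < X x} = measure M (space M) / 2"
proof -
  interpret D: finite_borel_measure "distr M borel X"
    by (intro finite_borel_measure.intro finite_measure_distr finite_borel_measure_axioms.intro) auto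
  have cdf: "cdf (distr M borel X) t = measure M {x \<in> space M. X x \<le> t}" for t
    unfolding cdf_def by (subst measure_distr) (auto intro!: arg_cong[where f="measure M"])
  have spc: "measure (distr M borel X) (space (distr M borel X)) = measure M (space M)"
    by (simp add: measure_distr)
  have pos: "0 < measure M (space M)" using nonzero by (simp add: emeasure_eq_measure zero_less_measure_iff)
  have cont: "isCont (cdf (distr M borel X)) s" for s
    unfolding D.isCont_cdf
  proof -
    have "X -` {s} \<inter> space M = {x \<in> space M. X x = s}" by auto
    then show "measure (distr M borel X) {s} = 0" using atomless[of s]
      by (subst measure_distr) (auto simp: measure_def)
  qed
  have "\<forall>\<^sub>F t in at_bot. cdf (distr M borel X) t < measure M (space M) / 2"
    using D.cdf_lim_at_bot pos by (intro order_tendstoD) auto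
  then obtain a where a: "cdf (distr M borel X) a < measure M (space M) / 2"
    by (auto dest: eventually_happens)
  have "\<forall>\<^sub>F t in at_top. cdf (distr M borel X) t > measure M (space M) / 2"
    using D.cdf_lim_at_top pos spc by (intro order_tendstoD) auto
  then obtain b where b: "cdf (distr M borel X) b > measure M (space M) / 2"
    by (auto dest: eventually_happens)
  have "a \<le> b" using D.cdf_nondecreasing[of b a] a b by linarith
  then obtain m where m: "cdf (distr M borel X) m = measure M (space M) / 2"
    using IVT'[of "cdf (distr M borel X)" a "measure M (space M) / 2" b] a b cont
      continuous_at_imp_continuous_on by (metis less_imp_le)
  have le: "measure M {x \<in> space M. X x \<le> m} = measure M (space M) / 2" using m cdf by simp
  have "measure M {x \<in> space M. X x \<le> m} = measure M {x \<in> space M. X x < m} + measure M {x \<in> space M. X x = m}"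
    by (subst finite_measure_Union[symmetric]) (auto intro!: arg_cong[where f="measure M"])
  then have "measure M {x \<in> space M. X x < m} = measure M (space M) / 2"
    using le atomless[of m] by (simp add: measure_def)
  moreover have "measure M {x \<in> space M. m < X x} = measure M (space M - {x \<in> space M. X x \<le> m})"
    by (intro arg_cong[where f="measure M"]) auto
  then have "measure M {x \<in> space M. m < X x} = measure M (space M) / 2"
    using le by (simp add: finite_measure_compl)
  ultimately show thesis using that by blast
qed

text \<open>The coefficient of \<open>y j\<close> is 1, so every line in direction \<open>j\<close>
  meets the hyperplane in a single point.\<close>

lemma AE_PiM_lborel_hyperplane:
  fixes v :: "'i \<Rightarrow> real"
  assumes I: "finite I" "j \<notin> I"
  shows "AE y in (\<Pi>\<^sub>M i\<in>insert j I. lborel). y j + (\<Sum>i\<in>I. v i * y i) \<noteq> s"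
proof -
  interpret product_sigma_finite "\<lambda>_::'i. lborel :: real measure" by standard
  define S where "S = {y \<in> space (\<Pi>\<^sub>M i\<in>insert j I. lborel :: real measure). y j + (\<Sum>i\<in>I. v i * y i) = s}"
  have S[measurable]: "S \<in> sets (\<Pi>\<^sub>M i\<in>insert j I. lborel)"
    unfolding S_def by (rule borel_measurable_eq) measurable
  have "emeasure (\<Pi>\<^sub>M i\<in>insert j I. lborel) S = (\<integral>\<^sup>+y. indicator S y \<partial>(\<Pi>\<^sub>M i\<in>insert j I. lborel))"
    by simp
  also have "\<dots> = (\<integral>\<^sup>+y. (\<integral>\<^sup>+t. indicator {s - (\<Sum>i\<in>I. v i * y i)} t \<partial>lborel) \<partial>(\<Pi>\<^sub>M i\<in>I. lborel))"
  proof -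
    have sum_eq: "(\<Sum>i\<in>I. v i * (if i = j then t else y i)) = (\<Sum>i\<in>I. v i * y i)" for y :: "'i \<Rightarrow> real" and t
      using I by (intro sum.cong) auto
    have "indicator S (x(j := t)) = (indicator {s - (\<Sum>i\<in>I. v i * x i)} t :: ennreal)"
      if "x \<in> space (\<Pi>\<^sub>M i\<in>I. lborel :: real measure)" for x t
      using that by (auto simp: S_def indicator_def sum_eq space_PiM_lborel extensional_def)
    then show ?thesis
      using I by (subst product_nn_integral_insert) (auto cong: nn_integral_cong)
  qed
  also have "\<dots> = 0" by simp
  finally show ?thesis
    by (subst AE_iff_measurable[OF S]) (auto simp: S_def)
qed


text \<open>The point \<open>z\<close> is chosen from \<open>F\<close> alone, before
  \<open>G\<close> and \<open>c\<close>: it makes both halves of \<open>F\<close> centered in the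
  sheared coordinates. The half-space bound then applies on either side, and the two dual
  half-spaces cover almost all of the domain of \<open>G\<close>. Bounded support of
  \<open>F\<close> supplies the first moments.\<close>

lemma santalo_translate:
  fixes F :: "('i \<Rightarrow> real) \<Rightarrow> ennreal"
  assumes I: "finite I" "j \<notin> I" and P: "santalo_on I"
    and F[measurable]: "F \<in> borel_measurable (\<Pi>\<^sub>M i\<in>insert j I. lborel)"
    and fin: "(\<integral>\<^sup>+x. F x \<partial>(\<Pi>\<^sub>M i\<in>insert j I. lborel)) \<noteq> \<infinity>"
    and bounded: "\<And>x i. x \<in> extensional (insert j I) \<Longrightarrow> F x \<noteq> 0 \<Longrightarrow> i \<in> insert j I \<Longrightarrow> \<bar>x i\<bar> \<le> R"
  shows "\<exists>z. \<forall>G c. G \<in> borel_measurable (\<Pi>\<^sub>M i\<in>insert j I. lborel) \<longrightarrow>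
      (\<forall>x\<in>extensional (insert j I). \<forall>y\<in>extensional (insert j I).
        F x * G y \<le> c * ennreal (exp (- (\<Sum>i\<in>insert j I. (x i - z i) * y i)))) \<longrightarrow>
      (\<integral>\<^sup>+x. F x \<partial>(\<Pi>\<^sub>M i\<in>insert j I. lborel)) * (\<integral>\<^sup>+x. G x \<partial>(\<Pi>\<^sub>M i\<in>insert j I. lborel))
        \<le> c * ennreal ((2 * pi) ^ card (insert j I))"
proof (cases "(\<integral>\<^sup>+x. F x \<partial>(\<Pi>\<^sub>M i\<in>insert j I. lborel)) = 0")
  case True
  then show ?thesis by simp
next
  case False
  define L where "L = (\<Pi>\<^sub>M i\<in>insert j I. lborel :: real measure)"
  define N where "N = density L F"
  have [measurable]: "F \<in> borel_measurable L" and [simp]: "space L = extensional (insert j I)"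
    using F by (simp_all add: L_def space_PiM_lborel)
  have spN[simp]: "space N = extensional (insert j I)" and setsN[measurable_cong]: "sets N = sets L" by (simp_all add: N_def)
  have emN: "emeasure N (space N) = (\<integral>\<^sup>+x. F x \<partial>L)"
  proof -
    have "extensional (insert j I) \<in> sets L" using sets.top[of L] by simp
    then show ?thesis unfolding N_def by (subst emeasure_density) (auto intro!: nn_integral_cong)
  qed
  interpret N: finite_measure N by (rule finite_measureI) (use fin emN in \<open>simp add: L_def\<close>)
  have coord[measurable]: "(\<lambda>x. x i) \<in> borel_measurable L" if "i \<in> insert j I" for i
    unfolding L_def using measurable_component_singleton[OF that, of "\<lambda>_. lborel :: real measure"] by simp
  have coordN[measurable]: "(\<lambda>x. x i) \<in> borel_measurable N" if "i \<in> insert j I" for i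
    using coord[OF that] by (simp cong: measurable_cong_sets add: setsN)
  have int: "integrable N (\<lambda>x. x i)" if "i \<in> insert j I" for i
  proof (rule N.integrable_const_bound[where B=R])
    show "AE x in N. norm (x i) \<le> R"
      unfolding N_def by (subst AE_density) (auto intro!: AE_I2 bounded[OF _ _ that])
  qed (use that in measurable)
  have nullN: "emeasure N {x \<in> space N. x j = s} = 0" for s
  proof -
    have "AE x in L. x j \<noteq> s" using AE_PiM_lborel_hyperplane[OF I, of "\<lambda>_. 0" s] unfolding L_def by simp
    then have "AE x in N. x j \<noteq> s" unfolding N_def by (subst AE_density) auto
    moreover have "{x \<in> space N. x j = s} \<in> sets N"
      by (rule borel_measurable_eq[OF coordN]) auto
    ultimately show ?thesis by (subst (asm) AE_iff_measurable[where N="{x \<in> space N. x j = s}"]) auto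
  qed
  obtain m where m: "measure N {x \<in> space N. x j < m} = measure N (space N) / 2"
    "measure N {x \<in> space N. m < x j} = measure N (space N) / 2"
    using N.bisecting_level[of "\<lambda>x. x j"] nullN False emN by (auto simp: L_def)
  define a where "a = measure N (space N) / 2"
  have a: "0 < a" using False emN unfolding a_def L_def N.emeasure_eq_measure
    by (metis ennreal_0 half_gt_zero measure_nonneg order_le_less)
  define A where "A \<sigma> = {x \<in> extensional (insert j I). 0 < \<sigma> * (x j - m)}" for \<sigma> :: real
  have A[measurable]: "A \<sigma> \<in> sets L" for \<sigma>
  proof -
    have "A \<sigma> = {x \<in> space L. 0 < \<sigma> * (x j - m)}" by (simp add: A_def)
    also have "\<dots> \<in> sets L" by measurable
    finally show ?thesis .
  qed
  have AN: "A \<sigma> \<in> sets N" for \<sigma> using A by (simp add: setsN)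
  have A_ext[simp]: "A \<sigma> \<inter> extensional (insert j I) = A \<sigma>" for \<sigma> by (auto simp: A_def)
  have mA: "measure N (A \<sigma>) = a" if "\<sigma> = 1 \<or> \<sigma> = -1" for \<sigma>
    using that m by (auto simp: A_def a_def algebra_simps)
  define E where "E \<sigma> i = (\<integral>x. indicator (A \<sigma>) x * x i \<partial>N)" for \<sigma> :: real and i
  have intA: "integrable N (\<lambda>x. indicator (A \<sigma>) x * x i)" if "i \<in> insert j I" for i \<sigma>
    using integrable_mult_indicator[OF AN int[OF that]] by simp
  have intA1: "integrable N (\<lambda>x. indicat_real (A \<sigma>) x)" for \<sigma>
    using AN by (auto simp: less_top[symmetric])
  \<comment> \<open>The barycenters of the halves lie strictly on opposite sides of the bisecting
    hyperplane, so the line through them crosses it and the denominator of \<open>v\<close> below is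
    positive.\<close>
  have Ej: "0 < \<sigma> * (E \<sigma> j - m * a)" if \<sigma>: "\<sigma> = 1 \<or> \<sigma> = -1" for \<sigma>
  proof -
    have eq: "\<sigma> * (E \<sigma> j - m * a) = (\<integral>x. indicator (A \<sigma>) x * (\<sigma> * (x j - m)) \<partial>N)"
    proof -
      have "(\<integral>x. indicator (A \<sigma>) x * (\<sigma> * (x j - m)) \<partial>N)
          = (\<integral>x. \<sigma> * (indicator (A \<sigma>) x * x j) - \<sigma> * m * indicator (A \<sigma>) x \<partial>N)"
        by (intro Bochner_Integration.integral_cong) (auto simp: algebra_simps)
      also have "\<dots> = \<sigma> * E \<sigma> j - \<sigma> * m * measure N (A \<sigma>)"
        using intA[of j \<sigma>] intA1[of \<sigma>] AN unfolding E_def by (subst Bochner_Integration.integral_diff) auto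
      finally show ?thesis using mA[OF \<sigma>] by (simp add: algebra_simps)
    qed
    have int': "integrable N (\<lambda>x. indicator (A \<sigma>) x * (\<sigma> * (x j - m)))"
      using integrable_mult_indicator[OF AN, of "\<lambda>x. \<sigma> * (x j - m)"] int[of j] by simp
    have nn: "0 \<le> indicator (A \<sigma>) x * (\<sigma> * (x j - m))" for x
      by (auto simp: A_def indicator_def)
    have "(\<integral>x. indicator (A \<sigma>) x * (\<sigma> * (x j - m)) \<partial>N) \<noteq> 0"
    proof
      assume "(\<integral>x. indicator (A \<sigma>) x * (\<sigma> * (x j - m)) \<partial>N) = 0"
      then have "AE x in N. indicator (A \<sigma>) x * (\<sigma> * (x j - m)) = 0"
        using integral_nonneg_eq_0_iff_AE[OF int'] nn by simp
      then have "AE x in N. x \<notin> A \<sigma>" by eventually_elim (auto simp: A_def indicator_def)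
      then have "measure N (A \<sigma>) = 0"
        using AN by (subst (asm) AE_iff_measurable[where N="A \<sigma>"]) (auto simp: measure_def A_def)
      then show False using a mA[OF \<sigma>] by simp
    qed
    then show ?thesis unfolding eq using Bochner_Integration.integral_nonneg[of N "\<lambda>x. indicator (A \<sigma>) x * (\<sigma> * (x j - m))"] nn by fastforce
  qed
  \<comment> \<open>The line through the barycenters of the two half-space restrictions has direction \<open>v\<close> (with
     \<open>j\<close>-th component \<open>1\<close>) and meets the bisecting hyperplane at \<open>z\<close>.\<close>
  define v where "v i = (E 1 i - E (-1) i) / (E 1 j - E (-1) j)" for i
  define z where "z = (\<lambda>i. (E 1 i - v i * (E 1 j - m * a)) / a)(j := m)"
  \<comment> \<open>In the sheared coordinates based at \<open>z\<close>, both halves have first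
    moment zero. One pair \<open>v\<close>, \<open>z\<close> serves both signs because the two
    halves have the same mass \<open>a\<close>.\<close>
  have E0: "E \<sigma> i - z i * a - v i * (E \<sigma> j - m * a) = 0" if "i \<in> I" "\<sigma> = 1 \<or> \<sigma> = -1" for i \<sigma>
  proof -
    have "E 1 j - E (-1) j > 0" using Ej[of 1] Ej[of "-1"] by simp
    then have "v i * (E 1 j - E (-1) j) = E 1 i - E (-1) i" by (simp add: v_def)
    moreover have "z i * a = E 1 i - v i * (E 1 j - m * a)" using that I a by (auto simp: z_def)
    ultimately show ?thesis using that(2) by (auto simp: algebra_simps)
  qed
  have zj: "z j = m" by (simp add: z_def)
  have indA: "indicator (A \<sigma>) x = (indicator {x. 0 < \<sigma> * (x j - z j)} x :: ennreal)"
    if "x \<in> extensional (insert j I)" for \<sigma> x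
    using that by (simp add: A_def zj indicator_def)
  have cent: "(\<integral>\<^sup>+x. indicator {x. 0 < \<sigma> * (x j - z j)} x * F x \<partial>L)
      \<le> (\<integral>\<^sup>+x. indicator {x. 0 < \<sigma> * (x j - z j)} x * F x *
            ennreal (exp (\<Sum>i\<in>I. \<zeta> i * (x i - z i - (x j - z j) * v i))) \<partial>L)"
    if \<sigma>: "\<sigma> = 1 \<or> \<sigma> = -1" for \<sigma> \<zeta>
  proof -
    define l where "l x = (\<Sum>i\<in>I. \<zeta> i * (x i - z i - (x j - z j) * v i))" for x
    have intl: "integrable N l" unfolding l_def using int I by (auto intro!: Bochner_Integration.integrable_sum)
    have [measurable]: "l \<in> borel_measurable L" unfolding l_def by (intro borel_measurable_sum) measurable
    have "(\<integral>x. indicator (A \<sigma>) x * l x \<partial>N)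
        = (\<integral>x. (\<Sum>i\<in>I. \<zeta> i * (indicator (A \<sigma>) x * x i - z i * indicator (A \<sigma>) x
            - v i * (indicator (A \<sigma>) x * x j - m * indicator (A \<sigma>) x))) \<partial>N)"
      by (intro Bochner_Integration.integral_cong refl)
         (simp add: l_def sum_distrib_left zj algebra_simps)
    also have "\<dots> = (\<Sum>i\<in>I. \<zeta> i * (E \<sigma> i - z i * measure N (A \<sigma>) - v i * (E \<sigma> j - m * measure N (A \<sigma>))))"
      using intA intA1 I AN unfolding E_def
      by (subst Bochner_Integration.integral_sum) (auto intro!: sum.cong)
    also have "\<dots> = 0" using E0[OF _ \<sigma>] by (simp add: mA[OF \<sigma>])
    finally have "emeasure N (A \<sigma>) \<le> (\<integral>\<^sup>+x. indicator (A \<sigma>) x * ennreal (exp (l x)) \<partial>N)"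
      by (intro N.emeasure_le_nn_integral_exp AN intl)
    moreover have "emeasure N (A \<sigma>) = (\<integral>\<^sup>+x. indicator {x. 0 < \<sigma> * (x j - z j)} x * F x \<partial>L)"
      unfolding N_def by (subst emeasure_density) (auto intro!: nn_integral_cong simp: indA mult_ac)
    moreover have "(\<integral>\<^sup>+x. indicator (A \<sigma>) x * ennreal (exp (l x)) \<partial>N)
        = (\<integral>\<^sup>+x. indicator {x. 0 < \<sigma> * (x j - z j)} x * F x * ennreal (exp (l x)) \<partial>L)"
      unfolding N_def by (subst nn_integral_density) (auto intro!: nn_integral_cong simp: indA mult_ac)
    ultimately show ?thesis by (simp add: l_def)
  qed
  have half: "(\<integral>\<^sup>+x. indicator {x. 0 < \<sigma> * (x j - z j)} x * F x \<partial>L) = ennreal a" if \<sigma>: "\<sigma> = 1 \<or> \<sigma> = -1" for \<sigma>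
  proof -
    have "(\<integral>\<^sup>+x. indicator {x. 0 < \<sigma> * (x j - z j)} x * F x \<partial>L) = emeasure N (A \<sigma>)"
      unfolding N_def by (subst emeasure_density) (auto intro!: nn_integral_cong simp: indA mult_ac)
    then show ?thesis using mA[OF \<sigma>] by (simp add: N.emeasure_eq_measure)
  qed
  show ?thesis
  proof (intro exI[of _ z] allI impI)
    fix G :: "('i \<Rightarrow> real) \<Rightarrow> ennreal" and c
    assume G[measurable]: "G \<in> borel_measurable (\<Pi>\<^sub>M i\<in>insert j I. lborel)"
      and "\<forall>x\<in>extensional (insert j I). \<forall>y\<in>extensional (insert j I).
        F x * G y \<le> c * ennreal (exp (- (\<Sum>i\<in>insert j I. (x i - z i) * y i)))"
    then have le: "F x * G y \<le> c * ennreal (exp (- (\<Sum>i\<in>insert j I. (x i - z i) * y i)))"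
      if "x \<in> extensional (insert j I)" "y \<in> extensional (insert j I)" for x y using that by blast
    have [measurable]: "G \<in> borel_measurable L" using G by (simp add: L_def)
    define w where "w y = y j + (\<Sum>i\<in>I. v i * y i)" for y
    have [measurable]: "w \<in> borel_measurable L" unfolding w_def
      by (intro borel_measurable_add borel_measurable_sum) measurable
    define K where "K = c * ennreal (pi / 2) * ennreal ((2 * pi) ^ card I)"
    have side: "ennreal a * (\<integral>\<^sup>+y. indicator {y. 0 < \<sigma> * w y} y * G y \<partial>L) \<le> K" if \<sigma>: "\<sigma> = 1 \<or> \<sigma> = -1" for \<sigma>
    proof -
      have "\<bar>\<sigma>\<bar> = 1" using \<sigma> by auto
      have "(\<integral>\<^sup>+x. indicator {x. 0 < \<sigma> * (x j - z j)} x * F x \<partial>L) * (\<integral>\<^sup>+y. indicator {y. 0 < \<sigma> * w y} y * G y \<partial>L) \<le> K"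
        unfolding L_def w_def K_def
        by (rule santalo_half_space[OF I P \<open>\<bar>\<sigma>\<bar> = 1\<close> F G le cent[OF \<sigma>, unfolded L_def]])
      then show ?thesis unfolding half[OF \<sigma>] .
    qed
    have "(\<integral>\<^sup>+y. G y \<partial>L) = (\<integral>\<^sup>+y. indicator {y. 0 < 1 * w y} y * G y + indicator {y. 0 < (-1) * w y} y * G y \<partial>L)"
    proof (rule nn_integral_cong_AE)
      have "AE y in L. w y \<noteq> 0" unfolding w_def L_def by (rule AE_PiM_lborel_hyperplane[OF I])
      then show "AE y in L. G y = indicator {y. 0 < 1 * w y} y * G y + indicator {y. 0 < (-1) * w y} y * G y"
        by eventually_elim (auto simp: indicator_def)
    qed
    also have "\<dots> = (\<integral>\<^sup>+y. indicator {y. 0 < 1 * w y} y * G y \<partial>L) + (\<integral>\<^sup>+y. indicator {y. 0 < (-1) * w y} y * G y \<partial>L)"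
      by (rule nn_integral_add) (auto intro!: borel_measurable_times_ennreal borel_measurable_indicator' simp: L_def[symmetric])
    finally have "ennreal a * (\<integral>\<^sup>+y. G y \<partial>L) \<le> K + K"
      using add_mono[OF side[of 1] side[of "-1"]] by (simp add: distrib_left)
    then have "2 * (ennreal a * (\<integral>\<^sup>+y. G y \<partial>L)) \<le> 2 * (K + K)" by (rule mult_left_mono) simp
    moreover have "(\<integral>\<^sup>+x. F x \<partial>L) = 2 * ennreal a"
    proof -
      have "(\<integral>\<^sup>+x. F x \<partial>L) = ennreal (2 * a)"
        unfolding emN[symmetric] N.emeasure_eq_measure a_def by simp
      then show ?thesis using a by (simp add: ennreal_mult)
    qed
    \<comment> \<open>The mass of \<open>F\<close> is twice that of a half and \<open>G\<close> is
      the sum of two pieces; the resulting factor 4 turns the pi / 2 of the half-line inequality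
      into the new factor 2 pi.\<close>
    moreover have "2 * (K + K) = c * ennreal ((2 * pi) ^ card (insert j I))"
    proof -
      have "2 * (K + K) = 2 * 2 * K" by (simp only: mult.assoc mult_2[of K])
      also have "\<dots> = c * (ennreal 4 * (ennreal (pi / 2) * ennreal ((2 * pi) ^ card I)))"
        by (simp add: K_def mult_ac)
      also have "ennreal 4 * (ennreal (pi / 2) * ennreal ((2 * pi) ^ card I)) = ennreal (4 * (pi / 2 * (2 * pi) ^ card I))"
        by (simp only: ennreal_mult pi_ge_zero divide_nonneg_nonneg zero_le_numeral mult_nonneg_nonneg zero_le_power)
      also have "4 * (pi / 2 * (2 * pi) ^ card I) = (2 * pi) ^ card (insert j I)"
        using I by simp
      finally show ?thesis .
    qed
    ultimately show "(\<integral>\<^sup>+x. F x \<partial>(\<Pi>\<^sub>M i\<in>insert j I. lborel)) * (\<integral>\<^sup>+x. G x \<partial>(\<Pi>\<^sub>M i\<in>insert j I. lborel))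
        \<le> c * ennreal ((2 * pi) ^ card (insert j I))"
      by (simp add: L_def mult.assoc)
  qed
qed

text \<open>Applying \<open>santalo_translate\<close> to \<open>F\<close> would leave an unwanted
  translation by \<open>z\<close>. It is therefore applied with the roles exchanged, to truncations
  of \<open>G\<close>: the translation then reappears as an exponential tilt of \<open>F\<close>,
  and the centering of \<open>F\<close> says precisely that a tilt cannot lower its integral.
  Monotone convergence removes the truncation.\<close>

lemma santalo_on_insert:
  fixes j :: 'i
  assumes I: "finite I" "j \<notin> I" and P: "santalo_on I"
  shows "santalo_on (insert j I)"
  unfolding santalo_on_def
proof (intro allI impI)
  fix F G :: "('i \<Rightarrow> real) \<Rightarrow> ennreal" and c
  define L where "L = (\<Pi>\<^sub>M i\<in>insert j I. lborel :: real measure)"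
  assume F: "F \<in> borel_measurable (\<Pi>\<^sub>M i\<in>insert j I. lborel)" and G: "G \<in> borel_measurable (\<Pi>\<^sub>M i\<in>insert j I. lborel)"
    and "\<forall>x\<in>extensional (insert j I). \<forall>y\<in>extensional (insert j I). F x * G y \<le> c * ennreal (exp (- (\<Sum>i\<in>insert j I. x i * y i)))"
    and cent: "\<forall>z. (\<integral>\<^sup>+x. F x \<partial>(\<Pi>\<^sub>M i\<in>insert j I. lborel)) \<le> (\<integral>\<^sup>+x. F x * ennreal (exp (\<Sum>i\<in>insert j I. z i * x i)) \<partial>(\<Pi>\<^sub>M i\<in>insert j I. lborel))"
  then have le: "F x * G y \<le> c * ennreal (exp (- (\<Sum>i\<in>insert j I. x i * y i)))"
    if "x \<in> extensional (insert j I)" "y \<in> extensional (insert j I)" for x y using that by blast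
  have [measurable]: "F \<in> borel_measurable L" "G \<in> borel_measurable L" using F G by (simp_all add: L_def)
  have spL: "space L = extensional (insert j I)" by (simp add: L_def space_PiM_lborel)
  have coord[measurable]: "(\<lambda>x. x i) \<in> borel_measurable L" if "i \<in> insert j I" for i
    unfolding L_def using measurable_component_singleton[OF that, of "\<lambda>_. lborel :: real measure"] by simp
  have "(\<integral>\<^sup>+x. F x \<partial>L) * (\<integral>\<^sup>+x. G x \<partial>L) \<le> c * ennreal ((2 * pi) ^ card (insert j I))"
  proof (cases "c = \<infinity> \<or> (\<forall>x\<in>extensional (insert j I). F x = 0)")
    case True
    then show ?thesis
    proof
      assume "c = \<infinity>" then show ?thesis by (simp add: ennreal_top_mult)
    next
      assume "\<forall>x\<in>extensional (insert j I). F x = 0"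
      then have "(\<integral>\<^sup>+x. F x \<partial>L) = (\<integral>\<^sup>+x. 0 \<partial>L)" by (intro nn_integral_cong) (simp add: spL)
      then show ?thesis by simp
    qed
  next
    case False
    then obtain x0 where x0: "x0 \<in> extensional (insert j I)" "F x0 \<noteq> 0" by blast
    define B where "B k = {y \<in> space L. \<forall>i\<in>insert j I. y i \<in> {- real k..real k}}" for k :: nat
    have B[measurable]: "B k \<in> sets L" for k
    proof -
      have "B k = space L \<inter> (\<Inter>i\<in>insert j I. {y \<in> space L. y i \<in> {- real k..real k}})" by (auto simp: B_def)
      also have "\<dots> \<in> sets L"
        using I by (intro sets.Int sets.finite_INT sets.top measurable_sets_Collect[OF coord]) auto
      finally show ?thesis .
    qed
    define Gk where "Gk k y = G y * indicator (B k) y" for k y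
    have Gk[measurable]: "Gk k \<in> borel_measurable L" for k unfolding Gk_def by measurable
    have vol: "emeasure L (B k) < \<infinity>" for k
    proof -
      interpret product_sigma_finite "\<lambda>_::'i. lborel :: real measure" by standard
      have "B k = PiE (insert j I) (\<lambda>_. {- real k..real k})"
        by (auto simp: B_def spL PiE_def)
      then have "emeasure L (B k) = (\<Prod>i\<in>insert j I. emeasure lborel {- real k..real k})"
        unfolding L_def using I by (subst emeasure_PiM[symmetric]) auto
      also have "\<dots> < \<infinity>" by (simp add: ennreal_power less_top[symmetric])
      finally show ?thesis .
    qed
    \<comment> \<open>At a point \<open>x0\<close> where \<open>F\<close> does not vanish, the
      product hypothesis bounds \<open>G\<close> on the cube \<open>B k\<close>; \<open>C\<close>
      bounds the exponent there.\<close>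
    have fin: "(\<integral>\<^sup>+y. Gk k y \<partial>L) \<noteq> \<infinity>" for k
    proof -
      define C where "C = (\<Sum>i\<in>insert j I. \<bar>x0 i\<bar>) * real k"
      have "Gk k y \<le> c * ennreal (exp C) / F x0 * indicator (B k) y" if "y \<in> space L" for y
      proof (cases "y \<in> B k")
        case True
        have "- (\<Sum>i\<in>insert j I. x0 i * y i) \<le> \<bar>\<Sum>i\<in>insert j I. x0 i * y i\<bar>" by simp
        also have "\<dots> \<le> (\<Sum>i\<in>insert j I. \<bar>x0 i\<bar> * real k)"
          using True by (intro order_trans[OF sum_abs] sum_mono) (auto simp: abs_mult B_def abs_le_iff intro!: mult_left_mono)
        also have "\<dots> = C" by (simp only: C_def sum_distrib_right)
        finally have "F x0 * G y \<le> c * ennreal (exp C)"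
          using le[OF x0(1), of y] that by (auto simp: spL intro!: order_trans[OF le[OF x0(1), of y]] mult_left_mono ennreal_leI)
        then have "G y \<le> c * ennreal (exp C) / F x0"
        proof (cases "F x0 = \<infinity>")
          case True
          then have "G y = 0" using \<open>F x0 * G y \<le> _\<close> False
            by (auto simp: ennreal_top_mult ennreal_mult_eq_top_iff top_unique split: if_splits)
          then show ?thesis by simp
        next
          case False
          then have "G y = F x0 * G y / F x0" using x0(2) mult_divide_eq_ennreal[of "F x0" "G y"]
            by (simp add: mult.commute)
          then show ?thesis using divide_right_mono_ennreal[OF \<open>F x0 * G y \<le> _\<close>, of "F x0"] by simp
        qed
        then show ?thesis using True by (simp add: Gk_def)
      qed (simp add: Gk_def)
      then have "(\<integral>\<^sup>+y. Gk k y \<partial>L) \<le> (\<integral>\<^sup>+y. c * ennreal (exp C) / F x0 * indicator (B k) y \<partial>L)"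
        by (rule nn_integral_mono)
      also have "\<dots> = c * ennreal (exp C) / F x0 * emeasure L (B k)"
        by (subst nn_integral_cmult) auto
      also have "\<dots> < \<infinity>"
        using vol[of k] x0(2) False by (auto simp: ennreal_mult_less_top less_top[symmetric] ennreal_divide_eq_top_iff ennreal_mult_eq_top_iff)
      finally show ?thesis by simp
    qed
    have trunc: "(\<integral>\<^sup>+y. Gk k y \<partial>L) * (\<integral>\<^sup>+x. F x \<partial>L) \<le> c * ennreal ((2 * pi) ^ card (insert j I))" for k
    proof -
      have bnd: "\<bar>y i\<bar> \<le> real k" if "y \<in> extensional (insert j I)" "Gk k y \<noteq> 0" "i \<in> insert j I" for y i
      proof -
        have "y \<in> B k" using that(2) by (auto simp: Gk_def indicator_def split: if_splits)
        then have "y i \<in> {- real k..real k}" using that(3) unfolding B_def by blast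
        then show ?thesis by auto
      qed
      obtain z where z: "\<forall>F c. F \<in> borel_measurable (\<Pi>\<^sub>M i\<in>insert j I. lborel) \<longrightarrow>
          (\<forall>x\<in>extensional (insert j I). \<forall>y\<in>extensional (insert j I).
            Gk k x * F y \<le> c * ennreal (exp (- (\<Sum>i\<in>insert j I. (x i - z i) * y i)))) \<longrightarrow>
          (\<integral>\<^sup>+x. Gk k x \<partial>(\<Pi>\<^sub>M i\<in>insert j I. lborel)) * (\<integral>\<^sup>+x. F x \<partial>(\<Pi>\<^sub>M i\<in>insert j I. lborel))
            \<le> c * ennreal ((2 * pi) ^ card (insert j I))"
        using santalo_translate[OF I P Gk[of k, unfolded L_def] fin[of k, unfolded L_def], of "real k"] bnd by auto
      \<comment> \<open>The tilt by \<open>z\<close> cancels the shift in the pairing, so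
        \<open>Gk k\<close> and \<open>F'\<close> satisfy the hypothesis of the translated
        inequality with the same \<open>c\<close>.\<close>
      define F' where "F' x = F x * ennreal (exp (\<Sum>i\<in>insert j I. z i * x i))" for x
      have [measurable]: "F' \<in> borel_measurable L" unfolding F'_def
      proof -
        have "(\<lambda>x. \<Sum>i\<in>insert j I. z i * x i) \<in> borel_measurable L"
          by (intro borel_measurable_sum borel_measurable_times coord borel_measurable_const)
        then show "(\<lambda>x. F x * ennreal (exp (\<Sum>i\<in>insert j I. z i * x i))) \<in> borel_measurable L"
          by measurable
      qed
      have "(\<integral>\<^sup>+y. Gk k y \<partial>L) * (\<integral>\<^sup>+x. F' x \<partial>L) \<le> c * ennreal ((2 * pi) ^ card (insert j I))"
        unfolding L_def
      proof (rule z[rule_format])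
        show "F' \<in> borel_measurable (\<Pi>\<^sub>M i\<in>insert j I. lborel)" using \<open>F' \<in> borel_measurable L\<close> by (simp add: L_def)
        fix y x :: "'i \<Rightarrow> real" assume y: "y \<in> extensional (insert j I)" and x: "x \<in> extensional (insert j I)"
        define e where "e = (\<Sum>i\<in>insert j I. z i * x i)"
        have e: "(\<Sum>i\<in>insert j I. (y i - z i) * x i) = (\<Sum>i\<in>insert j I. x i * y i) - e"
          unfolding e_def by (simp only: sum_subtractf[symmetric] left_diff_distrib mult.commute[of "x _"])
        have "Gk k y * F' x \<le> (F x * G y) * ennreal (exp e)"
          unfolding Gk_def F'_def e_def[symmetric] by (auto simp: indicator_def mult_ac)
        also have "\<dots> \<le> (c * ennreal (exp (- (\<Sum>i\<in>insert j I. x i * y i)))) * ennreal (exp e)"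
          by (rule mult_right_mono[OF le[OF x y]]) simp
        also have "\<dots> = c * ennreal (exp (- (\<Sum>i\<in>insert j I. (y i - z i) * x i)))"
          unfolding e by (simp only: mult.assoc ennreal_mult[symmetric] exp_ge_zero exp_add[symmetric]) (simp add: algebra_simps)
        finally show "Gk k y * F' x \<le> c * ennreal (exp (- (\<Sum>i\<in>insert j I. (y i - z i) * x i)))" .
      qed
      moreover have "(\<integral>\<^sup>+x. F x \<partial>L) \<le> (\<integral>\<^sup>+x. F' x \<partial>L)"
        using cent[rule_format, of z] by (simp only: F'_def L_def)
      ultimately show ?thesis using mult_left_mono[of "integral\<^sup>N L F" "integral\<^sup>N L F'" "integral\<^sup>N L (Gk k)"]
        by (meson order_trans zero_le)
    qed
    have "(\<integral>\<^sup>+y. G y \<partial>L) = (SUP k. (\<integral>\<^sup>+y. Gk k y \<partial>L))"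
    proof -
      have "G y = (SUP k. Gk k y)" if y: "y \<in> space L" for y
      proof -
        obtain k where k: "(\<Sum>i\<in>insert j I. \<bar>y i\<bar>) \<le> real k" using real_arch_simple by blast
        have "\<bar>y i\<bar> \<le> real k" if "i \<in> insert j I" for i
          using member_le_sum[OF that, of "\<lambda>i. \<bar>y i\<bar>"] k I by simp
        then have "y \<in> B k" using y by (auto simp: B_def abs_le_iff minus_le_iff)
        then show ?thesis by (intro antisym SUP_least SUP_upper2[of k]) (auto simp: Gk_def indicator_def)
      qed
      then have "(\<integral>\<^sup>+y. G y \<partial>L) = (\<integral>\<^sup>+y. (SUP k. Gk k y) \<partial>L)" by (intro nn_integral_cong)
      also have "\<dots> = (SUP k. (\<integral>\<^sup>+y. Gk k y \<partial>L))"
      proof (rule nn_integral_monotone_convergence_SUP)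
        have "B k \<subseteq> B l" if "k \<le> l" for k l using that by (fastforce simp: B_def)
        then show "incseq Gk" by (auto simp: incseq_def le_fun_def Gk_def indicator_def)
      qed measurable
      finally show ?thesis .
    qed
    then have "(\<integral>\<^sup>+x. F x \<partial>L) * (\<integral>\<^sup>+x. G x \<partial>L) = (SUP k. (\<integral>\<^sup>+x. F x \<partial>L) * (\<integral>\<^sup>+y. Gk k y \<partial>L))"
      by (simp add: SUP_mult_left_ennreal)
    also have "\<dots> \<le> c * ennreal ((2 * pi) ^ card (insert j I))"
      using trunc by (intro SUP_least) (simp add: mult.commute)
    finally show ?thesis .
  qed
  then show "(\<integral>\<^sup>+x. F x \<partial>(\<Pi>\<^sub>M i\<in>insert j I. lborel)) * (\<integral>\<^sup>+x. G x \<partial>(\<Pi>\<^sub>M i\<in>insert j I. lborel))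
      \<le> c * ennreal ((2 * pi) ^ card (insert j I))"
    unfolding L_def .
qed

lemma santalo_on_finite: "finite I \<Longrightarrow> santalo_on I"
proof (induction I rule: finite_induct)
  case empty
  show ?case
    by (simp add: santalo_on_def PiM_empty nn_integral_count_space_finite extensional_def)
next
  case (insert j I)
  then show ?case by (intro santalo_on_insert)
qed

lemma functional_santalo:
  fixes F G :: "'a::euclidean_space \<Rightarrow> ennreal"
  assumes [measurable]: "F \<in> borel_measurable borel" "G \<in> borel_measurable borel"
    and le: "\<And>x y. F x * G y \<le> ennreal (exp (- (x \<bullet> y)))"
    and cent: "\<And>z. (\<integral>\<^sup>+x. F x \<partial>lborel) \<le> (\<integral>\<^sup>+x. F x * ennreal (exp (z \<bullet> x)) \<partial>lborel)"
  shows "(\<integral>\<^sup>+x. F x \<partial>lborel) * (\<integral>\<^sup>+x. G x \<partial>lborel) \<le> ennreal ((2 * pi) ^ DIM('a))"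
proof -
  define T where "T = (\<lambda>f. \<Sum>b\<in>Basis. f b *\<^sub>R (b::'a))"
  have [measurable]: "T \<in> (\<Pi>\<^sub>M b\<in>Basis. lborel) \<rightarrow>\<^sub>M borel"
    unfolding T_def by measurable
  have int: "(\<integral>\<^sup>+x. f x \<partial>lborel) = (\<integral>\<^sup>+x. f (T x) \<partial>(\<Pi>\<^sub>M b\<in>Basis. lborel))"
    if [measurable]: "f \<in> borel_measurable borel" for f :: "'a \<Rightarrow> ennreal"
    by (subst lborel_eq, unfold T_def[symmetric]) (simp add: nn_integral_distr)
  have inner: "T f \<bullet> T g = (\<Sum>b\<in>Basis. f b * g b)" for f g
    by (subst euclidean_inner) (simp add: T_def inner_sum_left inner_Basis if_distrib sum.delta cong: if_cong)
  have "santalo_on (Basis :: 'a set)" by (simp add: santalo_on_finite)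
  from this[unfolded santalo_on_def, rule_format, of "\<lambda>x. F (T x)" "\<lambda>x. G (T x)" 1]
  show ?thesis
    using le[of "T _" "T _", unfolded inner] cent[of "T _"] by (simp add: int inner)
qed

section \<open>Homogeneous functions and volumes\<close>

lemma nn_integral_lborel_scale:
  fixes f :: "'a::euclidean_space \<Rightarrow> ennreal"
  assumes [measurable]: "f \<in> borel_measurable borel" and t: "0 < t"
  shows "(\<integral>\<^sup>+x. f x \<partial>lborel) = ennreal (t ^ DIM('a)) * (\<integral>\<^sup>+x. f (t *\<^sub>R x) \<partial>lborel)"
  using t by (subst lborel_affine[of t 0])
    (simp_all add: nn_integral_density nn_integral_distr nn_integral_cmult)

section \<open>Gaussian integrals of homogeneous functions\<close>

lemma nn_integral_gaussian_tail:
  fixes a :: real assumes "0 \<le> a"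
  shows "(\<integral>\<^sup>+t. indicator {0<..} t * (indicator {a..} t * ennreal (t * exp (- (t\<^sup>2 / 2)))) \<partial>lborel) = ennreal (exp (- (a\<^sup>2 / 2)))"
proof -
  have "(\<integral>\<^sup>+t. indicator {0<..} t * (indicator {a..} t * ennreal (t * exp (- (t\<^sup>2 / 2)))) \<partial>lborel)
      = (\<integral>\<^sup>+t. ennreal (t * exp (- (t\<^sup>2 / 2))) * indicator {a..} t \<partial>lborel)"
    using assms by (intro nn_integral_cong) (auto simp: indicator_def)
  also have "\<dots> = ennreal (0 - (- exp (- (a\<^sup>2 / 2))))"
  proof (rule nn_integral_FTC_atLeast[where F="\<lambda>t. - exp (- (t\<^sup>2 / 2))"])
    show "((\<lambda>t::real. - exp (- (t\<^sup>2 / 2))) \<longlongrightarrow> 0) at_top" by real_asymp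
    show "((\<lambda>t. - exp (- (t\<^sup>2 / 2))) has_real_derivative t * exp (- (t\<^sup>2 / 2))) (at t)" for t :: real
      by (auto intro!: derivative_eq_intros)
  qed (use assms in auto)
  finally show ?thesis by simp
qed

lemma borel_measurable_indicator_interval[measurable]:
  fixes f g :: "'b \<Rightarrow> real"
  assumes [measurable]: "f \<in> borel_measurable M" "g \<in> borel_measurable M"
  shows "(\<lambda>p. indicator {f p..} (g p) :: ennreal) \<in> borel_measurable M"
    and "(\<lambda>p. indicator {..f p} (g p) :: ennreal) \<in> borel_measurable M"
proof -
  have "(\<lambda>p. indicator {f p..} (g p) :: ennreal) = (\<lambda>p. if f p \<le> g p then 1 else 0)"
    and "(\<lambda>p. indicator {..f p} (g p) :: ennreal) = (\<lambda>p. if g p \<le> f p then 1 else 0)"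
    by (auto simp: indicator_def)
  then show "(\<lambda>p. indicator {f p..} (g p) :: ennreal) \<in> borel_measurable M"
    and "(\<lambda>p. indicator {..f p} (g p) :: ennreal) \<in> borel_measurable M"
    by simp_all
qed

text \<open>Write the Gaussian of \<open>a x\<close> as the integral of its negative derivative over
  all t \<ge> a x, exchange the integrals and rescale by \<open>t\<close>. The Gaussian becomes a
  mixture of dilates of the unit sublevel set; the extra factor \<open>f\<close> is there for
  exponential tilts.\<close>

lemma nn_integral_gaussian_homogeneous:
  fixes a :: "'a::euclidean_space \<Rightarrow> real" and f :: "'a \<Rightarrow> ennreal"
  assumes [measurable]: "a \<in> borel_measurable borel" "f \<in> borel_measurable borel"
    and nonneg: "\<And>x. 0 \<le> a x" and hom: "\<And>t x. 0 < t \<Longrightarrow> a (t *\<^sub>R x) = t * a x"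
  shows "(\<integral>\<^sup>+x. ennreal (exp (- ((a x)\<^sup>2 / 2))) * f x \<partial>lborel) =
    (\<integral>\<^sup>+t. indicator {0<..} t * (ennreal (t * exp (- (t\<^sup>2 / 2)) * t ^ DIM('a)) *
      (\<integral>\<^sup>+x. indicator {x. a x \<le> 1} x * f (t *\<^sub>R x) \<partial>lborel)) \<partial>lborel)"
proof -
  have "(\<integral>\<^sup>+x. ennreal (exp (- ((a x)\<^sup>2 / 2))) * f x \<partial>lborel)
      = (\<integral>\<^sup>+x. (\<integral>\<^sup>+t. (indicator {0<..} t * (indicator {a x..} t * ennreal (t * exp (- (t\<^sup>2 / 2))))) * f x \<partial>lborel) \<partial>lborel)"
    by (subst nn_integral_multc) (auto simp: nn_integral_gaussian_tail nonneg)
  also have "\<dots> = (\<integral>\<^sup>+t. (\<integral>\<^sup>+x. (indicator {0<..} t * (indicator {a x..} t * ennreal (t * exp (- (t\<^sup>2 / 2))))) * f x \<partial>lborel) \<partial>lborel)"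
  proof (rule lborel_pair.Fubini')
    show "(\<lambda>(t, x). (indicator {0<..} t * (indicator {a x..} t * ennreal (t * exp (- (t\<^sup>2 / 2))))) * f x)
        \<in> borel_measurable (lborel \<Otimes>\<^sub>M lborel)"
      unfolding split_beta' by measurable
  qed
  also have "\<dots> = (\<integral>\<^sup>+t. indicator {0<..} t * (ennreal (t * exp (- (t\<^sup>2 / 2)) * t ^ DIM('a)) *
      (\<integral>\<^sup>+x. indicator {x. a x \<le> 1} x * f (t *\<^sub>R x) \<partial>lborel)) \<partial>lborel)"
  proof (rule nn_integral_cong)
    fix t :: real
    show "(\<integral>\<^sup>+x. (indicator {0<..} t * (indicator {a x..} t * ennreal (t * exp (- (t\<^sup>2 / 2))))) * f x \<partial>lborel)
      = indicator {0<..} t * (ennreal (t * exp (- (t\<^sup>2 / 2)) * t ^ DIM('a)) *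
      (\<integral>\<^sup>+x. indicator {x. a x \<le> 1} x * f (t *\<^sub>R x) \<partial>lborel))"
    proof (cases "0 < t")
      case True
      have "(\<integral>\<^sup>+x. (indicator {0<..} t * (indicator {a x..} t * ennreal (t * exp (- (t\<^sup>2 / 2))))) * f x \<partial>lborel)
          = (\<integral>\<^sup>+x. ennreal (t * exp (- (t\<^sup>2 / 2))) * (indicator {x. a x \<le> t} x * f x) \<partial>lborel)"
        using True by (intro nn_integral_cong) (auto simp: indicator_def)
      also have "\<dots> = ennreal (t * exp (- (t\<^sup>2 / 2))) * (\<integral>\<^sup>+x. indicator {x. a x \<le> t} x * f x \<partial>lborel)"
        by (rule nn_integral_cmult) measurable
      also have "(\<integral>\<^sup>+x. indicator {x. a x \<le> t} x * f x \<partial>lborel)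
          = ennreal (t ^ DIM('a)) * (\<integral>\<^sup>+x. indicator {x. a x \<le> t} (t *\<^sub>R x) * f (t *\<^sub>R x) \<partial>lborel)"
        by (rule nn_integral_lborel_scale[OF _ True]) measurable
      also have "(\<lambda>x. indicator {x. a x \<le> t} (t *\<^sub>R x) * f (t *\<^sub>R x)) = (\<lambda>x. indicator {x. a x \<le> 1} x * f (t *\<^sub>R x))"
        using True by (auto simp: indicator_def hom fun_eq_iff)
      finally show ?thesis using True by (simp add: ennreal_mult mult.assoc)
    qed simp
  qed
  finally show ?thesis .
qed

lemma nn_integral_std_gaussian:
  "(\<integral>\<^sup>+x. ennreal (exp (- ((norm (x::'a::euclidean_space))\<^sup>2 / 2))) \<partial>lborel) = ennreal (sqrt (2 * pi) ^ DIM('a))"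
proof -
  have one: "(\<integral>\<^sup>+x. ennreal (exp (- ((x::real)\<^sup>2 / 2))) \<partial>lborel) = ennreal (sqrt (2 * pi))"
  proof -
    interpret prob_space "density lborel (std_normal_density :: real \<Rightarrow> real)"
      by (rule prob_space_normal_density) simp
    have "(\<integral>\<^sup>+x. ennreal (exp (- ((x::real)\<^sup>2 / 2))) \<partial>lborel)
        = (\<integral>\<^sup>+x. ennreal (sqrt (2 * pi)) * ennreal (std_normal_density x) \<partial>lborel)"
      by (intro nn_integral_cong) (simp add: std_normal_density_def flip: ennreal_mult)
    also have "\<dots> = ennreal (sqrt (2 * pi)) * (\<integral>\<^sup>+x. ennreal (std_normal_density x) \<partial>lborel)"
      by (rule nn_integral_cmult) measurable
    also have "(\<integral>\<^sup>+x. ennreal (std_normal_density x) \<partial>lborel) = 1"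
      using emeasure_space_1 by (simp add: emeasure_density)
    finally show ?thesis by simp
  qed
  have "(\<integral>\<^sup>+x. ennreal (exp (- ((norm (x::'a))\<^sup>2 / 2))) \<partial>lborel)
      = (\<integral>\<^sup>+x. (\<Prod>b\<in>(Basis::'a set). ennreal (exp (- ((x \<bullet> b)\<^sup>2 / 2)))) \<partial>lborel)"
  proof (rule nn_integral_cong)
    fix x :: 'a
    have "(norm x)\<^sup>2 = (\<Sum>b\<in>Basis. (x \<bullet> b)\<^sup>2)"
      unfolding power2_norm_eq_inner euclidean_inner[of x x] by (simp add: power2_eq_square)
    then have "- ((norm x)\<^sup>2 / 2) = (\<Sum>b\<in>Basis. - ((x \<bullet> b)\<^sup>2 / 2))"
      by (simp add: sum_negf sum_divide_distrib)
    then show "ennreal (exp (- ((norm x)\<^sup>2 / 2))) = (\<Prod>b\<in>Basis. ennreal (exp (- ((x \<bullet> b)\<^sup>2 / 2))))"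
      by (simp add: exp_sum prod_ennreal)
  qed
  also have "\<dots> = (\<Prod>b\<in>(Basis::'a set). (\<integral>\<^sup>+x. ennreal (exp (- (x\<^sup>2 / 2))) \<partial>lborel))"
    by (rule nn_integral_lborel_prod) auto
  finally show ?thesis by (simp add: one ennreal_power)
qed

text \<open>The factor, depending on the dimension alone, between the Gaussian integral of a
  homogeneous function and the volume of its unit sublevel set. It is calibrated on the unit ball in
  \<open>gaussian_moment_cball\<close>.\<close>

definition gaussian_moment :: "nat \<Rightarrow> ennreal" where
  "gaussian_moment n = (\<integral>\<^sup>+t. indicator {0<..} t * ennreal (t * exp (- (t\<^sup>2 / 2)) * t ^ n) \<partial>lborel)"

lemma nn_integral_gaussian_sublevel:
  fixes a :: "'a::euclidean_space \<Rightarrow> real"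
  assumes [measurable]: "a \<in> borel_measurable borel"
    and nonneg: "\<And>x. 0 \<le> a x" and hom: "\<And>t x. 0 < t \<Longrightarrow> a (t *\<^sub>R x) = t * a x"
  shows "(\<integral>\<^sup>+x. ennreal (exp (- ((a x)\<^sup>2 / 2))) \<partial>lborel) = gaussian_moment DIM('a) * emeasure lborel {x. a x \<le> 1}"
proof -
  have "(\<integral>\<^sup>+x. ennreal (exp (- ((a x)\<^sup>2 / 2))) \<partial>lborel)
     = (\<integral>\<^sup>+t. indicator {0<..} t * (ennreal (t * exp (- (t\<^sup>2 / 2)) * t ^ DIM('a)) * emeasure lborel {x. a x \<le> 1}) \<partial>lborel)"
    using nn_integral_gaussian_homogeneous[OF assms(1) _ nonneg hom, of "\<lambda>_. 1"] by simp
  also have "\<dots> = gaussian_moment DIM('a) * emeasure lborel {x. a x \<le> 1}"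
    unfolding gaussian_moment_def by (subst nn_integral_multc[symmetric]) (auto simp: mult.assoc)
  finally show ?thesis .
qed

lemma gaussian_moment_cball:
  "gaussian_moment DIM('a) * emeasure lborel (cball (0::'a::euclidean_space) 1) = ennreal (sqrt (2 * pi) ^ DIM('a))"
proof -
  have "{x::'a. norm x \<le> 1} = cball 0 1" by auto
  then show ?thesis
    using nn_integral_gaussian_sublevel[of "norm :: 'a \<Rightarrow> real"] nn_integral_std_gaussian[where 'a='a] by simp
qed

text \<open>The Pareto density has mass 1. It is the weight inserted in
  \<open>emeasure_homogeneous_sublevel\<close> to compare two sublevel sets ray by ray.\<close>

lemma nn_integral_reciprocal_power:
  fixes b :: real assumes b: "0 < b" and N: "0 < N"
  shows "(\<integral>\<^sup>+t. indicator {b..} t * ennreal (real N * b ^ N / t ^ Suc N) \<partial>lborel) = 1"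
proof -
  have "(\<integral>\<^sup>+t. ennreal (real N * b ^ N / t ^ Suc N) * indicator {b..} t \<partial>lborel) = ennreal (0 - (- (b ^ N / b ^ N)))"
  proof (rule nn_integral_FTC_atLeast[where F="\<lambda>t. - (b ^ N / t ^ N)"])
    show "((\<lambda>t::real. - (b ^ N / t ^ N)) \<longlongrightarrow> 0) at_top"
    proof -
      have "((\<lambda>t::real. b ^ N / t ^ N) \<longlongrightarrow> 0) at_top"
        using N by (intro tendsto_divide_0[OF tendsto_const] filterlim_at_top_imp_at_infinity filterlim_pow_at_top filterlim_ident) 
      then show ?thesis using tendsto_minus by fastforce
    qed
    fix t assume t: "b \<le> t"
    have "((\<lambda>t. - (b ^ N / t ^ N)) has_real_derivative - (- (b ^ N * (real N * t ^ (N - 1))) / (t ^ N * t ^ N))) (at t)"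
      using b t by (auto intro!: derivative_eq_intros)
    moreover have "- (- (b ^ N * (real N * t ^ (N - 1))) / (t ^ N * t ^ N)) = real N * b ^ N / t ^ Suc N"
      using b t N by (cases N) (auto simp: field_simps)
    ultimately show "((\<lambda>t. - (b ^ N / t ^ N)) has_real_derivative real N * b ^ N / t ^ Suc N) (at t)" by simp
    show "0 \<le> real N * b ^ N / t ^ Suc N" using b t by simp
  qed measurable
  then show ?thesis using b by (simp add: mult.commute del: power_Suc)
qed

text \<open>Polar coordinates with the sphere replaced by the boundary of an arbitrary star-shaped
  set: the ratio of \<open>b\<close> to \<open>a\<close> is constant on rays. It is applied with
  \<open>a\<close> the support function and \<open>b\<close> the norm for the polar body, and with
  \<open>a\<close> the norm and \<open>b\<close> the gauge for the unit ball.\<close>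

lemma emeasure_homogeneous_sublevel:
  fixes a b :: "'a::euclidean_space \<Rightarrow> real"
  assumes [measurable]: "a \<in> borel_measurable borel" "b \<in> borel_measurable borel"
    and a: "\<And>x. x \<noteq> 0 \<Longrightarrow> 0 < a x" "\<And>t x. 0 < t \<Longrightarrow> a (t *\<^sub>R x) = t * a x"
    and b: "\<And>x. x \<noteq> 0 \<Longrightarrow> 0 < b x" "\<And>t x. 0 < t \<Longrightarrow> b (t *\<^sub>R x) = t * b x"
  shows "emeasure lborel {x. a x \<le> 1} = (\<integral>\<^sup>+x. indicator {x. b x \<le> 1} x * ennreal ((b x / a x) ^ DIM('a)) \<partial>lborel)"
proof -
  define N where "N = DIM('a)"
  have N: "0 < N" by (simp add: N_def)
  \<comment> \<open>Both sides equal this double integral over \<open>(x, t)\<close>: integrate over \<open>t\<close> first, or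
     substitute \<open>x = t y\<close> and then integrate over \<open>t\<close>.\<close>
  define k where "k x t = indicator {0<..} t * (indicator {x. a x \<le> 1} x * (indicator {b x..} t * ennreal (real N * b x ^ N / t ^ Suc N)))" for x t
  have k: "(\<lambda>(x, t). k x t) \<in> borel_measurable (lborel \<Otimes>\<^sub>M lborel)"
    unfolding k_def split_beta' by measurable
  have "emeasure lborel {x. a x \<le> 1} = (\<integral>\<^sup>+x. indicator {x. a x \<le> 1} x \<partial>lborel)" by simp
  also have "\<dots> = (\<integral>\<^sup>+x. (\<integral>\<^sup>+t. k x t \<partial>lborel) \<partial>lborel)"
  proof (rule nn_integral_cong_AE, rule AE_mp[OF AE_lborel_singleton[of 0]], rule AE_I2, rule impI)
    fix x :: 'a assume "x \<noteq> 0"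
    then have bx: "0 < b x" by (rule b)
    have "(\<integral>\<^sup>+t. k x t \<partial>lborel) = (\<integral>\<^sup>+t. indicator {x. a x \<le> 1} x * (indicator {b x..} t * ennreal (real N * b x ^ N / t ^ Suc N)) \<partial>lborel)"
      using bx by (intro nn_integral_cong) (auto simp: k_def indicator_def)
    also have "\<dots> = indicator {x. a x \<le> 1} x * 1"
      by (subst nn_integral_cmult) (auto simp: nn_integral_reciprocal_power[OF bx N] simp del: power_Suc)
    finally show "indicator {x. a x \<le> 1} x = (\<integral>\<^sup>+t. k x t \<partial>lborel)" by simp
  qed
  also have "\<dots> = (\<integral>\<^sup>+t. (\<integral>\<^sup>+x. k x t \<partial>lborel) \<partial>lborel)"
    using lborel_pair.Fubini'[OF k] by simp
  also have "\<dots> = (\<integral>\<^sup>+t. (\<integral>\<^sup>+x. indicator {0<..} t * (indicator {x. b x \<le> 1} x * (indicator {..1 / a x} t * ennreal (real N * b x ^ N * t ^ (N - 1)))) \<partial>lborel) \<partial>lborel)"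
  proof (rule nn_integral_cong)
    fix t :: real
    show "(\<integral>\<^sup>+x. k x t \<partial>lborel) = (\<integral>\<^sup>+x. indicator {0<..} t * (indicator {x. b x \<le> 1} x * (indicator {..1 / a x} t * ennreal (real N * b x ^ N * t ^ (N - 1)))) \<partial>lborel)"
    proof (cases "0 < t")
      case t: True
      have "(\<integral>\<^sup>+x. k x t \<partial>lborel) = ennreal (t ^ N) * (\<integral>\<^sup>+x. k (t *\<^sub>R x) t \<partial>lborel)"
        unfolding N_def by (rule nn_integral_lborel_scale[OF _ t]) (use k in measurable)
      also have "\<dots> = (\<integral>\<^sup>+x. ennreal (t ^ N) * k (t *\<^sub>R x) t \<partial>lborel)"
        by (rule nn_integral_cmult[symmetric]) (use k in measurable)
      also have "\<dots> = (\<integral>\<^sup>+x. indicator {0<..} t * (indicator {x. b x \<le> 1} x * (indicator {..1 / a x} t * ennreal (real N * b x ^ N * t ^ (N - 1)))) \<partial>lborel)"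
      proof (rule nn_integral_cong_AE, rule AE_mp[OF AE_lborel_singleton[of 0]], rule AE_I2, rule impI)
        fix x :: 'a assume x: "x \<noteq> 0"
        have "t ^ N * (real N * b (t *\<^sub>R x) ^ N / t ^ Suc N) = real N * b x ^ N * t ^ (N - 1)"
          using t N by (cases N) (auto simp: b(2) power_mult_distrib field_simps)
        then have e: "ennreal (t ^ N) * ennreal (real N * b (t *\<^sub>R x) ^ N / t ^ Suc N) = ennreal (real N * b x ^ N * t ^ (N - 1))"
          using t b(1)[OF x] by (subst ennreal_mult[symmetric]) (auto simp: b(2))
        have "a (t *\<^sub>R x) \<le> 1 \<longleftrightarrow> t \<le> 1 / a x" "b (t *\<^sub>R x) \<le> t \<longleftrightarrow> b x \<le> 1"
          using t a(1)[OF x] by (auto simp: a(2) b(2) field_simps)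
        then show "ennreal (t ^ N) * k (t *\<^sub>R x) t = indicator {0<..} t * (indicator {x. b x \<le> 1} x * (indicator {..1 / a x} t * ennreal (real N * b x ^ N * t ^ (N - 1))))"
          using e t by (auto simp: k_def indicator_def)
      qed
      finally show ?thesis .
    qed (simp add: k_def)
  qed
  also have "\<dots> = (\<integral>\<^sup>+x. (\<integral>\<^sup>+t. indicator {0<..} t * (indicator {x. b x \<le> 1} x * (indicator {..1 / a x} t * ennreal (real N * b x ^ N * t ^ (N - 1)))) \<partial>lborel) \<partial>lborel)"
  proof (rule lborel_pair.Fubini'[symmetric])
    show "(\<lambda>(t, x). indicator {0<..} t * (indicator {x. b x \<le> 1} x * (indicator {..1 / a x} t * ennreal (real N * b x ^ N * t ^ (N - 1)))))
        \<in> borel_measurable (lborel \<Otimes>\<^sub>M lborel)"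
      unfolding split_beta' by measurable
  qed
  also have "\<dots> = (\<integral>\<^sup>+x. indicator {x. b x \<le> 1} x * ennreal ((b x / a x) ^ N) \<partial>lborel)"
  proof (rule nn_integral_cong_AE, rule AE_mp[OF AE_lborel_singleton[of 0]], rule AE_I2, rule impI)
    fix x :: 'a assume x: "x \<noteq> 0"
    have "(\<integral>\<^sup>+t. ennreal (real N * b x ^ N * t ^ (N - 1)) * indicator {0..1 / a x} t \<partial>lborel) = ennreal (b x ^ N * (1 / a x) ^ N - b x ^ N * 0 ^ N)"
      using a(1)[OF x] b(1)[OF x] by (intro nn_integral_FTC_Icc) (auto intro!: derivative_eq_intros simp: mult_ac)
    then have *: "(\<integral>\<^sup>+t. ennreal (real N * b x ^ N * t ^ (N - 1)) * indicator {0..1 / a x} t \<partial>lborel) = ennreal ((b x / a x) ^ N)"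
      using zero_power[OF N, where ?'a=real] by (simp add: power_divide)
    have "(\<integral>\<^sup>+t. indicator {0<..} t * (indicator {x. b x \<le> 1} x * (indicator {..1 / a x} t * ennreal (real N * b x ^ N * t ^ (N - 1)))) \<partial>lborel)
        = (\<integral>\<^sup>+t. indicator {x. b x \<le> 1} x * (ennreal (real N * b x ^ N * t ^ (N - 1)) * indicator {0..1 / a x} t) \<partial>lborel)"
      by (rule nn_integral_cong_AE, rule AE_mp[OF AE_lborel_singleton[of 0]]) (auto simp: indicator_def intro!: AE_I2)
    also have "\<dots> = indicator {x. b x \<le> 1} x * ennreal ((b x / a x) ^ N)"
      by (subst nn_integral_cmult, measurable) (simp only: *)
    finally show "(\<integral>\<^sup>+t. indicator {0<..} t * (indicator {x. b x \<le> 1} x * (indicator {..1 / a x} t * ennreal (real N * b x ^ N * t ^ (N - 1)))) \<partial>lborel)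
        = indicator {x. b x \<le> 1} x * ennreal ((b x / a x) ^ N)" .
  qed
  finally show ?thesis by (simp add: N_def)
qed

section \<open>Support functions and gauges\<close>

lemma bdd_above_inner_compact:
  fixes K :: "(real ^ 'n) set" assumes "compact K"
  shows "bdd_above ((\<lambda>z. y \<bullet> (z - w)) ` K)"
proof -
  have "continuous_on K (\<lambda>z. y \<bullet> (z - w))" by (intro continuous_intros)
  from compact_continuous_image[OF this assms] show ?thesis
    by (rule bounded_imp_bdd_above[OF compact_imp_bounded])
qed

lemma support_fun_upper: "compact K \<Longrightarrow> z \<in> K \<Longrightarrow> y \<bullet> (z - w) \<le> support_fun K w y"
  unfolding support_fun_def by (rule cSUP_upper[OF _ bdd_above_inner_compact])

lemma support_fun_least: "K \<noteq> {} \<Longrightarrow> (\<And>z. z \<in> K \<Longrightarrow> y \<bullet> (z - w) \<le> c) \<Longrightarrow> support_fun K w y \<le> c"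
  unfolding support_fun_def by (rule cSUP_least)

lemma support_fun_attained:
  assumes "compact K" "K \<noteq> {}" obtains z where "z \<in> K" "support_fun K w y = y \<bullet> (z - w)"
proof -
  have "continuous_on K (\<lambda>z. y \<bullet> (z - w))" by (intro continuous_intros)
  then obtain z where z: "z \<in> K" "\<And>x. x \<in> K \<Longrightarrow> y \<bullet> (x - w) \<le> y \<bullet> (z - w)"
    using continuous_attains_sup[OF assms] by blast
  have "support_fun K w y = y \<bullet> (z - w)"
    using z assms by (intro antisym support_fun_least support_fun_upper) auto
  then show thesis using z that by blast
qed

lemma support_fun_scale:
  assumes "compact K" "K \<noteq> {}" "0 \<le> t" shows "support_fun K w (t *\<^sub>R y) = t * support_fun K w y"
proof (rule antisym)
  show "support_fun K w (t *\<^sub>R y) \<le> t * support_fun K w y"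
    using assms by (intro support_fun_least) (auto intro!: mult_left_mono support_fun_upper)
  obtain z where "z \<in> K" "support_fun K w y = y \<bullet> (z - w)" using support_fun_attained[OF assms(1,2)] .
  then show "t * support_fun K w y \<le> support_fun K w (t *\<^sub>R y)"
    using support_fun_upper[OF assms(1), of z "t *\<^sub>R y" w] by simp
qed

lemma continuous_on_support_fun:
  assumes "compact K" "K \<noteq> {}" shows "continuous_on S (support_fun K w)"
proof -
  obtain M where M: "\<forall>z\<in>K. norm z \<le> M"
    using compact_imp_bounded[OF assms(1)] unfolding bounded_iff by blast
  define B where "B = M + norm w"
  have B: "norm (z - w) \<le> B" if "z \<in> K" for z
    using norm_triangle_ineq4[of z w] M that by (auto simp: B_def)
  have le: "support_fun K w x - support_fun K w y \<le> B * norm (x - y)" for x y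
  proof -
    obtain z where z: "z \<in> K" "support_fun K w x = x \<bullet> (z - w)" using support_fun_attained[OF assms] .
    have "support_fun K w x - support_fun K w y \<le> (x - y) \<bullet> (z - w)"
      using support_fun_upper[OF assms(1) z(1), of y w] z(2) by (simp add: inner_diff_left)
    also have "\<dots> \<le> norm (x - y) * norm (z - w)" by (rule norm_cauchy_schwarz)
    also have "\<dots> \<le> norm (x - y) * B" by (intro mult_left_mono B z(1)) simp
    finally show ?thesis by (simp add: mult.commute)
  qed
  have "B-lipschitz_on UNIV (support_fun K w)"
  proof (rule lipschitz_onI)
    show "0 \<le> B" using B assms(2) norm_ge_zero order_trans by blast
    show "dist (support_fun K w x) (support_fun K w y) \<le> B * dist x y" for x y
      using le[of x y] le[of y x] by (simp add: dist_norm norm_minus_commute abs_le_iff)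
  qed
  then show ?thesis using lipschitz_on_continuous_on continuous_on_subset by blast
qed

lemma support_fun_shift:
  assumes "compact K" "K \<noteq> {}" shows "support_fun K w y = support_fun K 0 y - y \<bullet> w"
proof (rule antisym)
  show "support_fun K w y \<le> support_fun K 0 y - y \<bullet> w"
    using support_fun_upper[OF assms(1), of _ y 0] assms by (intro support_fun_least) (auto simp: inner_diff_right)
  show "support_fun K 0 y - y \<bullet> w \<le> support_fun K w y"
    using support_fun_upper[OF assms(1), of _ y w] support_fun_attained[OF assms, of 0 y]
    by (metis add.commute diff_le_eq diff_zero inner_diff_right)
qed

lemma support_fun_translate: "support_fun ((\<lambda>z. z - w) ` K) 0 y = support_fun K w y"
  by (simp add: support_fun_def image_image)

lemma mem_if_le_support_fun:
  assumes K: "compact K" "convex K" "K \<noteq> {}" and le: "\<And>y. y \<bullet> z \<le> support_fun K 0 y"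
  shows "z \<in> K"
proof (rule ccontr)
  assume "z \<notin> K"
  then obtain a b where ab: "a \<bullet> z < b" "\<And>x. x \<in> K \<Longrightarrow> b < a \<bullet> x"
    using separating_hyperplane_closed_point[OF K(2) compact_imp_closed[OF K(1)]] by blast
  have "support_fun K 0 (- a) \<le> - b" using ab(2) by (intro support_fun_least K) (auto intro: less_imp_le)
  with le[of "- a"] ab(1) show False by simp
qed

text \<open>The Minkowski gauge, described by supporting half-spaces. In this form the duality
  inequality \<open>inner_le_g_h\<close> is immediate, and compactness of the sphere provides a
  direction in which it is an equality.\<close>

definition gauge_of :: "(real ^ 'n) set \<Rightarrow> real ^ 'n \<Rightarrow> real" where
  "gauge_of K x = (SUP \<nu>\<in>sphere 0 1. (x \<bullet> \<nu>) / support_fun K 0 \<nu>)"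

locale centered_body =
  fixes K :: "(real ^ 'n) set"
  assumes compact_K: "compact K" and convex_K: "convex K" and zero_interior: "0 \<in> interior K"
begin

abbreviation "h \<equiv> support_fun K 0"
abbreviation "g \<equiv> gauge_of K"

lemma K_nonempty: "K \<noteq> {}" using zero_interior interior_subset by blast

lemma h_scale: "0 \<le> t \<Longrightarrow> h (t *\<^sub>R y) = t * h y"
  by (rule support_fun_scale[OF compact_K K_nonempty])

lemma h_upper: "z \<in> K \<Longrightarrow> y \<bullet> z \<le> h y"
  using support_fun_upper[OF compact_K, of z y 0] by simp

lemma h_cont: "continuous_on S h"
  by (rule continuous_on_support_fun[OF compact_K K_nonempty])

lemma h_borel[measurable]: "h \<in> borel_measurable borel"
  by (rule borel_measurable_continuous_onI[OF h_cont])

lemma h_pos: assumes "y \<noteq> 0" shows "0 < h y"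
proof -
  obtain e where e: "0 < e" "cball 0 e \<subseteq> K" using zero_interior unfolding mem_interior_cball by blast
  have "(e / norm y) *\<^sub>R y \<in> K" using e assms by (intro subsetD[OF e(2)]) simp
  from h_upper[OF this, of y] have "e / norm y * (norm y)\<^sup>2 \<le> h y" by (simp add: power2_norm_eq_inner)
  moreover have "0 < e / norm y * (norm y)\<^sup>2" using e(1) assms by simp
  ultimately show ?thesis by linarith
qed

lemma h_nonneg: "0 \<le> h y"
  using h_pos[of y] h_scale[of 0 y] by (cases "y = 0") auto

lemma sphere_nonempty: "sphere (0::real^'n) 1 \<noteq> {}" by simp

lemma g_quot_cont: "continuous_on (sphere 0 1) (\<lambda>\<nu>. (x \<bullet> \<nu>) / h \<nu>)"
proof (intro continuous_intros h_cont ballI)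
  fix \<nu> :: "real ^ 'n" assume "\<nu> \<in> sphere 0 1"
  then have "\<nu> \<noteq> 0" by auto
  from h_pos[OF this] show "h \<nu> \<noteq> 0" by simp
qed

lemma g_bdd: "bdd_above ((\<lambda>\<nu>. (x \<bullet> \<nu>) / h \<nu>) ` sphere 0 1)"
  by (rule bounded_imp_bdd_above[OF compact_imp_bounded[OF compact_continuous_image[OF g_quot_cont compact_sphere]]])

lemma g_attained: obtains \<nu> where "norm \<nu> = 1" "g x = (x \<bullet> \<nu>) / h \<nu>" "x \<bullet> \<nu> = g x * h \<nu>"
proof -
  obtain \<nu> where \<nu>: "\<nu> \<in> sphere 0 1" "\<And>\<mu>. \<mu> \<in> sphere 0 1 \<Longrightarrow> (x \<bullet> \<mu>) / h \<mu> \<le> (x \<bullet> \<nu>) / h \<nu>"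
    using continuous_attains_sup[OF compact_sphere sphere_nonempty g_quot_cont] by blast
  have "g x = (x \<bullet> \<nu>) / h \<nu>" unfolding gauge_of_def
    using \<nu> g_bdd by (intro antisym cSUP_least cSUP_upper) auto
  moreover have "0 < h \<nu>" using \<nu>(1) by (intro h_pos) auto
  moreover have "norm \<nu> = 1" using \<nu>(1) by simp
  ultimately show thesis by (intro that[of \<nu>]) auto
qed

lemma inner_le_g_h: "x \<bullet> y \<le> g x * h y"
proof (cases "y = 0")
  case True then show ?thesis using h_scale[of 0 y] by simp
next
  case False
  have "(x \<bullet> (y /\<^sub>R norm y)) / h (y /\<^sub>R norm y) \<le> g x"
    unfolding gauge_of_def using False by (intro cSUP_upper g_bdd) simp
  then have "(x \<bullet> y) / h y \<le> g x" using False by (simp add: h_scale field_simps)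
  then show ?thesis using h_pos[OF False] by (simp add: pos_divide_le_eq)
qed

lemma g_scale: assumes "0 \<le> t" shows "g (t *\<^sub>R x) = t * g x"
proof (rule antisym)
  obtain \<nu> where "norm \<nu> = 1" "(t *\<^sub>R x) \<bullet> \<nu> = g (t *\<^sub>R x) * h \<nu>" using g_attained .
  moreover from this have "0 < h \<nu>" by (intro h_pos) auto
  ultimately show "g (t *\<^sub>R x) \<le> t * g x"
    using mult_left_mono[OF inner_le_g_h[of x \<nu>] assms] by (simp add: mult.assoc[symmetric])
  obtain \<nu> where "norm \<nu> = 1" "x \<bullet> \<nu> = g x * h \<nu>" using g_attained .
  moreover from this have "0 < h \<nu>" by (intro h_pos) auto
  ultimately show "t * g x \<le> g (t *\<^sub>R x)"
    using inner_le_g_h[of "t *\<^sub>R x" \<nu>] by (simp add: mult.assoc[symmetric])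
qed

lemma g_pos: assumes "x \<noteq> 0" shows "0 < g x"
proof -
  have "0 < x \<bullet> x" using assms by simp
  also have "\<dots> \<le> g x * h x" by (rule inner_le_g_h)
  finally show ?thesis using h_pos[OF assms] by (simp add: zero_less_mult_iff)
qed

lemma g_0: "g 0 = 0" using g_scale[of 0 0] by simp

lemma g_nonneg: "0 \<le> g x" using g_pos[of x] g_0 by (cases "x = 0") auto

lemma g_le_1_iff: "g x \<le> 1 \<longleftrightarrow> x \<in> K"
proof
  assume "g x \<le> 1"
  then have "y \<bullet> x \<le> h y" for y
    using inner_le_g_h[of x y] mult_right_mono[of "g x" 1 "h y"] h_nonneg[of y] by (simp add: inner_commute)
  then show "x \<in> K" by (rule mem_if_le_support_fun[OF compact_K convex_K K_nonempty])
next
  assume x: "x \<in> K"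
  obtain \<nu> where \<nu>: "norm \<nu> = 1" "x \<bullet> \<nu> = g x * h \<nu>" using g_attained .
  then have "0 < h \<nu>" by (intro h_pos) auto
  then show "g x \<le> 1" using h_upper[OF x, of \<nu>] \<nu>(2) by (simp add: inner_commute)
qed

text \<open>The direction attaining \<open>g x\<close> is a competitor for \<open>g y\<close>, so
  the reciprocal of the least value of \<open>h\<close> on the sphere is a Lipschitz
  constant.\<close>

lemma g_lipschitz: obtains L where "0 < L" "\<forall>x y. \<bar>g x - g y\<bar> \<le> L * norm (x - y)"
proof -
  obtain \<nu>0 where \<nu>0: "\<nu>0 \<in> sphere 0 1" "\<And>\<nu>. \<nu> \<in> sphere 0 1 \<Longrightarrow> h \<nu>0 \<le> h \<nu>"
    using continuous_attains_inf[OF compact_sphere sphere_nonempty h_cont] by blast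
  have pos: "0 < h \<nu>0" using \<nu>0(1) by (intro h_pos) auto
  have le: "g x - g y \<le> (1 / h \<nu>0) * norm (x - y)" for x y
  proof -
    obtain \<nu> where \<nu>: "norm \<nu> = 1" "g x = (x \<bullet> \<nu>) / h \<nu>" using g_attained .
    have h\<nu>: "h \<nu>0 \<le> h \<nu>" using \<nu>0(2) \<nu>(1) by simp
    have "(y \<bullet> \<nu>) / h \<nu> \<le> g y" using inner_le_g_h[of y \<nu>] pos h\<nu> by (simp add: pos_divide_le_eq)
    then have "g x - g y \<le> ((x - y) \<bullet> \<nu>) / h \<nu>" using \<nu>(2) by (simp add: inner_diff_left diff_divide_distrib)
    also have "\<dots> \<le> norm (x - y) / h \<nu>"
      using norm_cauchy_schwarz[of "x - y" \<nu>] \<nu>(1) pos h\<nu> by (intro divide_right_mono) auto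
    also have "\<dots> \<le> norm (x - y) / h \<nu>0" using pos h\<nu> by (intro divide_left_mono) auto
    finally show ?thesis by simp
  qed
  have "\<bar>g x - g y\<bar> \<le> (1 / h \<nu>0) * norm (x - y)" for x y
    using le[of x y] le[of y x] by (simp add: abs_le_iff norm_minus_commute)
  then show thesis using that[of "1 / h \<nu>0"] pos by simp
qed

lemma g_cont: "continuous_on S g"
proof -
  obtain L where L: "0 < L" "\<forall>x y. \<bar>g x - g y\<bar> \<le> L * norm (x - y)" using g_lipschitz .
  then have "L-lipschitz_on UNIV g" by (intro lipschitz_onI) (auto simp: dist_norm)
  then show ?thesis using lipschitz_on_continuous_on continuous_on_subset by blast
qed

lemma g_borel[measurable]: "g \<in> borel_measurable borel"
  by (rule borel_measurable_continuous_onI[OF g_cont])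

lemma g_less_1_iff: "g x < 1 \<longleftrightarrow> x \<in> interior K"
proof
  assume "x \<in> interior K"
  then have "\<exists>e>0. cball x e \<subseteq> K" by (simp only: mem_interior_cball)
  then obtain e where e: "0 < e" "cball x e \<subseteq> K" by (elim exE conjE)
  show "g x < 1"
  proof (cases "x = 0")
    case False
    have "x + (e / norm x) *\<^sub>R x \<in> K" using e False by (intro subsetD[OF e(2)]) (simp add: dist_norm)
    then have "(1 + e / norm x) *\<^sub>R x \<in> K" by (simp add: scaleR_add_left)
    then have "(1 + e / norm x) * g x \<le> 1" using e g_scale[of "1 + e / norm x" x] by (simp add: g_le_1_iff[symmetric])
    moreover have "0 < e / norm x * g x" using e False g_pos[OF False] by simp
    ultimately show ?thesis by (simp add: distrib_right)
  qed (simp add: g_0)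
next
  assume "g x < 1"
  have "open {x. g x < 1}" by (rule open_Collect_less[OF g_cont continuous_on_const])
  moreover have "{x. g x < 1} \<subseteq> K" using g_le_1_iff by (auto intro: less_imp_le)
  ultimately have "{x. g x < 1} \<subseteq> interior K" by (rule interior_maximal[rotated])
  then show "x \<in> interior K" using \<open>g x < 1\<close> by blast
qed

lemma frontier_iff: "x \<in> frontier K \<longleftrightarrow> g x = 1"
proof -
  have "closure K = K" using compact_imp_closed[OF compact_K] by simp
  then have "x \<in> frontier K \<longleftrightarrow> g x \<le> 1 \<and> \<not> g x < 1"
    by (simp add: frontier_def g_less_1_iff g_le_1_iff)
  then show ?thesis by auto
qed

end

section \<open>The Blaschke-Santalo inequality\<close>

lemma emeasure_cball_pos_finite:
  "emeasure lborel (cball (0::'a::euclidean_space) 1) \<noteq> 0" "emeasure lborel (cball (0::'a) 1) \<noteq> \<infinity>"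
proof -
  have "emeasure lborel (ball (0::'a) 1) \<noteq> 0"
  proof
    assume "emeasure lborel (ball (0::'a) 1) = 0"
    then have "ball (0::'a) 1 \<in> null_sets lborel" by (simp add: null_sets_def)
    then have "negligible (ball (0::'a) 1)" by (simp add: negligible_iff_null_sets null_sets_completionI)
    then show False using open_not_negligible[of "ball (0::'a) 1"] by simp
  qed
  moreover have "emeasure lborel (ball (0::'a) 1) \<le> emeasure lborel (cball (0::'a) 1)"
    by (intro emeasure_mono) auto
  ultimately show "emeasure lborel (cball (0::'a) 1) \<noteq> 0" by auto
  show "emeasure lborel (cball (0::'a) 1) \<noteq> \<infinity>"
    using emeasure_lborel_cball_finite[of "0::'a" 1] by simp
qed

context centered_body
begin

lemma K_borel[measurable]: "K \<in> sets borel"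
  using borel_compact[OF compact_K] .

lemma K_finite: "emeasure lborel K < \<infinity>"
  using emeasure_compact_finite[OF compact_K] .

lemma g_sublevel: "{x. g x \<le> 1} = K"
  using g_le_1_iff by auto

text \<open>The Gaussians of \<open>g\<close> and \<open>h\<close> satisfy the functional hypothesis
  because the pairing is at most \<open>g x * h y\<close>, hence at most half the sum of the
  squares. Their integrals are the two volumes times the same constant \<kappa>.\<close>

lemma santalo_inequality:
  assumes bary: "\<And>z. (\<integral>x. indicator K x *\<^sub>R (z \<bullet> x) \<partial>lborel) = 0"
  shows "emeasure lborel K * emeasure lborel {y. h y \<le> 1} \<le> (emeasure lborel (cball 0 1 :: (real ^ 'n) set))\<^sup>2"
proof -
  define D where "D = DIM(real ^ 'n)"
  define \<kappa> where "\<kappa> = gaussian_moment D"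
  define VB where "VB = emeasure lborel (cball 0 1 :: (real ^ 'n) set)"
  have e: "\<kappa> * VB = ennreal (sqrt (2 * pi) ^ D)"
    unfolding \<kappa>_def D_def VB_def by (rule gaussian_moment_cball)
  define M where "M = density lborel (indicator K :: real ^ 'n \<Rightarrow> ennreal)"
  have [simp]: "space M = UNIV" and [measurable_cong]: "sets M = sets borel" by (simp_all add: M_def)
  have emM: "emeasure M UNIV = emeasure lborel K" unfolding M_def by (subst emeasure_density) auto
  interpret M: finite_measure M by (rule finite_measureI) (use K_finite emM in auto)
  obtain R where R: "\<forall>x\<in>K. norm x \<le> R" using compact_imp_bounded[OF compact_K] unfolding bounded_iff by blast
  \<comment> \<open>Every dilate of \<open>K\<close> has its barycenter at the origin, and the
    Gaussian of the gauge is a mixture of dilates, so the tilt inequality is checked on each dilate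
    and integrated.\<close>
  have cent: "(\<integral>\<^sup>+x. ennreal (exp (- ((g x)\<^sup>2 / 2))) \<partial>lborel) \<le> (\<integral>\<^sup>+x. ennreal (exp (- ((g x)\<^sup>2 / 2))) * ennreal (exp (z \<bullet> x)) \<partial>lborel)" for z
  proof -
    have le: "emeasure lborel K \<le> (\<integral>\<^sup>+x. indicator K x * ennreal (exp (z \<bullet> (t *\<^sub>R x))) \<partial>lborel)" for t
    proof -
      have "emeasure M UNIV \<le> (\<integral>\<^sup>+x. indicator UNIV x * ennreal (exp ((t *\<^sub>R z) \<bullet> x)) \<partial>M)"
      proof (rule M.emeasure_le_nn_integral_exp)
        show "integrable M (\<lambda>x. (t *\<^sub>R z) \<bullet> x)"
        proof (rule M.integrable_const_bound[where B="norm (t *\<^sub>R z) * R"])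
          have "norm ((t *\<^sub>R z) \<bullet> x) \<le> norm (t *\<^sub>R z) * R" if "x \<in> K" for x
            using R that Cauchy_Schwarz_ineq2[of "t *\<^sub>R z" x] mult_left_mono[of "norm x" R "norm (t *\<^sub>R z)"] by fastforce
          then show "AE x in M. norm ((t *\<^sub>R z) \<bullet> x) \<le> norm (t *\<^sub>R z) * R"
            unfolding M_def by (subst AE_density) (auto simp: indicator_def split: if_splits)
        qed measurable
        have "(\<integral>x. (t *\<^sub>R z) \<bullet> x \<partial>M) = (\<integral>x. indicator K x *\<^sub>R ((t *\<^sub>R z) \<bullet> x) \<partial>lborel)"
        proof -
          have "M = density lborel (\<lambda>x. ennreal (indicator K x))" unfolding M_def by (intro density_cong) (auto simp: indicator_def)
          then show ?thesis by (simp only:) (subst integral_density, auto)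
        qed
        then show "(\<integral>x. indicator UNIV x * ((t *\<^sub>R z) \<bullet> x) \<partial>M) = 0" using bary[of "t *\<^sub>R z"]
          by (simp only: indicator_UNIV mult_1)
      qed simp
      also have "\<dots> = (\<integral>\<^sup>+x. indicator K x * ennreal (exp (z \<bullet> (t *\<^sub>R x))) \<partial>lborel)"
        unfolding M_def by (subst nn_integral_density) auto
      finally show ?thesis unfolding emM .
    qed
    \<comment> \<open>The factor 1 gives both sides the shape required by
      \<open>nn_integral_gaussian_homogeneous\<close>, so that they are sliced into the same
      dilates.\<close>
    have "(\<integral>\<^sup>+x. ennreal (exp (- ((g x)\<^sup>2 / 2))) * 1 \<partial>lborel)
      \<le> (\<integral>\<^sup>+x. ennreal (exp (- ((g x)\<^sup>2 / 2))) * ennreal (exp (z \<bullet> x)) \<partial>lborel)"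
      by (subst (1 2) nn_integral_gaussian_homogeneous)
        (auto simp: g_nonneg g_scale g_sublevel intro!: nn_integral_mono mult_left_mono le[unfolded inner_scaleR_right])
    then show ?thesis by simp
  qed
  have "(\<integral>\<^sup>+x. ennreal (exp (- ((g x)\<^sup>2 / 2))) \<partial>lborel) * (\<integral>\<^sup>+y. ennreal (exp (- ((h y)\<^sup>2 / 2))) \<partial>lborel)
      \<le> ennreal ((2 * pi) ^ DIM(real ^ 'n))"
  proof (rule functional_santalo)
    fix x y :: "real ^ 'n"
    have "x \<bullet> y \<le> g x * h y" by (rule inner_le_g_h)
    also have "\<dots> \<le> (g x)\<^sup>2 / 2 + (h y)\<^sup>2 / 2"
      using zero_le_power2[of "g x - h y"] by (simp add: power2_diff)
    finally show "ennreal (exp (- ((g x)\<^sup>2 / 2))) * ennreal (exp (- ((h y)\<^sup>2 / 2))) \<le> ennreal (exp (- (x \<bullet> y)))"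
      by (simp add: ennreal_mult[symmetric] exp_add[symmetric])
  qed (auto intro: cent)
  then have "(\<kappa> * emeasure lborel K) * (\<kappa> * emeasure lborel {y. h y \<le> 1}) \<le> ennreal ((2 * pi) ^ D)"
    using nn_integral_gaussian_sublevel[OF g_borel g_nonneg g_scale] nn_integral_gaussian_sublevel[OF h_borel h_nonneg h_scale]
    by (simp add: \<kappa>_def D_def g_sublevel)
  \<comment> \<open>For the unit ball the gauge and the support function are both the norm, so the
    constant is the product of two equal Gaussian integrals of the ball; \<kappa> then cancels from
    both sides.\<close>
  also have "\<dots> = (\<kappa> * VB) * (\<kappa> * VB)"
  proof -
    have "sqrt (2 * pi) ^ D * sqrt (2 * pi) ^ D = (2 * pi) ^ D"
      unfolding power_mult_distrib[symmetric] by simp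
    then show ?thesis unfolding e by (subst ennreal_mult[symmetric]) auto
  qed
  finally have "(\<kappa> * \<kappa>) * (emeasure lborel K * emeasure lborel {y. h y \<le> 1}) \<le> (\<kappa> * \<kappa>) * VB\<^sup>2"
    unfolding power2_eq_square by (simp only: mult_ac)
  moreover have "\<kappa> \<noteq> 0" "\<kappa> \<noteq> \<infinity>"
  proof -
    have "ennreal (sqrt (2 * pi) ^ D) \<noteq> 0" by (simp add: ennreal_eq_0_iff not_le)
    with e show "\<kappa> \<noteq> 0" by (metis mult_zero_left)
    show "\<kappa> \<noteq> \<infinity>"
    proof
      assume "\<kappa> = \<infinity>"
      then have "\<kappa> * VB = \<infinity>" using emeasure_cball_pos_finite(1)[where 'a="real ^ 'n"] by (simp add: VB_def ennreal_top_mult)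
      then show False unfolding e by simp
    qed
  qed
  ultimately show ?thesis
    by (subst (asm) ennreal_mult_le_mult_iff) (auto simp: VB_def ennreal_mult_eq_top_iff)
qed

end

text \<open>If the barycenter \<open>w\<close> were not interior, some linear functional would be
  minimal over \<open>S\<close> at the value taken at \<open>w\<close>. Since its mean excess
  vanishes, almost all of \<open>S\<close> would lie in a hyperplane, although the interior has
  positive measure.\<close>

lemma interior_barycenter:
  fixes S :: "('a::euclidean_space) set"
  assumes S: "compact S" "convex S" "interior S \<noteq> {}"
  obtains w where "w \<in> interior S" "\<And>z. (\<integral>x. indicator S x *\<^sub>R (z \<bullet> (x - w)) \<partial>lborel) = 0"
proof -
  have [measurable]: "S \<in> sets borel" using borel_compact[OF S(1)] .
  have fin: "emeasure lborel S < \<infinity>" using emeasure_compact_finite[OF S(1)] .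
  have int_pos: "emeasure lborel (interior S) \<noteq> 0"
  proof
    assume "emeasure lborel (interior S) = 0"
    then have "interior S \<in> null_sets lborel" by (simp add: null_sets_def)
    then have "negligible (interior S)" by (simp add: negligible_iff_null_sets null_sets_completionI)
    then show False using open_not_negligible[OF open_interior S(3)] by simp
  qed
  have "emeasure lborel (interior S) \<le> emeasure lborel S" by (intro emeasure_mono interior_subset) simp
  with int_pos have "emeasure lborel S \<noteq> 0" by auto
  then have V: "0 < measure lborel S" using fin by (simp add: measure_def enn2real_positive_iff zero_less_iff_neq_zero)
  have int1: "integrable lborel (\<lambda>x. indicator S x *\<^sub>R x)"
    by (rule borel_integrable_compact[OF S(1) continuous_on_id])
  define w where "w = (1 / measure lborel S) *\<^sub>R (\<integral>x. indicator S x *\<^sub>R x \<partial>lborel)"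
  have zero: "(\<integral>x. indicator S x *\<^sub>R (z \<bullet> (x - w)) \<partial>lborel) = 0" for z
  proof -
    have intS: "integrable lborel (\<lambda>x. indicat_real S x)" using fin by simp
    have "(\<integral>x. indicator S x *\<^sub>R (z \<bullet> (x - w)) \<partial>lborel) = (\<integral>x. z \<bullet> (indicator S x *\<^sub>R x) - indicator S x * (z \<bullet> w) \<partial>lborel)"
      by (intro Bochner_Integration.integral_cong) (auto simp: inner_diff_right algebra_simps)
    also have "\<dots> = z \<bullet> (\<integral>x. indicator S x *\<^sub>R x \<partial>lborel) - measure lborel S * (z \<bullet> w)"
      using integrable_inner_right[OF int1, of z] intS fin integral_inner_right[OF int1, of z]
      by (subst Bochner_Integration.integral_diff) (auto simp del: inner_scaleR_right)
    also have "\<dots> = 0" using V by (simp add: w_def)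
    finally show ?thesis .
  qed
  have "w \<in> interior S"
  proof (rule ccontr)
    assume "w \<notin> interior S"
    then obtain a b where ab: "a \<noteq> 0" "\<forall>x\<in>{w}. a \<bullet> x \<le> b" "\<forall>x\<in>interior S. b \<le> a \<bullet> x"
      using separating_hyperplane_sets[of "{w}" "interior S"] S convex_interior[OF S(2)] by auto
    have ge: "a \<bullet> w \<le> a \<bullet> x" if "x \<in> S" for x
    proof -
      have "S \<subseteq> closure (interior S)" using convex_closure_interior[OF S(2,3)] closure_subset by blast
      moreover have "closure (interior S) \<subseteq> {x. a \<bullet> w \<le> a \<bullet> x}"
        using ab by (intro closure_minimal closed_halfspace_ge) force
      ultimately show ?thesis using that by blast
    qed
    have intz: "integrable lborel (\<lambda>x. indicator S x *\<^sub>R (a \<bullet> (x - w)))"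
      by (intro borel_integrable_compact S continuous_intros)
    have "AE x in lborel. indicator S x *\<^sub>R (a \<bullet> (x - w)) = 0"
      using integral_nonneg_eq_0_iff_AE[OF intz] ge zero[of a] by (auto simp: inner_diff_right indicator_def)
    moreover have "AE x in lborel. a \<bullet> x \<noteq> a \<bullet> w"
    proof -
      have "negligible {x. a \<bullet> x = a \<bullet> w}" using ab(1) by (intro negligible_hyperplane) auto
      then have "{x. a \<bullet> x = a \<bullet> w} \<in> null_sets lborel"
        by (simp add: negligible_iff_null_sets null_sets_completion_iff)
      from AE_not_in[OF this] show ?thesis by simp
    qed
    ultimately have "AE x in lborel. x \<notin> interior S"
    proof eventually_elim
      case (elim x)
      then show ?case using interior_subset[of S] by (auto simp: indicator_def inner_diff_right)
    qed
    then have "emeasure lborel (interior S) = 0"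
      by (subst (asm) AE_iff_measurable[where N="interior S"]) auto
    then show False using int_pos by simp
  qed
  then show thesis using zero that by blast
qed

text \<open>The point \<open>w\<close> is the barycenter, which in general is not the Santalo point.
  A bound at any interior point is enough, because a Santalo point has the smallest polar
  volume.\<close>

lemma blaschke_santalo:
  fixes \<Omega> :: "(real ^ 'n) set"
  assumes "convex_body \<Omega>"
  obtains w where "w \<in> interior \<Omega>"
    "measure lebesgue \<Omega> * measure lebesgue (polar_dual \<Omega> w) \<le> (measure lebesgue (cball 0 1 :: (real ^ 'n) set))\<^sup>2"
proof -
  have S: "compact \<Omega>" "convex \<Omega>" "interior \<Omega> \<noteq> {}" using assms by (auto simp: convex_body_def)
  obtain w where w: "w \<in> interior \<Omega>" "\<And>z. (\<integral>x. indicator \<Omega> x *\<^sub>R (z \<bullet> (x - w)) \<partial>lborel) = 0"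
    using interior_barycenter[OF S] by blast
  define K where "K = (+) (- w) ` \<Omega>"
  have K_eq: "K = (\<lambda>z. z - w) ` \<Omega>" by (simp add: K_def)
  have [measurable]: "\<Omega> \<in> sets borel" using borel_compact[OF S(1)] .
  interpret centered_body K
  proof
    show "compact K" unfolding K_def using S(1) by (rule compact_translation)
    show "convex K" unfolding K_def using S(2) by (rule convex_translation)
    show "0 \<in> interior K" using w(1) unfolding K_def interior_translation by force
  qed
  have shift: "(\<integral>x. f x \<partial>lborel) = (\<integral>x. f (x - w) \<partial>lborel)" if [measurable]: "f \<in> borel_measurable borel" for f :: "real ^ 'n \<Rightarrow> real"
  proof -
    have "lborel = distr lborel borel (\<lambda>x. - w + x)" by (rule lborel_distr_plus[symmetric])
    then have "(\<integral>x. f x \<partial>lborel) = (\<integral>x. f x \<partial>distr lborel borel (\<lambda>x. - w + x))" by simp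
    then show ?thesis by (simp add: integral_distr)
  qed
  have "(\<integral>x. indicator K x *\<^sub>R (z \<bullet> x) \<partial>lborel) = 0" for z
  proof -
    have ind: "indicator K (x - w) = (indicator \<Omega> x :: real)" for x by (auto simp: K_eq indicator_def)
    have "(\<integral>x. indicator K x *\<^sub>R (z \<bullet> x) \<partial>lborel) = (\<integral>x. indicator K (x - w) *\<^sub>R (z \<bullet> (x - w)) \<partial>lborel)"
      by (rule shift) measurable
    then show ?thesis unfolding ind using w(2) by simp
  qed
  note ineq = santalo_inequality[OF this]
  have pd: "polar_dual \<Omega> w = (+) w ` {y. h y \<le> 1}"
    unfolding polar_dual_def K_eq support_fun_translate by (auto simp: image_iff add.commute)
  have meas: "measure lebesgue K = measure lebesgue \<Omega>" "measure lebesgue (polar_dual \<Omega> w) = measure lebesgue {y. h y \<le> 1}"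
    unfolding K_def pd by (rule measure_translation)+
  have hm: "{y. h y \<le> 1} \<in> sets borel" by measurable
  have "emeasure lborel K \<noteq> 0"
  proof
    assume "emeasure lborel K = 0"
    then have "K \<in> null_sets lborel" by (simp add: null_sets_def)
    then have "negligible K" by (simp add: negligible_iff_null_sets null_sets_completionI)
    then have "negligible (interior K)" by (rule negligible_subset[OF _ interior_subset])
    then show False using open_not_negligible[OF open_interior] zero_interior by blast
  qed
  then have hfin: "emeasure lborel {y. h y \<le> 1} \<noteq> \<infinity>"
    using ineq emeasure_cball_pos_finite(2)[where 'a="real ^ 'n"]
    by (auto simp: ennreal_mult_top ennreal_mult_eq_top_iff top_unique power2_eq_square)
  have "measure lborel K * measure lborel {y. h y \<le> 1} \<le> (measure lborel (cball 0 1 :: (real ^ 'n) set))\<^sup>2"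
  proof -
    have "enn2real (emeasure lborel K * emeasure lborel {y. h y \<le> 1}) \<le> enn2real ((emeasure lborel (cball 0 1 :: (real ^ 'n) set))\<^sup>2)"
      using ineq emeasure_cball_pos_finite(2)[where 'a="real ^ 'n"]
      by (intro enn2real_mono) (auto simp: power2_eq_square ennreal_mult_less_top less_top)
    then show ?thesis by (simp add: measure_def enn2real_mult power2_eq_square)
  qed
  then have "measure lebesgue K * measure lebesgue {y. h y \<le> 1} \<le> (measure lebesgue (cball 0 1 :: (real ^ 'n) set))\<^sup>2"
    using hm by (simp add: measure_completion)
  then show thesis using that[OF w(1)] meas by simp
qed

section \<open>The Gauss map\<close>

definition unit_normal :: "(real ^ 'n) set \<Rightarrow> real ^ 'n \<Rightarrow> real ^ 'n \<Rightarrow> bool" where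
  "unit_normal \<Omega> p \<nu> \<longleftrightarrow> norm \<nu> = 1 \<and> (\<forall>z\<in>\<Omega>. \<nu> \<bullet> (z - p) \<le> 0)"

lemma unit_normal_interior:
  assumes "unit_normal \<Omega> p \<nu>" "c \<in> interior \<Omega>" shows "\<nu> \<bullet> (c - p) < 0"
proof -
  obtain e where e: "0 < e" "cball c e \<subseteq> \<Omega>" using assms(2) unfolding mem_interior_cball by blast
  have \<nu>: "norm \<nu> = 1" using assms(1) by (simp add: unit_normal_def)
  have "c + e *\<^sub>R \<nu> \<in> cball c e" using e(1) \<nu> by (simp add: dist_norm)
  then have "\<nu> \<bullet> (c + e *\<^sub>R \<nu> - p) \<le> 0" using e(2) assms(1) unfolding unit_normal_def by blast
  moreover have "\<nu> \<bullet> (c + e *\<^sub>R \<nu> - p) = \<nu> \<bullet> (c - p) + e"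
    using \<nu> by (simp add: inner_diff_right inner_add_right dot_square_norm)
  ultimately show ?thesis using e(1) by linarith
qed

lemma unit_normal_exists:
  assumes "convex_body \<Omega>" "p \<in> frontier \<Omega>" obtains \<nu> where "unit_normal \<Omega> p \<nu>"
proof -
  have S: "convex \<Omega>" "interior \<Omega> \<noteq> {}" using assms(1) by (auto simp: convex_body_def)
  have "p \<notin> interior \<Omega>" using assms(2) by (simp add: frontier_def)
  then obtain a b where ab: "a \<noteq> 0" "\<forall>x\<in>interior \<Omega>. a \<bullet> x \<le> b" "\<forall>x\<in>{p}. b \<le> a \<bullet> x"
    using separating_hyperplane_sets[of "interior \<Omega>" "{p}"] S convex_interior[OF S(1)] by auto
  have "\<Omega> \<subseteq> closure (interior \<Omega>)" using convex_closure_interior[OF S] closure_subset by blast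
  moreover have "closure (interior \<Omega>) \<subseteq> {x. a \<bullet> x \<le> b}"
    using ab(2) by (intro closure_minimal closed_halfspace_le) auto
  ultimately have "a \<bullet> (z - p) \<le> 0" if "z \<in> \<Omega>" for z
    using ab(3) that by (fastforce simp: inner_diff_right)
  then have "unit_normal \<Omega> p (a /\<^sub>R norm a)"
    using ab(1) by (auto simp: unit_normal_def intro!: mult_nonneg_nonpos)
  then show thesis by (rule that)
qed

text \<open>Suppose \<nu> has a positive component along a tangent direction \<open>v\<close>. For
  small \<open>t\<close> the function \<open>f\<close> changes sign between the directions v -
  \<epsilon> e and v + \<epsilon> e, so some intermediate direction leads to a zero of
  \<open>f\<close>, that is, to a boundary point. The choice of \<epsilon> keeps the pairing of
  \<nu> with all these directions positive, which contradicts the supporting inequality.\<close>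

lemma unit_normal_tangent_le:
  assumes "compact \<Omega>" and U: "open U" "p \<in> U" and fU: "frontier \<Omega> \<inter> U = {x \<in> U. f x = 0}"
    and cont: "continuous_on U f" and p: "p \<in> frontier \<Omega>"
    and f': "(f has_derivative (\<lambda>v. e \<bullet> v)) (at p)" and e: "e \<noteq> 0"
    and \<nu>: "unit_normal \<Omega> p \<nu>" and v: "e \<bullet> v = 0"
  shows "\<nu> \<bullet> v \<le> 0"
proof (rule ccontr)
  assume "\<not> \<nu> \<bullet> v \<le> 0"
  then have pos: "0 < \<nu> \<bullet> v" by simp
  define \<epsilon> where "\<epsilon> = (\<nu> \<bullet> v) / (2 * (\<bar>\<nu> \<bullet> e\<bar> + 1))"
  have \<epsilon>: "0 < \<epsilon>" using pos by (simp add: \<epsilon>_def add_nonneg_pos)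
  have \<epsilon>2: "\<epsilon> * \<bar>\<nu> \<bullet> e\<bar> < \<nu> \<bullet> v"
  proof -
    have "\<epsilon> * (\<bar>\<nu> \<bullet> e\<bar> + 1) = (\<nu> \<bullet> v) / 2" by (simp add: \<epsilon>_def field_simps)
    then show ?thesis using \<epsilon> pos by (simp add: distrib_left)
  qed
  have fp: "f p = 0" using fU p U(2) by blast
  have dir: "((\<lambda>t. f (p + t *\<^sub>R w)) has_real_derivative e \<bullet> w) (at 0)" for w
  proof -
    have "((\<lambda>t. p + t *\<^sub>R w) has_derivative (\<lambda>t. t *\<^sub>R w)) (at (0::real))"
      by (auto intro!: derivative_eq_intros)
    moreover have "(f has_derivative (\<lambda>v. e \<bullet> v)) (at (p + 0 *\<^sub>R w))" using f' by simp
    ultimately have "((\<lambda>t. f (p + t *\<^sub>R w)) has_derivative (\<lambda>t. e \<bullet> (t *\<^sub>R w))) (at 0)"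
      by (rule has_derivative_compose)
    moreover have "(\<lambda>t. e \<bullet> (t *\<^sub>R w)) = (*) (e \<bullet> w)" by (simp add: fun_eq_iff)
    ultimately show ?thesis by (simp only: has_field_derivative_def)
  qed
  have ee: "0 < e \<bullet> e" using e by simp
  define wp wm where "wp = v + \<epsilon> *\<^sub>R e" and "wm = v - \<epsilon> *\<^sub>R e"
  have "0 < e \<bullet> wp" using v \<epsilon> ee by (simp add: wp_def inner_add_right)
  then obtain d1 where d1: "0 < d1" "\<forall>t>0. t < d1 \<longrightarrow> f p < f (p + t *\<^sub>R wp)"
    using DERIV_pos_inc_right[OF dir[of wp]] by auto
  have "e \<bullet> wm < 0" using v \<epsilon> ee by (simp add: wm_def inner_diff_right)
  then obtain d2 where d2: "0 < d2" "\<forall>t>0. t < d2 \<longrightarrow> f p > f (p + t *\<^sub>R wm)"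
    using DERIV_neg_dec_right[OF dir[of wm]] by auto
  obtain r where r: "0 < r" "ball p r \<subseteq> U" using U openE by blast
  define M where "M = norm v + \<epsilon> * norm e + 1"
  have M: "0 < M" using \<epsilon> by (simp add: M_def add_nonneg_pos)
  define t where "t = min (min (d1 / 2) (d2 / 2)) (r / (2 * M))"
  have t: "0 < t" "t < d1" "t < d2" "t * M < r"
  proof -
    show "0 < t" "t < d1" "t < d2" using d1(1) d2(1) r(1) M by (auto simp: t_def)
    have "t * M \<le> r / (2 * M) * M" using M by (intro mult_right_mono) (auto simp: t_def)
    also have "\<dots> < r" using M r(1) by simp
    finally show "t * M < r" .
  qed
  define \<gamma> where "\<gamma> s = p + t *\<^sub>R (v + s *\<^sub>R e)" for s
  have \<gamma>U: "\<gamma> s \<in> U" if "s \<in> {-\<epsilon>..\<epsilon>}" for s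
  proof -
    have "norm (v + s *\<^sub>R e) \<le> norm v + \<bar>s\<bar> * norm e" using norm_triangle_ineq[of v "s *\<^sub>R e"] by simp
    also have "\<dots> \<le> norm v + \<epsilon> * norm e" using that by (intro add_left_mono mult_right_mono) auto
    also have "\<dots> \<le> M" by (simp add: M_def)
    finally have "t * norm (v + s *\<^sub>R e) \<le> t * M" using t(1) by (intro mult_left_mono) auto
    then have "t * norm (v + s *\<^sub>R e) < r" using t(4) by (rule order_le_less_trans)
    then have "dist p (\<gamma> s) < r" using t(1) by (simp add: \<gamma>_def dist_norm)
    then show ?thesis using r(2) by auto
  qed
  have "continuous_on {-\<epsilon>..\<epsilon>} (\<lambda>s. f (\<gamma> s))"
  proof (rule continuous_on_compose2[OF cont])
    show "continuous_on {-\<epsilon>..\<epsilon>} \<gamma>" unfolding \<gamma>_def by (intro continuous_intros)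
  qed (use \<gamma>U in blast)
  moreover have "f (\<gamma> (- \<epsilon>)) \<le> 0" "0 \<le> f (\<gamma> \<epsilon>)"
    using d1(2) d2(2) t fp by (auto simp: \<gamma>_def wp_def wm_def intro: less_imp_le)
  ultimately obtain s where s: "-\<epsilon> \<le> s" "s \<le> \<epsilon>" "f (\<gamma> s) = 0"
    using IVT'[of "\<lambda>s. f (\<gamma> s)" "- \<epsilon>" 0 \<epsilon>] \<epsilon> by auto
  then have "\<gamma> s \<in> frontier \<Omega>" using fU \<gamma>U[of s] by auto
  then have "\<gamma> s \<in> \<Omega>" using frontier_subset_closed[OF compact_imp_closed[OF assms(1)]] by blast
  then have "\<nu> \<bullet> (t *\<^sub>R (v + s *\<^sub>R e)) \<le> 0" using \<nu> by (auto simp: unit_normal_def \<gamma>_def)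
  then have "\<nu> \<bullet> v + s * (\<nu> \<bullet> e) \<le> 0" using t(1) by (simp add: inner_add_right mult_le_0_iff)
  moreover have "\<bar>s * (\<nu> \<bullet> e)\<bar> \<le> \<epsilon> * \<bar>\<nu> \<bullet> e\<bar>" using s by (auto simp: abs_mult intro!: mult_right_mono)
  ultimately show False using \<epsilon>2 by linarith
qed

lemma unit_normal_gradient:
  assumes "compact \<Omega>" and U: "open U" "p \<in> U" and fU: "frontier \<Omega> \<inter> U = {x \<in> U. f x = 0}"
    and cont: "continuous_on U f" and p: "p \<in> frontier \<Omega>"
    and f': "(f has_derivative (\<lambda>v. e \<bullet> v)) (at p)" and e: "e \<noteq> 0"
    and \<nu>: "unit_normal \<Omega> p \<nu>"
  obtains s where "\<nu> = s *\<^sub>R e"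
proof -
  note tan = unit_normal_tangent_le[OF assms(1) U fU cont p f' e \<nu>]
  define s where "s = (\<nu> \<bullet> e) / (e \<bullet> e)"
  define v where "v = \<nu> - s *\<^sub>R e"
  have ev: "e \<bullet> v = 0" using e by (simp add: v_def s_def inner_diff_right inner_commute)
  have "\<nu> \<bullet> v \<le> 0" "\<nu> \<bullet> (- v) \<le> 0" using tan[of v] tan[of "- v"] ev by auto
  then have "\<nu> \<bullet> v = 0" by simp
  then have "v \<bullet> v = 0" using ev by (simp add: v_def inner_diff_left)
  then show thesis using that[of s] by (simp add: v_def)
qed

text \<open>Differentiability of the gradient \<open>e\<close>, from the second order of smoothness,
  is what later makes the Gauss map differentiable.\<close>

lemma smooth_fun_gradient:
  assumes "smooth_fun_on f U" "open U"
  obtains e where "\<And>x. x \<in> U \<Longrightarrow> (f has_derivative (\<lambda>v. e x \<bullet> v)) (at x)"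
    "\<And>x. x \<in> U \<Longrightarrow> e differentiable (at x)"
    "\<And>x. x \<in> U \<Longrightarrow> frechet_derivative f (at x) = (\<lambda>v. e x \<bullet> v)"
proof -
  have C: "C_k_on (Suc (Suc 0)) f U" using assms(1) unfolding smooth_fun_on_def by blast
  then have diff: "f differentiable (at x)" if "x \<in> U" for x using that by simp
  have diff2: "(\<lambda>x. frechet_derivative f (at x) v) differentiable (at x)" if "x \<in> U" for x v
    using C that by simp
  define e where "e x = (\<Sum>b\<in>Basis. frechet_derivative f (at x) b *\<^sub>R b)" for x :: "real ^ 'a"
  have eq: "frechet_derivative f (at x) = (\<lambda>v. e x \<bullet> v)" if "x \<in> U" for x
  proof
    fix v
    have lin: "linear (frechet_derivative f (at x))" using linear_frechet_derivative[OF diff[OF that]] .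
    have "frechet_derivative f (at x) v = frechet_derivative f (at x) (\<Sum>b\<in>Basis. (v \<bullet> b) *\<^sub>R b)"
      by (simp add: euclidean_representation)
    also have "\<dots> = (\<Sum>b\<in>Basis. (v \<bullet> b) * frechet_derivative f (at x) b)"
      by (simp add: linear_sum[OF lin] linear_cmul[OF lin])
    also have "\<dots> = e x \<bullet> v" by (simp add: e_def inner_sum_left inner_commute[of v] mult.commute)
    finally show "frechet_derivative f (at x) v = e x \<bullet> v" .
  qed
  show thesis
  proof (rule that)
    show "e differentiable (at x)" if "x \<in> U" for x
      unfolding e_def using diff2[OF that] by (intro differentiable_sum differentiable_scaleR) auto
    show "(f has_derivative (\<lambda>v. e x \<bullet> v)) (at x)" if "x \<in> U" for x
      using diff[OF that] eq[OF that] by (simp add: frechet_derivative_works)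
  qed (rule eq)
qed

section \<open>Differentiability and injectivity of the Gauss map\<close>

locale smooth_body =
  fixes \<Omega> :: "(real ^ 'n) set"
  assumes body: "convex_body \<Omega>" and smooth: "smooth_boundary \<Omega>"
begin

abbreviation "gm \<equiv> gauss_map \<Omega>"

lemma body': "compact \<Omega>" "convex \<Omega>" "interior \<Omega> \<noteq> {}"
  using body by (auto simp: convex_body_def)

lemma frontier_mem: "p \<in> frontier \<Omega> \<Longrightarrow> p \<in> \<Omega>"
  using frontier_subset_closed[OF compact_imp_closed[OF body'(1)]] by blast

text \<open>Both normals are unit multiples of one gradient, hence equal up to sign, and an interior
  point lies strictly on the negative side of each, which excludes opposite signs.\<close>

lemma unit_normal_unique:
  assumes p: "p \<in> frontier \<Omega>" and "unit_normal \<Omega> p \<nu>" "unit_normal \<Omega> p \<mu>" shows "\<nu> = \<mu>"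
proof -
  obtain U f where U: "open U" "p \<in> U" "smooth_fun_on f U" "frontier \<Omega> \<inter> U = {x \<in> U. f x = 0}"
    "\<forall>x\<in>U. frechet_derivative f (at x) \<noteq> (\<lambda>v. 0)"
    using smooth p unfolding smooth_boundary_def by blast
  obtain e where e: "\<And>x. x \<in> U \<Longrightarrow> (f has_derivative (\<lambda>v. e x \<bullet> v)) (at x)"
    "\<And>x. x \<in> U \<Longrightarrow> frechet_derivative f (at x) = (\<lambda>v. e x \<bullet> v)"
    using smooth_fun_gradient[OF U(3,1)] by metis
  have cont: "continuous_on U f"
    using e(1) by (meson continuous_at_imp_continuous_on has_derivative_continuous)
  have e0: "e p \<noteq> 0" using U(2,5) e(2) by fastforce
  obtain s t where st: "\<nu> = s *\<^sub>R e p" "\<mu> = t *\<^sub>R e p"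
    using unit_normal_gradient[OF body'(1) U(1,2,4) cont p e(1)[OF U(2)] e0] assms(2,3) by metis
  have "\<bar>s\<bar> * norm (e p) = 1" "\<bar>t\<bar> * norm (e p) = 1"
    using assms(2,3) st by (auto simp: unit_normal_def)
  then have "\<bar>s\<bar> = \<bar>t\<bar>" using e0 by (metis mult_right_cancel norm_eq_zero)
  moreover have "\<not> (s = - t)"
  proof
    assume "s = - t"
    then have "\<nu> = - \<mu>" using st by simp
    obtain c where "c \<in> interior \<Omega>" using body' by blast
    from unit_normal_interior[OF assms(2) this] unit_normal_interior[OF assms(3) this] \<open>\<nu> = - \<mu>\<close>
    show False by simp
  qed
  ultimately show ?thesis using st by (auto simp: abs_eq_iff)
qed

lemma gauss_map_eqI:
  assumes "p \<in> frontier \<Omega>" "unit_normal \<Omega> p \<nu>" shows "gm p = \<nu>"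
  unfolding gauss_map_def unit_normal_def[symmetric]
  using assms unit_normal_unique by blast

lemma unit_normal_gauss_map: assumes "p \<in> frontier \<Omega>" shows "unit_normal \<Omega> p (gm p)"
proof -
  obtain \<nu> where "unit_normal \<Omega> p \<nu>" using unit_normal_exists[OF body assms] .
  with gauss_map_eqI[OF assms this] show ?thesis by simp
qed

lemma norm_gauss_map: "p \<in> frontier \<Omega> \<Longrightarrow> norm (gm p) = 1"
  using unit_normal_gauss_map by (simp add: unit_normal_def)

text \<open>The Gauss map is plus or minus the normalized gradient of a local defining function. The
  sign is read off by pairing the gradient with the vector from an interior point \<open>c\<close>;
  this pairing never vanishes on the boundary, so by continuity the sign is constant near
  \<open>p\<close>.\<close>

lemma gauss_map_differentiable:
  assumes p: "p \<in> frontier \<Omega>" shows "gm differentiable (at p within frontier \<Omega>)"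
proof -
  obtain U f where U: "open U" "p \<in> U" "smooth_fun_on f U" "frontier \<Omega> \<inter> U = {x \<in> U. f x = 0}"
    "\<forall>x\<in>U. frechet_derivative f (at x) \<noteq> (\<lambda>v. 0)"
    using smooth p unfolding smooth_boundary_def by blast
  obtain e where e: "\<And>x. x \<in> U \<Longrightarrow> (f has_derivative (\<lambda>v. e x \<bullet> v)) (at x)"
    "\<And>x. x \<in> U \<Longrightarrow> e differentiable (at x)"
    "\<And>x. x \<in> U \<Longrightarrow> frechet_derivative f (at x) = (\<lambda>v. e x \<bullet> v)"
    using smooth_fun_gradient[OF U(3,1)] by metis
  have cont: "continuous_on U f"
    using e(1) by (meson continuous_at_imp_continuous_on has_derivative_continuous)
  have e0: "e x \<noteq> 0" if "x \<in> U" for x using U(5) e(3) that by fastforce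
  have conte: "continuous_on U e"
    using e(2) by (meson continuous_at_imp_continuous_on differentiable_imp_continuous_within)
  obtain c where c: "c \<in> interior \<Omega>" using body' by blast
  have form: "gm q = sgn (e q \<bullet> (q - c)) *\<^sub>R (inverse (norm (e q)) *\<^sub>R e q)" and nz: "e q \<bullet> (q - c) \<noteq> 0"
    if q: "q \<in> frontier \<Omega>" "q \<in> U" for q
  proof -
    note un = unit_normal_gauss_map[OF q(1)]
    obtain s where s: "gm q = s *\<^sub>R e q"
      using unit_normal_gradient[OF body'(1) U(1) q(2) U(4) cont q(1) e(1)[OF q(2)] e0[OF q(2)] un] .
    have "0 < s * (e q \<bullet> (q - c))" using unit_normal_interior[OF un c] s by (simp add: inner_diff_right algebra_simps)
    then have *: "sgn s = sgn (e q \<bullet> (q - c))" "e q \<bullet> (q - c) \<noteq> 0" by (auto simp: zero_less_mult_iff)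
    have "\<bar>s\<bar> * norm (e q) = 1" using norm_gauss_map[OF q(1)] s by simp
    then have "\<bar>s\<bar> = inverse (norm (e q))" using e0[OF q(2)] by (simp add: field_simps)
    then have "s = sgn (e q \<bullet> (q - c)) * inverse (norm (e q))" using * by (metis mult_sgn_abs)
    then show "gm q = sgn (e q \<bullet> (q - c)) *\<^sub>R (inverse (norm (e q)) *\<^sub>R e q)" "e q \<bullet> (q - c) \<noteq> 0" using s * by simp_all
  qed
  define \<sigma> where "\<sigma> = sgn (e p \<bullet> (p - c))"
  have \<sigma>: "0 < \<sigma> * (e p \<bullet> (p - c))" using nz[OF p U(2)] by (auto simp: \<sigma>_def sgn_if)
  have "continuous_on U (\<lambda>q. \<sigma> * (e q \<bullet> (q - c)))" by (intro continuous_intros conte)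
  then have "open (U \<inter> (\<lambda>q. \<sigma> * (e q \<bullet> (q - c))) -` {0<..})"
    by (simp add: continuous_on_open_vimage U(1) Int_commute)
  then obtain d where d: "0 < d" "ball p d \<subseteq> U \<inter> (\<lambda>q. \<sigma> * (e q \<bullet> (q - c))) -` {0<..}"
    using \<sigma> U(2) by (meson Int_iff greaterThan_iff openE vimageI2)
  obtain e' where e': "(e has_derivative e') (at p)" using e(2)[OF U(2)] by (auto simp: differentiable_def)
  have "(\<lambda>q. norm (e q)) differentiable (at p)"
    using differentiable_chain_at[OF e(2)[OF U(2)] differentiable_norm_at[OF e0[OF U(2)]]] by (simp add: comp_def)
  then have "(\<lambda>q. \<sigma> *\<^sub>R (inverse (norm (e q)) *\<^sub>R e q)) differentiable (at p)"
    using e(2)[OF U(2)] e0[OF U(2)] by (intro differentiable_scaleR differentiable_const differentiable_inverse) auto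
  then obtain G where G: "((\<lambda>q. \<sigma> *\<^sub>R (inverse (norm (e q)) *\<^sub>R e q)) has_derivative G) (at p within frontier \<Omega>)"
    by (meson differentiable_def has_derivative_at_withinI)
  have "(gm has_derivative G) (at p within frontier \<Omega>)"
  proof (rule has_derivative_transform_within[OF G d(1) p])
    fix q assume q: "q \<in> frontier \<Omega>" "dist q p < d"
    then have qq: "q \<in> U" "0 < \<sigma> * (e q \<bullet> (q - c))" using d(2) by (auto simp: dist_commute)
    then have "sgn (e q \<bullet> (q - c)) = \<sigma>" using nz[OF p U(2)] by (auto simp: \<sigma>_def sgn_if zero_less_mult_iff split: if_splits)
    then show "\<sigma> *\<^sub>R (inverse (norm (e q)) *\<^sub>R e q) = gm q" using form[OF q(1) qq(1)] by simp
  qed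
  then show ?thesis by (auto simp: differentiable_def)
qed

definition Dgm where "Dgm p = frechet_derivative gm (at p within frontier \<Omega>)"

lemma Dgm: "p \<in> frontier \<Omega> \<Longrightarrow> (gm has_derivative Dgm p) (at p within frontier \<Omega>)"
  unfolding Dgm_def using gauss_map_differentiable frechet_derivative_works by blast

lemma linear_Dgm: "p \<in> frontier \<Omega> \<Longrightarrow> linear (Dgm p)"
  using Dgm has_derivative_linear by blast

lemma gauss_curvature_eq:
  "gauss_curvature \<Omega> p = det (matrix (\<lambda>v. Dgm p (v - (v \<bullet> gm p) *\<^sub>R gm p) + (v \<bullet> gm p) *\<^sub>R gm p))"
  by (simp add: gauss_curvature_def Dgm_def Let_def)

lemma frontierI_unit_normal: "p \<in> \<Omega> \<Longrightarrow> unit_normal \<Omega> p \<nu> \<Longrightarrow> p \<in> frontier \<Omega>"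
  using unit_normal_interior[of \<Omega> p \<nu> p] closure_subset by (auto simp: frontier_def)

lemma gauss_map_surj:
  assumes "norm x = 1" obtains p where "p \<in> frontier \<Omega>" "gm p = x" "\<And>z. z \<in> \<Omega> \<Longrightarrow> x \<bullet> z \<le> x \<bullet> p"
proof -
  have "\<Omega> \<noteq> {}" using body' by auto
  moreover have "continuous_on \<Omega> (\<lambda>z. x \<bullet> z)" by (intro continuous_intros)
  ultimately obtain p where p: "p \<in> \<Omega>" "\<forall>z\<in>\<Omega>. x \<bullet> z \<le> x \<bullet> p"
    using continuous_attains_sup[OF body'(1), of "\<lambda>z. x \<bullet> z"] by blast
  then have un: "unit_normal \<Omega> p x" using assms by (auto simp: unit_normal_def inner_diff_right)
  then have "p \<in> frontier \<Omega>" using frontierI_unit_normal p(1) by blast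
  then show thesis using that gauss_map_eqI un p(2) by blast
qed

text \<open>Two boundary points with a common normal span a segment in the boundary along which the
  Gauss map is constant. Its differential then annihilates the tangent vector \<open>q - p\<close>,
  so the curvature at \<open>p\<close> would vanish.\<close>

lemma gauss_map_inj:
  assumes pos: "\<forall>p\<in>frontier \<Omega>. gauss_curvature \<Omega> p > 0" shows "inj_on gm (frontier \<Omega>)"
proof (rule inj_onI, rule ccontr)
  fix p q assume p: "p \<in> frontier \<Omega>" and q: "q \<in> frontier \<Omega>" and eq: "gm p = gm q" and "p \<noteq> q"
  define \<nu> where "\<nu> = gm p"
  have un: "unit_normal \<Omega> p \<nu>" "unit_normal \<Omega> q \<nu>"
    using unit_normal_gauss_map[OF p] unit_normal_gauss_map[OF q] eq by (simp_all add: \<nu>_def)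
  have orth: "\<nu> \<bullet> (q - p) = 0"
    using un frontier_mem[OF p] frontier_mem[OF q] by (fastforce simp: unit_normal_def inner_diff_right)
  define \<gamma> where "\<gamma> t = p + t *\<^sub>R (q - p)" for t :: real
  have \<gamma>: "\<gamma> t \<in> frontier \<Omega> \<and> gm (\<gamma> t) = \<nu>" if t: "t \<in> {0..1}" for t
  proof -
    have "\<gamma> t = (1 - t) *\<^sub>R p + t *\<^sub>R q" by (simp add: \<gamma>_def algebra_simps)
    then have mem: "\<gamma> t \<in> \<Omega>" using convexD_alt[OF body'(2) frontier_mem[OF p] frontier_mem[OF q], of t] t by simp
    have "\<nu> \<bullet> (z - \<gamma> t) = \<nu> \<bullet> (z - p)" for z using orth by (simp add: \<gamma>_def inner_diff_right inner_add_right)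
    then have "unit_normal \<Omega> (\<gamma> t) \<nu>" using un(1) by (simp add: unit_normal_def)
    then show ?thesis using frontierI_unit_normal[OF mem] gauss_map_eqI by blast
  qed
  have d\<gamma>: "(\<gamma> has_derivative (\<lambda>t. t *\<^sub>R (q - p))) (at 0 within {0..1})"
    unfolding \<gamma>_def by (auto intro!: derivative_eq_intros)
  have "\<gamma> 0 = p" by (simp add: \<gamma>_def)
  have "((\<lambda>t. gm (\<gamma> t)) has_derivative (\<lambda>t. Dgm p (t *\<^sub>R (q - p)))) (at 0 within {0..1})"
    by (rule has_derivative_in_compose2[OF _ _ _ d\<gamma>, of "frontier \<Omega>" gm "Dgm", unfolded \<open>\<gamma> 0 = p\<close>])
       (use \<gamma> Dgm in auto)
  then have 1: "((\<lambda>t. gm (\<gamma> t)) has_vector_derivative Dgm p (q - p)) (at 0 within {0..1})"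
    using linear_cmul[OF linear_Dgm[OF p]] by (simp add: has_vector_derivative_def)
  have "((\<lambda>t. gm (\<gamma> t)) has_vector_derivative 0) (at 0 within {0..1})"
    by (rule has_vector_derivative_transform_within[OF has_vector_derivative_const[of \<nu>], of 1]) (use \<gamma> in auto)
  then have D0: "Dgm p (q - p) = 0"
    using vector_derivative_unique_within[OF _ 1] by (simp add: trivial_limit_within islimpt_Icc)
  define L where "L v = Dgm p (v - (v \<bullet> \<nu>) *\<^sub>R \<nu>) + (v \<bullet> \<nu>) *\<^sub>R \<nu>" for v
  have lin: "linear L" unfolding L_def
    by (rule linearI) (simp_all add: linear_diff[OF linear_Dgm[OF p]] linear_add[OF linear_Dgm[OF p]] linear_cmul[OF linear_Dgm[OF p]] algebra_simps)
  have "L (q - p) = 0" using D0 orth by (simp add: L_def inner_commute)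
  moreover have "L 0 = 0" using linear_0[OF lin] .
  ultimately have "\<not> inj L" using \<open>p \<noteq> q\<close> by (metis injD right_minus_eq)
  then have "det (matrix L) = 0" using det_nz_iff_inj[OF lin] by blast
  moreover have "gauss_curvature \<Omega> p = det (matrix L)" by (simp add: gauss_curvature_eq L_def[abs_def] \<nu>_def)
  ultimately show False using pos p by auto
qed

end

section \<open>Change of variables over arbitrary finite index types\<close>

text \<open>The library's change-of-variables theorems require a wellordered index type; the copy supplies an
  arbitrary wellorder.\<close>

typedef 'a ordered_copy = "UNIV :: 'a set" morphisms un_copy mk_copy by simp

lemma bij_un_copy: "bij un_copy"
  by (metis UNIV_I bijI' mk_copy_inverse un_copy_inject)

instance ordered_copy :: (finite) finite
proof
  show "finite (UNIV :: 'a ordered_copy set)"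
    by (rule finite_imageD[of un_copy, OF finite bij_is_inj[OF bij_un_copy]])
qed

definition copy_rank :: "'a::finite ordered_copy \<Rightarrow> nat" where
  "copy_rank = (SOME r. inj r)"

lemma inj_copy_rank: "inj copy_rank"
proof -
  have "\<exists>r :: 'a ordered_copy \<Rightarrow> nat. inj r" using finite_imp_inj_to_nat_seg[OF finite] by blast
  then show ?thesis unfolding copy_rank_def by (rule someI_ex)
qed

instantiation ordered_copy :: (finite) wellorder
begin

definition less_eq_ordered_copy :: "'a ordered_copy \<Rightarrow> 'a ordered_copy \<Rightarrow> bool" where
  "less_eq_ordered_copy x y \<longleftrightarrow> copy_rank x \<le> copy_rank y"

definition less_ordered_copy :: "'a ordered_copy \<Rightarrow> 'a ordered_copy \<Rightarrow> bool" where
  "less_ordered_copy x y \<longleftrightarrow> copy_rank x < copy_rank y"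

instance
proof
  fix x y z :: "'a ordered_copy"
  show "x < y \<longleftrightarrow> x \<le> y \<and> \<not> y \<le> x" by (auto simp: less_eq_ordered_copy_def less_ordered_copy_def)
  show "x \<le> x" by (simp add: less_eq_ordered_copy_def)
  show "x \<le> y \<Longrightarrow> y \<le> z \<Longrightarrow> x \<le> z" by (simp add: less_eq_ordered_copy_def)
  show "x \<le> y \<Longrightarrow> y \<le> x \<Longrightarrow> x = y" unfolding less_eq_ordered_copy_def by (rule injD[OF inj_copy_rank]) (rule antisym)
  show "x \<le> y \<or> y \<le> x" by (auto simp: less_eq_ordered_copy_def)
next
  fix P :: "'a ordered_copy \<Rightarrow> bool" and a
  assume step: "\<And>x. (\<And>y. y < x \<Longrightarrow> P y) \<Longrightarrow> P x"
  show "P a"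
  proof (induction a rule: measure_induct_rule[of copy_rank])
    case (less x)
    show ?case
    proof (rule step)
      fix y assume "y < x"
      then show "P y" unfolding less_ordered_copy_def by (rule less.IH)
    qed
  qed
qed

end

definition to_copy :: "real ^ 'n \<Rightarrow> real ^ 'n ordered_copy" where
  "to_copy x = (\<chi> i. x $ un_copy i)"

definition of_copy :: "real ^ 'n ordered_copy \<Rightarrow> real ^ 'n" where
  "of_copy y = (\<chi> i. y $ mk_copy i)"

lemma to_copy_of_copy [simp]: "to_copy (of_copy y) = y" "of_copy (to_copy x) = x"
  by (simp_all add: to_copy_def of_copy_def un_copy_inverse mk_copy_inverse)

lemma linear_copy: "linear to_copy" "linear of_copy"
  by (auto intro!: linearI simp: to_copy_def of_copy_def vec_eq_iff)

lemma bounded_linear_copy: "bounded_linear to_copy" "bounded_linear of_copy"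
  by (simp_all add: linear_copy flip: linear_conv_bounded_linear)

lemma borel_measurable_copy [measurable]: "to_copy \<in> borel \<rightarrow>\<^sub>M borel" "of_copy \<in> borel \<rightarrow>\<^sub>M borel"
  by (rule borel_measurable_continuous_onI[OF linear_continuous_on[OF bounded_linear_copy(1)]],
      rule borel_measurable_continuous_onI[OF linear_continuous_on[OF bounded_linear_copy(2)]])

lemma prod_Basis_vec: "(\<Prod>b\<in>Basis. f ((x :: real ^ 'n) \<bullet> b)) = (\<Prod>i\<in>UNIV. f (x $ i))"
proof -
  have B: "(Basis :: (real ^ 'n) set) = range (\<lambda>i. axis i 1)" by (auto simp: Basis_vec_def)
  have inj: "inj (\<lambda>i. axis i (1::real) :: real ^ 'n)" by (auto simp: inj_def axis_eq_axis)
  show ?thesis unfolding B prod.reindex[OF inj] by (simp add: inner_axis)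
qed

lemma lborel_distr_of_copy: "distr lborel borel of_copy = (lborel :: (real ^ 'n) measure)"
proof (rule lborel_eqI[symmetric])
  fix l u :: "real ^ 'n" assume le: "\<And>b. b \<in> Basis \<Longrightarrow> l \<bullet> b \<le> u \<bullet> b"
  have le': "l $ i \<le> u $ i" for i using le[of "axis i 1"] by (simp add: inner_axis)
  have box: "of_copy -` box l u = box (to_copy l) (to_copy u)"
    by (auto simp: mem_box_cart of_copy_def to_copy_def) (metis un_copy_inverse mk_copy_inverse UNIV_I)+
  have le2: "to_copy l \<bullet> b \<le> to_copy u \<bullet> b" if "b \<in> Basis" for b
    using that le' by (auto simp: Basis_vec_def inner_axis to_copy_def)
  have "emeasure (distr lborel borel of_copy) (box l u) = emeasure lborel (box (to_copy l) (to_copy u))"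
    by (simp add: emeasure_distr box)
  also have "\<dots> = ennreal (\<Prod>b\<in>Basis. (to_copy u - to_copy l) \<bullet> b)"
    using le2 by (rule emeasure_lborel_box)
  also have "(\<Prod>b\<in>Basis. (to_copy u - to_copy l) \<bullet> b) = (\<Prod>i\<in>UNIV. (u - l) $ un_copy i)"
    by (subst prod_Basis_vec[of "\<lambda>x. x"]) (simp add: to_copy_def)
  also have "\<dots> = (\<Prod>i\<in>UNIV. (u - l) $ i)"
    by (rule prod.reindex_bij_betw[OF bij_un_copy])
  also have "\<dots> = (\<Prod>b\<in>Basis. (u - l) \<bullet> b)" by (rule prod_Basis_vec[of "\<lambda>x. x", symmetric])
  finally show "emeasure (distr lborel borel of_copy) (box l u) = ennreal (\<Prod>b\<in>Basis. (u - l) \<bullet> b)" .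
qed simp

lemma to_copy_image: "to_copy ` A = of_copy -` A"
proof (intro set_eqI iffI)
  fix y assume "y \<in> of_copy -` A"
  then have "to_copy (of_copy y) \<in> to_copy ` A" by blast
  then show "y \<in> to_copy ` A" by simp
qed auto

lemma emeasure_to_copy:
  assumes [measurable]: "A \<in> sets borel"
  shows "to_copy ` A \<in> sets borel" "emeasure lborel (to_copy ` A) = emeasure lborel (A :: (real ^ 'n) set)"
proof -
  show "to_copy ` A \<in> sets borel" unfolding to_copy_image using measurable_sets[OF borel_measurable_copy(2) assms] by simp
  have "emeasure lborel A = emeasure (distr lborel borel of_copy) A" by (simp add: lborel_distr_of_copy)
  also have "\<dots> = emeasure lborel (to_copy ` A)" by (simp add: emeasure_distr to_copy_image)
  finally show "emeasure lborel (to_copy ` A) = emeasure lborel A" ..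
qed

text \<open>Reindex the Leibniz formula: conjugating permutations by the bijection
  \<open>un_copy\<close> preserves their signs.\<close>

lemma det_copy: "det (matrix (\<lambda>y. to_copy (f (of_copy y)))) = det (matrix (f :: real ^ 'n \<Rightarrow> real ^ 'n))"
proof -
  define A where "A = matrix f"
  have ax: "of_copy (axis b 1) = axis (un_copy b) 1" for b :: "'n ordered_copy"
    by (auto simp: of_copy_def vec_eq_iff axis_def mk_copy_inverse) (metis un_copy_inverse mk_copy_inverse UNIV_I)+
  have A': "matrix (\<lambda>y. to_copy (f (of_copy y))) $ a $ b = A $ un_copy a $ un_copy b" for a b
    by (simp add: matrix_def A_def ax to_copy_def)
  let ?q = "\<lambda>p x. un_copy (p (inv un_copy x))"
  have bij: "bij_betw ?q {p. p permutes UNIV} {q. q permutes (UNIV :: 'n set)}"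
    using bij_betw_permutations[OF bij_un_copy] by simp
  have sgn: "sign (?q p) = sign p" if "p permutes UNIV" for p :: "'n ordered_copy \<Rightarrow> _"
  proof -
    have "map_permutation UNIV un_copy p = ?q p"
      using bij_un_copy by (auto simp: map_permutation_def restrict_id_def bij_def fun_eq_iff)
    with sign_map_permutation[OF bij_is_inj[OF bij_un_copy] that finite] show ?thesis by simp
  qed
  have "det A = (\<Sum>q | q permutes UNIV. of_int (sign q) * (\<Prod>i\<in>UNIV. A $ i $ q i))" by (rule det_def)
  also have "\<dots> = (\<Sum>p | p permutes UNIV. of_int (sign (?q p)) * (\<Prod>i\<in>UNIV. A $ i $ ?q p i))"
    by (rule sum.reindex_bij_betw[OF bij, symmetric])
  also have "\<dots> = (\<Sum>p | p permutes UNIV. of_int (sign p) * (\<Prod>i\<in>UNIV. A $ un_copy i $ un_copy (p i)))"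
  proof (rule sum.cong[OF refl])
    fix p :: "'n ordered_copy \<Rightarrow> 'n ordered_copy" assume "p \<in> {p. p permutes UNIV}"
    have "(\<Prod>i\<in>UNIV. A $ i $ ?q p i) = (\<Prod>i\<in>UNIV. A $ un_copy i $ ?q p (un_copy i))"
      by (rule prod.reindex_bij_betw[OF bij_un_copy, symmetric])
    then show "of_int (sign (?q p)) * (\<Prod>i\<in>UNIV. A $ i $ ?q p i) = of_int (sign p) * (\<Prod>i\<in>UNIV. A $ un_copy i $ un_copy (p i))"
      using sgn \<open>p \<in> _\<close> by (simp add: inv_f_f[OF bij_is_inj[OF bij_un_copy]])
  qed
  also have "\<dots> = det (matrix (\<lambda>y. to_copy (f (of_copy y))))" by (simp add: det_def A')
  finally show ?thesis by (simp add: A_def)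
qed

text \<open>Conjugation with \<open>to_copy\<close> preserves volumes, differentiability and the
  determinant, so the statement is moved to the ordered index type. Finite measure of
  \<open>T\<close> makes the constant Jacobian 1 integrable.\<close>

lemma emeasure_image_abs_det_1:
  fixes f :: "real ^ 'n \<Rightarrow> real ^ 'n"
  assumes T: "T \<in> sets borel" "emeasure lborel T \<noteq> \<infinity>" and fT: "f ` T \<in> sets borel"
    and der: "\<And>x. x \<in> T \<Longrightarrow> (f has_derivative f' x) (at x within T)" and inj: "inj_on f T"
    and det: "\<And>x. x \<in> T \<Longrightarrow> \<bar>det (matrix (f' x))\<bar> = 1"
  shows "emeasure lborel (f ` T) = emeasure lborel T"
proof -
  define T' where "T' = to_copy ` T"
  define F where "F = (\<lambda>y. to_copy (f (of_copy y)))"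
  define F' where "F' = (\<lambda>y v. to_copy (f' (of_copy y) (of_copy v)))"
  note T'm = emeasure_to_copy[OF T(1), folded T'_def]
  have mem: "of_copy y \<in> T" if "y \<in> T'" for y using that by (auto simp: T'_def)
  have ofT: "of_copy ` T' = T" by (simp add: T'_def image_image)
  have FT': "F ` T' = to_copy ` f ` T" by (simp add: F_def T'_def image_image)
  have der': "(F has_derivative F' y) (at y within T')" if "y \<in> T'" for y
  proof -
    have "(of_copy has_derivative of_copy) (at y within T')"
      by (rule bounded_linear_imp_has_derivative[OF bounded_linear_copy(2)])
    moreover have "(f has_derivative f' (of_copy y)) (at (of_copy y) within of_copy ` T')"
      unfolding ofT by (rule der[OF mem[OF that]])
    ultimately have "((\<lambda>y. f (of_copy y)) has_derivative (\<lambda>v. f' (of_copy y) (of_copy v))) (at y within T')"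
      by (rule has_derivative_in_compose)
    then show ?thesis unfolding F_def F'_def
      by (rule bounded_linear.has_derivative[OF bounded_linear_copy(1)])
  qed
  have inj': "inj_on F T'"
    using inj mem by (auto simp: inj_on_def F_def) (metis to_copy_of_copy)
  have det': "\<bar>det (matrix (F' y))\<bar> = 1" if "y \<in> T'" for y
    using det[OF mem[OF that]] unfolding F'_def det_copy .
  have T'L: "T' \<in> lmeasurable"
    using T'm T(2) by (simp add: fmeasurable_def less_top)
  then have "(\<lambda>_. 1::real) integrable_on T'" by (simp add: lmeasurable_iff_integrable_on)
  then have intD: "(\<lambda>y. \<bar>det (matrix (F' y))\<bar>) integrable_on T'"
    using det' by (subst integrable_cong) auto
  have T's: "T' \<in> sets lebesgue" using T'm(1) by simp
  have FL: "F ` T' \<in> lmeasurable"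
    using measurable_differentiable_image_eq[OF T's der' inj'] intD by blast
  have "measure lebesgue (F ` T') = integral T' (\<lambda>y. \<bar>det (matrix (F' y))\<bar>)"
    by (rule measure_differentiable_image_eq[OF T's der' inj' intD])
  also have "\<dots> = integral T' (\<lambda>_. 1)" using det' by (intro Henstock_Kurzweil_Integration.integral_cong) auto
  also have "\<dots> = measure lebesgue T'" using lmeasure_integral[OF T'L] by simp
  finally have "emeasure lebesgue (F ` T') = emeasure lebesgue T'"
    using FL T'L by (simp add: emeasure_eq_measure2)
  then have "emeasure lborel (F ` T') = emeasure lborel T'"
    using emeasure_to_copy(1)[OF fT] T'm(1) by (simp add: FT')
  then show ?thesis using T'm(2) emeasure_to_copy(2)[OF fT] by (simp add: FT')
qed

text \<open>Rotate \<open>b\<close> to a multiple of an arbitrary coordinate axis \<open>k\<close>.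
  The rotated map differs from the identity matrix in column \<open>k\<close> only, and Cramer's
  lemma reads off the determinant.\<close>

lemma det_rank_one_update:
  fixes a b :: "real ^ 'n"
  shows "det (matrix (\<lambda>v. v + (v \<bullet> b) *\<^sub>R a)) = 1 + a \<bullet> b"
proof (cases "b = 0")
  case True
  then show ?thesis by (simp add: matrix_id_mat_1 flip: id_def)
next
  case False
  define L where "L = (\<lambda>v. v + (v \<bullet> b) *\<^sub>R a)"
  define k :: 'n where "k = undefined"
  define b0 where "b0 = b /\<^sub>R norm b"
  have b: "b = norm b *\<^sub>R b0" using False by (simp add: b0_def)
  have n: "norm (axis k 1 :: real ^ 'n) = 1" "norm b0 = 1" using False by (simp_all add: b0_def norm_axis_1)
  obtain Q :: "real ^ 'n \<Rightarrow> real ^ 'n" where Q: "orthogonal_transformation Q" "Q (axis k 1) = b0"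
    using orthogonal_transformation_exists_1[OF n] .
  obtain a' where a': "Q a' = a" using orthogonal_transformation_surj[OF Q(1)] by (metis surjD)
  have linQ: "linear Q" using Q(1) by (simp add: orthogonal_transformation_def)
  have inner: "Q v \<bullet> Q w = v \<bullet> w" for v w using Q(1) by (simp add: orthogonal_transformation_def)
  have coord: "Q w \<bullet> b = norm b * (w $ k)" for w
    using inner[of w "axis k 1"] Q(2) by (subst b) (simp add: inner_axis)
  define L' where "L' = (\<lambda>w. w + (norm b * (w $ k)) *\<^sub>R a')"
  have comp: "L \<circ> Q = Q \<circ> L'"
    by (simp add: fun_eq_iff L_def L'_def coord a' linear_add[OF linQ] linear_cmul[OF linQ])
  have lin: "linear L" "linear L'"
    by (auto intro!: linearI simp: L_def L'_def inner_add_left algebra_simps)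
  have "det (matrix L) * det (matrix Q) = det (matrix Q) * det (matrix L')"
    using comp matrix_compose[OF linQ lin(1)] matrix_compose[OF lin(2) linQ] by (metis det_mul)
  moreover have "det (matrix Q) \<noteq> 0"
    using det_nz_iff_inj[OF linQ] orthogonal_transformation_inj[OF Q(1)] by blast
  ultimately have "det (matrix L) = det (matrix L')" by simp
  also have "matrix L' = (\<chi> i j. if j = k then (mat 1 *v (axis k 1 + norm b *\<^sub>R a')) $ i else mat 1 $ i $ j)"
    unfolding matrix_vector_mul_lid by (auto simp: matrix_def L'_def vec_eq_iff mat_def axis_def)
  also have "det \<dots> = (axis k 1 + norm b *\<^sub>R a') $ k * det (mat 1 :: real ^ 'n ^ 'n)" by (rule cramer_lemma)
  also have "\<dots> = 1 + norm b * a' $ k" by (simp add: axis_def)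
  also have "norm b * a' $ k = a \<bullet> b" using coord[of a'] a' by simp
  finally show ?thesis by (simp add: L_def)
qed

section \<open>The volume-preserving map of a soliton\<close>

locale soliton_body = smooth_body \<Omega> for \<Omega> :: "(real ^ 'n) set" +
  assumes curvature_pos: "\<forall>p\<in>frontier \<Omega>. gauss_curvature \<Omega> p > 0"
    and soliton: "\<forall>x\<in>sphere 0 1. support_fun \<Omega> 0 x = gauss_curvature_on_sphere \<Omega> x"
begin

lemma support_gauss_map:
  assumes p: "p \<in> frontier \<Omega>"
  shows "support_fun \<Omega> 0 (gm p) = gauss_curvature \<Omega> p" "support_fun \<Omega> 0 (gm p) = gm p \<bullet> p"
proof -
  have "the_inv_into (frontier \<Omega>) gm (gm p) = p"
    by (rule the_inv_into_f_f[OF gauss_map_inj[OF curvature_pos] p])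
  then have "gauss_curvature_on_sphere \<Omega> (gm p) = gauss_curvature \<Omega> p"
    by (simp add: gauss_curvature_on_sphere_def)
  moreover have "gm p \<in> sphere 0 1" using norm_gauss_map[OF p] by simp
  ultimately show "support_fun \<Omega> 0 (gm p) = gauss_curvature \<Omega> p" using soliton by metis
  have "\<Omega> \<noteq> {}" using body' by auto
  then show "support_fun \<Omega> 0 (gm p) = gm p \<bullet> p"
    using unit_normal_gauss_map[OF p] support_fun_upper[OF body'(1) frontier_mem[OF p], of "gm p" 0]
    by (intro antisym support_fun_least) (auto simp: unit_normal_def inner_diff_right)
qed

lemma support_pos_sphere: assumes "norm x = 1" shows "0 < support_fun \<Omega> 0 x"
proof -
  obtain p where "p \<in> frontier \<Omega>" "gm p = x" using gauss_map_surj[OF assms] by blast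
  then show ?thesis using support_gauss_map(1) curvature_pos by metis
qed

text \<open>By the soliton equation the support function equals the positive curvature in every
  direction, whereas the normal of a hyperplane separating the origin from the interior would have a
  nonpositive support value.\<close>

lemma zero_interior_body: "0 \<in> interior \<Omega>"
proof (rule ccontr)
  assume "0 \<notin> interior \<Omega>"
  then obtain a b where ab: "a \<noteq> 0" "\<forall>x\<in>interior \<Omega>. a \<bullet> x \<le> b" "\<forall>x\<in>{0}. b \<le> a \<bullet> x"
    using separating_hyperplane_sets[of "interior \<Omega>" "{0}"] body' convex_interior[OF body'(2)] by auto
  have "\<Omega> \<subseteq> closure (interior \<Omega>)" using convex_closure_interior[OF body'(2,3)] closure_subset by blast
  moreover have "closure (interior \<Omega>) \<subseteq> {x. a \<bullet> x \<le> b}"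
    using ab(2) by (intro closure_minimal closed_halfspace_le) auto
  ultimately have le: "a \<bullet> z \<le> 0" if "z \<in> \<Omega>" for z using ab(3) that by fastforce
  have "\<Omega> \<noteq> {}" using body' by auto
  then have "support_fun \<Omega> 0 (a /\<^sub>R norm a) \<le> 0"
    using le by (intro support_fun_least) (auto intro!: mult_nonneg_nonpos)
  moreover have "0 < support_fun \<Omega> 0 (a /\<^sub>R norm a)" using ab(1) by (intro support_pos_sphere) simp
  ultimately show False by simp
qed

end

sublocale soliton_body \<subseteq> centered_body \<Omega>
  by standard (use body' zero_interior_body in auto)

context soliton_body
begin

text \<open>For \<open>x \<noteq> 0\<close>, \<open>bd x\<close> is the radial projection of \<open>x\<close> to the boundary, \<open>nrm x\<close> the outward
  unit normal there and \<open>grd x\<close> turns out to be the gradient of the gauge at \<open>x\<close>.\<close>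

definition bd where "bd x = inverse (g x) *\<^sub>R x"
definition nrm where "nrm x = gm (bd x)"
definition grd where "grd x = inverse (h (nrm x)) *\<^sub>R nrm x"
definition \<Phi> where "\<Phi> x = g x *\<^sub>R nrm x"

section \<open>The gradient of the gauge and the Jacobian of \<open>\<Phi>\<close>\<close>

lemma bd_frontier: "x \<noteq> 0 \<Longrightarrow> bd x \<in> frontier \<Omega>"
  using g_pos[of x] by (simp add: frontier_iff bd_def g_scale)

lemma g_bd: "x \<noteq> 0 \<Longrightarrow> g x *\<^sub>R bd x = x"
  using g_pos[of x] by (simp add: bd_def)

lemma norm_nrm: "x \<noteq> 0 \<Longrightarrow> norm (nrm x) = 1"
  unfolding nrm_def by (rule norm_gauss_map[OF bd_frontier])

lemma h_nrm: "x \<noteq> 0 \<Longrightarrow> h (nrm x) = nrm x \<bullet> bd x"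
  unfolding nrm_def by (rule support_gauss_map(2)[OF bd_frontier])

lemma h_nrm_pos: assumes "x \<noteq> 0" shows "0 < h (nrm x)"
  using norm_nrm[OF assms] by (intro h_pos) auto

lemma nrm_eq: "x \<noteq> 0 \<Longrightarrow> nrm x = h (nrm x) *\<^sub>R grd x"
  using h_nrm_pos[of x] by (simp add: grd_def)

lemma grd_inner_bd: "x \<noteq> 0 \<Longrightarrow> grd x \<bullet> bd x = 1"
  using h_nrm_pos[of x] h_nrm[of x] by (simp add: grd_def)

lemma g_eq_grd: assumes "x \<noteq> 0" shows "g x = grd x \<bullet> x"
proof -
  have "grd x \<bullet> x = g x * (grd x \<bullet> bd x)" using g_bd[OF assms] by (metis inner_scaleR_right)
  then show ?thesis using grd_inner_bd[OF assms] by simp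
qed

text \<open>Together with \<open>g_eq_grd\<close> this says that \<open>grd x\<close> is a
  subgradient of the gauge at \<open>x\<close>.\<close>

lemma g_ge_grd: assumes "x \<noteq> 0" shows "grd x \<bullet> y \<le> g y"
  using inner_le_g_h[of y "nrm x"] h_nrm_pos[OF assms]
  by (simp add: grd_def inner_commute field_simps)

lemma gm_cont: "continuous_on (frontier \<Omega>) gm"
  using gauss_map_differentiable differentiable_imp_continuous_within continuous_on_eq_continuous_within by blast

lemma bd_cont: "continuous_on (-{0}) bd"
  unfolding bd_def using g_pos by (intro continuous_intros g_cont) force

lemma nrm_cont: "continuous_on (-{0}) nrm"
  unfolding nrm_def by (rule continuous_on_compose2[OF gm_cont bd_cont]) (auto intro: bd_frontier)

lemma h_nrm_cont: "continuous_on (-{0}) (\<lambda>x. h (nrm x))"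
  by (rule continuous_on_compose2[OF h_cont[of UNIV] nrm_cont]) auto

lemma grd_cont: "continuous_on (-{0}) grd"
  unfolding grd_def by (intro continuous_intros h_nrm_cont nrm_cont ballI) (use h_nrm_pos in force)

text \<open>A convex function with a continuous choice of subgradients is differentiable: the
  subgradient inequalities at \<open>x\<close> and at \<open>y\<close> enclose the remainder between
  0 and the pairing of \<open>grd y - grd x\<close> with \<open>y - x\<close>.\<close>

lemma g_has_derivative: assumes x: "x \<noteq> 0" shows "(g has_derivative (\<lambda>v. grd x \<bullet> v)) (at x)"
  unfolding has_derivative_at_alt
proof (intro conjI allI impI)
  show "bounded_linear (\<lambda>v. grd x \<bullet> v)" by (rule bounded_linear_inner_right)
  fix e :: real assume e: "0 < e"
  have "isCont grd x" using grd_cont x by (simp add: continuous_on_eq_continuous_at open_Compl)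
  then obtain d where d: "0 < d" "\<And>y. dist y x < d \<Longrightarrow> dist (grd y) (grd x) < e"
    using e unfolding continuous_at_eps_delta by (metis dist_commute)
  show "\<exists>d>0. \<forall>y. norm (y - x) < d \<longrightarrow> norm (g y - g x - grd x \<bullet> (y - x)) \<le> e * norm (y - x)"
  proof (intro exI[of _ "min d (norm x)"] conjI allI impI)
    show "0 < min d (norm x)" using d(1) x by simp
    fix y assume y: "norm (y - x) < min d (norm x)"
    then have y0: "y \<noteq> 0" by auto
    have lo: "0 \<le> g y - g x - grd x \<bullet> (y - x)"
      using g_ge_grd[OF x, of y] g_eq_grd[OF x] by (simp add: inner_diff_right)
    have "g y - g x - grd x \<bullet> (y - x) \<le> (grd y - grd x) \<bullet> (y - x)"
      using g_ge_grd[OF y0, of x] g_eq_grd[OF y0] by (simp add: inner_diff_right inner_diff_left)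
    also have "\<dots> \<le> norm (grd y - grd x) * norm (y - x)" by (rule norm_cauchy_schwarz)
    also have "\<dots> \<le> e * norm (y - x)"
      using d(2)[of y] y by (intro mult_right_mono) (auto simp: dist_norm)
    finally show "norm (g y - g x - grd x \<bullet> (y - x)) \<le> e * norm (y - x)" using lo by simp
  qed
qed

text \<open>The vector \<open>v - (v \<bullet> grd x) *\<^sub>R bd x\<close> is the projection of
  \<open>v\<close> to the tangent space along the ray through \<open>x\<close>. This part is mapped
  by the differential of the Gauss map, and the radial part is sent to the normal.\<close>

lemma \<Phi>_has_derivative:
  assumes x: "x \<noteq> 0"
  shows "(\<Phi> has_derivative (\<lambda>v. Dgm (bd x) (v - (v \<bullet> grd x) *\<^sub>R bd x) + (v \<bullet> grd x) *\<^sub>R nrm x)) (at x)"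
proof -
  have gx: "g x \<noteq> 0" using g_pos[OF x] by simp
  have lin: "linear (Dgm (bd x))" by (rule linear_Dgm[OF bd_frontier[OF x]])
  define b' where "b' v = inverse (g x) *\<^sub>R v - (inverse (g x) * (grd x \<bullet> v) * inverse (g x)) *\<^sub>R x" for v
  have "((\<lambda>y. inverse (g y)) has_derivative (\<lambda>v. - (inverse (g x) * (grd x \<bullet> v) * inverse (g x)))) (at x)"
    by (rule Deriv.has_derivative_inverse[OF gx g_has_derivative[OF x]])
  from has_derivative_scaleR[OF this has_derivative_ident] have "(bd has_derivative b') (at x)"
    by (simp add: bd_def[abs_def] b'_def[abs_def])
  then have "(bd has_derivative b') (at x within -{0})" by (rule has_derivative_at_withinI)
  then have "((\<lambda>y. gm (bd y)) has_derivative (\<lambda>v. Dgm (bd x) (b' v))) (at x within -{0})"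
    by (rule has_derivative_in_compose2[of "frontier \<Omega>" gm Dgm bd "-{0}" x b', rotated -1]) (use x bd_frontier Dgm in auto)
  then have "(nrm has_derivative (\<lambda>v. Dgm (bd x) (b' v))) (at x)"
    using x by (simp add: nrm_def[abs_def] at_within_open[of x "-{0}"] open_Compl)
  then have "(\<Phi> has_derivative (\<lambda>v. g x *\<^sub>R Dgm (bd x) (b' v) + (grd x \<bullet> v) *\<^sub>R nrm x)) (at x)"
    unfolding \<Phi>_def[abs_def] using g_has_derivative[OF x] by (auto intro!: derivative_eq_intros)
  moreover have "g x *\<^sub>R Dgm (bd x) (b' v) = Dgm (bd x) (v - (v \<bullet> grd x) *\<^sub>R bd x)" for v
  proof -
    have "g x *\<^sub>R b' v = v - (v \<bullet> grd x) *\<^sub>R bd x"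
      using gx by (simp add: b'_def bd_def scaleR_diff_right inner_commute)
    then show ?thesis by (simp only: linear_cmul[OF lin, symmetric])
  qed
  ultimately show ?thesis by (simp add: inner_commute)
qed

text \<open>The map \<open>L\<close> fixes the tangent space and sends \<open>bd x\<close> to
  \<open>nrm x\<close>, so it exchanges the oblique projection along the ray for the orthogonal one.
  As a rank-one update it has determinant 1 / h. What remains is \<open>M\<close>, whose determinant
  is the Gauss curvature, equal to h for a soliton.\<close>

lemma det_\<Phi>:
  assumes x: "x \<noteq> 0"
  shows "det (matrix (\<lambda>v. Dgm (bd x) (v - (v \<bullet> grd x) *\<^sub>R bd x) + (v \<bullet> grd x) *\<^sub>R nrm x)) = 1"
proof -
  have lin: "linear (Dgm (bd x))" by (rule linear_Dgm[OF bd_frontier[OF x]])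
  define M where "M w = Dgm (bd x) (w - (w \<bullet> nrm x) *\<^sub>R nrm x) + (w \<bullet> nrm x) *\<^sub>R nrm x" for w
  define L where "L v = v + (v \<bullet> grd x) *\<^sub>R (nrm x - bd x)" for v
  have hn: "h (nrm x) \<noteq> 0" using h_nrm_pos[OF x] by simp
  have nn: "nrm x \<bullet> nrm x = 1" using norm_nrm[OF x] by (simp add: dot_square_norm)
  have vn: "v \<bullet> nrm x = h (nrm x) * (v \<bullet> grd x)" for v using hn by (simp add: grd_def)
  have Ln: "L v \<bullet> nrm x = v \<bullet> grd x" for v
    using h_nrm[OF x] by (simp add: L_def inner_add_left inner_diff_left nn vn[of v] inner_commute[of "bd x"] algebra_simps)
  have "M (L v) = Dgm (bd x) (v - (v \<bullet> grd x) *\<^sub>R bd x) + (v \<bullet> grd x) *\<^sub>R nrm x" for v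
    unfolding M_def Ln by (simp add: L_def algebra_simps)
  then have eq: "(\<lambda>v. Dgm (bd x) (v - (v \<bullet> grd x) *\<^sub>R bd x) + (v \<bullet> grd x) *\<^sub>R nrm x) = M \<circ> L" by auto
  have linM: "linear M" unfolding M_def
    by (rule linearI) (simp_all add: linear_diff[OF lin] linear_add[OF lin] linear_cmul[OF lin] inner_add_left algebra_simps)
  have linL: "linear L" unfolding L_def by (rule linearI) (simp_all add: inner_add_left algebra_simps)
  have "det (matrix M) = h (nrm x)"
    using support_gauss_map(1)[OF bd_frontier[OF x]] by (simp add: gauss_curvature_eq M_def[abs_def] nrm_def)
  moreover have "det (matrix L) = 1 / h (nrm x)"
  proof -
    have "det (matrix L) = 1 + (nrm x - bd x) \<bullet> grd x" unfolding L_def by (rule det_rank_one_update)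
    also have "\<dots> = nrm x \<bullet> grd x" using grd_inner_bd[OF x]
      by (simp add: inner_diff_left inner_commute[of "bd x"])
    also have "\<dots> = 1 / h (nrm x)" by (simp add: grd_def nn field_simps)
    finally show ?thesis .
  qed
  ultimately show ?thesis unfolding eq matrix_compose[OF linL linM] det_mul using hn by simp
qed

section \<open>\<open>\<Phi>\<close> as a measure-preserving bijection between punctured
  bodies\<close>

lemma norm_\<Phi>: "x \<noteq> 0 \<Longrightarrow> norm (\<Phi> x) = g x"
  using norm_nrm g_nonneg by (simp add: \<Phi>_def)

lemma \<Phi>_nonzero: assumes "x \<noteq> 0" shows "\<Phi> x \<noteq> 0"
  using norm_\<Phi>[OF assms] g_pos[OF assms] by auto

lemma sgn_\<Phi>: assumes "x \<noteq> 0" shows "sgn (\<Phi> x) = nrm x"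
proof -
  have "sgn (\<Phi> x) = inverse (g x) *\<^sub>R (g x *\<^sub>R nrm x)" using norm_\<Phi>[OF assms] by (simp add: sgn_div_norm \<Phi>_def)
  then show ?thesis using g_pos[OF assms] by simp
qed

lemma \<Phi>_inj: "inj_on \<Phi> (-{0})"
proof (rule inj_onI)
  fix x y assume "x \<in> -{0}" "y \<in> -{0}" and eq: "\<Phi> x = \<Phi> y"
  then have x: "x \<noteq> 0" and y: "y \<noteq> 0" by auto
  have gg: "g x = g y" using norm_\<Phi>[OF x] norm_\<Phi>[OF y] eq by simp
  have "nrm x = nrm y" using sgn_\<Phi>[OF x] sgn_\<Phi>[OF y] eq by simp
  then have "bd x = bd y"
    unfolding nrm_def using inj_onD[OF gauss_map_inj[OF curvature_pos]] bd_frontier[OF x] bd_frontier[OF y] by blast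
  then show "x = y" using g_bd[OF x] g_bd[OF y] gg by metis
qed

lemma \<Phi>_image: "\<Phi> ` ((\<Omega> - {0}) \<inter> \<Phi> -` A) = (cball 0 1 - {0}) \<inter> A"
proof (intro equalityI subsetI)
  fix y assume "y \<in> \<Phi> ` ((\<Omega> - {0}) \<inter> \<Phi> -` A)"
  then obtain x where "x \<in> \<Omega>" "x \<noteq> 0" "\<Phi> x \<in> A" "y = \<Phi> x" by auto
  then show "y \<in> (cball 0 1 - {0}) \<inter> A" using norm_\<Phi>[of x] \<Phi>_nonzero[of x] g_le_1_iff[of x] by auto
next
  fix y assume y: "y \<in> (cball 0 1 - {0}) \<inter> A"
  then have y0: "y \<noteq> 0" by auto
  then have "norm (y /\<^sub>R norm y) = 1" by simp
  then obtain p where p: "p \<in> frontier \<Omega>" "gm p = y /\<^sub>R norm y" using gauss_map_surj by metis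
  \<comment> \<open>The boundary point with normal in the direction of \<open>y\<close>, scaled so
    that its gauge is the norm of \<open>y\<close>.\<close>
  define x where "x = norm y *\<^sub>R p"
  have gp: "g p = 1" using p(1) by (simp add: frontier_iff)
  then have "p \<noteq> 0" using g_0 by auto
  then have x0: "x \<noteq> 0" using y0 by (simp add: x_def)
  have gx: "g x = norm y" by (simp add: x_def g_scale gp)
  then have "bd x = p" using y0 by (simp add: bd_def x_def)
  then have "\<Phi> x = y" using y0 by (simp add: \<Phi>_def gx nrm_def p(2))
  moreover have "x \<in> \<Omega>" using gx y by (simp flip: g_le_1_iff)
  ultimately show "y \<in> \<Phi> ` ((\<Omega> - {0}) \<inter> \<Phi> -` A)" using x0 y by blast
qed

lemma borel_measurable_punctured:
  fixes f :: "real ^ 'n \<Rightarrow> 'c :: real_normed_vector"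
  assumes "continuous_on (-{0}) f"
  shows "(\<lambda>x. indicator (-{0}) x *\<^sub>R f x) \<in> borel_measurable borel"
  using assms by (intro borel_measurable_continuous_on_indicator) auto

lemma \<Phi>_borel[measurable]: "\<Phi> \<in> borel_measurable borel"
proof -
  have "\<Phi> = (\<lambda>x. g x *\<^sub>R (indicator (-{0}) x *\<^sub>R nrm x))"
    by (auto simp: fun_eq_iff \<Phi>_def indicator_def g_0)
  moreover have "\<dots> \<in> borel_measurable borel"
    using borel_measurable_punctured[OF nrm_cont] by measurable
  ultimately show ?thesis by simp
qed

text \<open>Volume preservation is applied to the preimage of each Borel set, giving an identity of
  measures through which arbitrary integrands can be transported. The origin is removed because
  \<open>\<Phi>\<close> is controlled only away from it.\<close>

lemma distr_\<Phi>: "distr (density lborel (indicator (\<Omega> - {0}))) borel \<Phi> = density lborel (indicator (cball 0 1 - {0}))"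
proof (rule measure_eqI)
  fix A assume "A \<in> sets (distr (density lborel (indicator (\<Omega> - {0}))) borel \<Phi>)"
  then have A[measurable]: "A \<in> sets borel" by simp
  define T where "T = (\<Omega> - {0}) \<inter> \<Phi> -` A"
  have [measurable]: "\<Phi> -` A \<in> sets borel" using measurable_sets[OF \<Phi>_borel A] by simp
  have dens: "emeasure (density lborel (indicator X)) Y = emeasure lborel (X \<inter> Y)"
    if [measurable]: "X \<in> sets borel" "Y \<in> sets borel" for X Y :: "(real ^ 'n) set"
    by (subst emeasure_density) (auto simp: indicator_inter_arith[symmetric])
  have T: "T \<in> sets borel" unfolding T_def by measurable
  have T0: "x \<noteq> 0" if "x \<in> T" for x using that by (auto simp: T_def)
  have "emeasure lborel T \<le> emeasure lborel \<Omega>" by (intro emeasure_mono) (auto simp: T_def)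
  then have fin: "emeasure lborel T \<noteq> \<infinity>" using K_finite by (auto simp: top_unique)
  have im: "\<Phi> ` T = (cball 0 1 - {0}) \<inter> A" unfolding T_def by (rule \<Phi>_image)
  have "emeasure lborel (\<Phi> ` T) = emeasure lborel T"
  proof (rule emeasure_image_abs_det_1[OF T fin])
    show "\<Phi> ` T \<in> sets borel" unfolding im by measurable
    show "inj_on \<Phi> T" using \<Phi>_inj by (rule inj_on_subset) (auto simp: T_def)
    show "(\<Phi> has_derivative (\<lambda>v. Dgm (bd x) (v - (v \<bullet> grd x) *\<^sub>R bd x) + (v \<bullet> grd x) *\<^sub>R nrm x)) (at x within T)"
      if "x \<in> T" for x using \<Phi>_has_derivative[OF T0[OF that]] by (rule has_derivative_at_withinI)
    show "\<bar>det (matrix (\<lambda>v. Dgm (bd x) (v - (v \<bullet> grd x) *\<^sub>R bd x) + (v \<bullet> grd x) *\<^sub>R nrm x))\<bar> = 1"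
      if "x \<in> T" for x using det_\<Phi>[OF T0[OF that]] by simp
  qed
  then have "emeasure lborel ((cball 0 1 - {0}) \<inter> A) = emeasure lborel ((\<Omega> - {0}) \<inter> \<Phi> -` A)"
    unfolding im by (simp only: T_def)
  then show "emeasure (distr (density lborel (indicator (\<Omega> - {0}))) borel \<Phi>) A = emeasure (density lborel (indicator (cball 0 1 - {0}))) A"
    by (simp add: emeasure_distr dens)
qed simp

end

section \<open>Integral identities carried over by \<open>\<Phi>\<close>\<close>

context soliton_body
begin

abbreviation "unit_ball \<equiv> cball 0 1 :: (real ^ 'n) set"

lemma nn_integral_\<Phi>:
  assumes [measurable]: "f \<in> borel_measurable borel"
  shows "(\<integral>\<^sup>+y. indicator (unit_ball - {0}) y * f y \<partial>lborel) = (\<integral>\<^sup>+x. indicator (\<Omega> - {0}) x * f (\<Phi> x) \<partial>lborel)"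
proof -
  have "(\<integral>\<^sup>+y. f y \<partial>density lborel (indicator (unit_ball - {0}))) = (\<integral>\<^sup>+x. f (\<Phi> x) \<partial>density lborel (indicator (\<Omega> - {0})))"
    unfolding distr_\<Phi>[symmetric] by (simp add: nn_integral_distr)
  moreover have "(\<integral>\<^sup>+y. k y \<partial>density lborel (indicator X)) = (\<integral>\<^sup>+y. indicator X y * k y \<partial>lborel)"
    if [measurable]: "X \<in> sets borel" "k \<in> borel_measurable borel" for X and k :: "real ^ 'n \<Rightarrow> ennreal"
    by (rule nn_integral_density) auto
  ultimately show ?thesis by simp
qed

lemma integral_\<Phi>:
  fixes f :: "real ^ 'n \<Rightarrow> real"
  assumes [measurable]: "f \<in> borel_measurable borel"
  shows "(\<integral>y. indicator (unit_ball - {0}) y * f y \<partial>lborel) = (\<integral>x. indicator (\<Omega> - {0}) x * f (\<Phi> x) \<partial>lborel)"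
proof -
  have dens: "density lborel (indicator X) = density lborel (\<lambda>x. ennreal (indicator X x))" for X :: "(real ^ 'n) set"
    by (rule arg_cong[where f="density lborel"]) (auto simp: indicator_def)
  have "(\<integral>y. f y \<partial>density lborel (indicator (unit_ball - {0}))) = (\<integral>x. f (\<Phi> x) \<partial>density lborel (indicator (\<Omega> - {0})))"
    unfolding distr_\<Phi>[symmetric] by (simp add: integral_distr)
  moreover have "(\<integral>y. k y \<partial>density lborel (indicator X)) = (\<integral>y. indicator X y * k y \<partial>lborel)"
    if [measurable]: "X \<in> sets borel" "k \<in> borel_measurable borel" for X and k :: "real ^ 'n \<Rightarrow> real"
    unfolding dens by (subst integral_density) auto
  ultimately show ?thesis by simp
qed

lemma null_frontier: "frontier \<Omega> \<in> null_sets lborel"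
proof -
  have "negligible (frontier \<Omega>)" by (rule negligible_convex_frontier[OF convex_K])
  then show ?thesis by (simp add: negligible_iff_null_sets null_sets_completion_iff)
qed

text \<open>The function \<open>max 0 (1 - g)\<close> is Lipschitz with compact support, so by translation invariance
  of Lebesgue measure its difference quotients, hence also its directional derivatives, have
  integral zero.\<close>

lemma integral_grd_zero: "(\<integral>x. indicator (\<Omega> - {0}) x * (grd x \<bullet> w) \<partial>lborel) = 0"
proof -
  define \<psi> where "\<psi> x = max 0 (1 - g x)" for x
  obtain L where L: "0 < L" "\<forall>x y. \<bar>g x - g y\<bar> \<le> L * norm (x - y)" using g_lipschitz .
  obtain R where R: "\<forall>x\<in>\<Omega>. norm x \<le> R" using compact_imp_bounded[OF compact_K] unfolding bounded_iff by blast
  have \<psi>_lip: "\<bar>\<psi> x - \<psi> y\<bar> \<le> L * norm (x - y)" for x y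
    using L(2)[rule_format, of x y] by (auto simp: \<psi>_def max_def)
  have \<psi>_0: "\<psi> x = 0" if "x \<notin> \<Omega>" for x using that g_le_1_iff[of x] by (auto simp: \<psi>_def)
  have \<psi>_cont: "continuous_on S \<psi>" for S unfolding \<psi>_def by (intro continuous_intros g_cont)
  have [measurable]: "\<psi> \<in> borel_measurable borel" by (rule borel_measurable_continuous_onI[OF \<psi>_cont])
  have \<psi>_int: "integrable lborel \<psi>"
  proof -
    have "integrable lborel (\<lambda>x. indicator \<Omega> x *\<^sub>R \<psi> x)" by (rule borel_integrable_compact[OF compact_K \<psi>_cont])
    moreover have "(\<lambda>x. indicator \<Omega> x *\<^sub>R \<psi> x) = \<psi>" using \<psi>_0 by (auto simp: indicator_def fun_eq_iff)
    ultimately show ?thesis by simp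
  qed
  have shift: "integrable lborel (\<lambda>x. \<psi> (v + x))" "(\<integral>x. \<psi> (v + x) \<partial>lborel) = (\<integral>x. \<psi> x \<partial>lborel)" for v
  proof -
    have eq: "lborel = distr lborel borel ((+) v)" by (rule lborel_distr_plus[symmetric])
    have "integrable (distr lborel borel ((+) v)) \<psi>" using \<psi>_int eq by metis
    then show "integrable lborel (\<lambda>x. \<psi> (v + x))" by (subst (asm) integrable_distr_eq) auto
    have "(\<integral>x. \<psi> x \<partial>lborel) = (\<integral>x. \<psi> x \<partial>distr lborel borel ((+) v))" using eq by metis
    then show "(\<integral>x. \<psi> (v + x) \<partial>lborel) = (\<integral>x. \<psi> x \<partial>lborel)" by (subst (asm) integral_distr) auto
  qed
  define d where "d k x = (\<psi> ((1 / real (Suc k)) *\<^sub>R w + x) - \<psi> x) / (1 / real (Suc k))" for k x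
  have d_int: "(\<integral>x. d k x \<partial>lborel) = 0" for k
    unfolding d_def using shift \<psi>_int by (subst integral_divide_zero) simp
  define F where "F x = - (indicator (\<Omega> - {0}) x * (grd x \<bullet> w))" for x
  have Fm: "F \<in> borel_measurable borel"
  proof -
    have "F = (\<lambda>x. - (indicator (\<Omega> - {0}) x * ((indicator (-{0}) x *\<^sub>R grd x) \<bullet> w)))"
      by (auto simp: F_def indicator_def fun_eq_iff)
    moreover have "\<dots> \<in> borel_measurable borel"
      using borel_measurable_punctured[OF grd_cont] by measurable
    ultimately show ?thesis by simp
  qed
  \<comment> \<open>The shifts in \<open>d k\<close> are no longer than \<open>w\<close>, so all
    difference quotients vanish outside this ball; the Lipschitz bound on it is the dominating
    function.\<close>
  define B where "B = cball (0 :: real ^ 'n) (R + norm w)"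
  have "(\<lambda>k. \<integral>x. d k x \<partial>lborel) \<longlonglongrightarrow> (\<integral>x. F x \<partial>lborel)"
  proof (rule integral_dominated_convergence[where w="\<lambda>x. L * norm w * indicator B x"])
    show "F \<in> borel_measurable lborel" using Fm by simp
    show "d k \<in> borel_measurable lborel" for k unfolding d_def by measurable
    have "emeasure lborel B < \<infinity>" unfolding B_def by (rule emeasure_lborel_cball_finite)
    then have "integrable lborel (indicat_real B)" by (simp add: B_def)
    then show "integrable lborel (\<lambda>x. L * norm w * indicator B x)" by simp
    show "AE x in lborel. norm (d k x) \<le> L * norm w * indicator B x" for k
    proof (rule AE_I2)
      fix x
      define t where "t = 1 / real (Suc k)"
      have t: "0 < t" "t \<le> 1" by (auto simp: t_def)
      have dk: "d k x = (\<psi> (t *\<^sub>R w + x) - \<psi> x) / t" by (simp only: d_def t_def)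
      show "norm (d k x) \<le> L * norm w * indicator B x"
      proof (cases "x \<in> B")
        case True
        have "\<bar>\<psi> (t *\<^sub>R w + x) - \<psi> x\<bar> \<le> L * norm (t *\<^sub>R w)" using \<psi>_lip[of "t *\<^sub>R w + x" x] by simp
        then have "\<bar>\<psi> (t *\<^sub>R w + x) - \<psi> x\<bar> / t \<le> L * norm w" using t by (simp add: field_simps)
        then show ?thesis unfolding dk using True t by (simp add: abs_divide)
      next
        case False
        have nx: "R + norm w < norm x" using False by (simp add: B_def)
        then have "x \<notin> \<Omega>" using R norm_ge_zero[of w] by fastforce
        moreover have "t *\<^sub>R w + x \<notin> \<Omega>"
        proof
          assume "t *\<^sub>R w + x \<in> \<Omega>"
          then have "norm (t *\<^sub>R w + x) \<le> R" using R by blast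
          moreover have "norm x \<le> norm (t *\<^sub>R w + x) + norm (t *\<^sub>R w)"
            using norm_triangle_ineq4[of "t *\<^sub>R w + x" "t *\<^sub>R w"] by simp
          moreover have "norm (t *\<^sub>R w) \<le> norm w" using t by (simp add: mult_left_le_one_le)
          ultimately show False using nx by linarith
        qed
        ultimately show ?thesis unfolding dk using False \<psi>_0 by simp
      qed
    qed
    show "AE x in lborel. (\<lambda>k. d k x) \<longlonglongrightarrow> F x"
    \<comment> \<open>Away from the origin and the boundary, \<open>\<psi>\<close> coincides locally
      either with \<open>1 - g\<close> or with 0; the excluded points form a null set.\<close>
    proof (rule AE_mp[OF AE_conjI[OF AE_lborel_singleton[of 0] AE_not_in[OF null_frontier]]], rule AE_I2, rule impI)
      fix x assume "x \<noteq> 0 \<and> x \<notin> frontier \<Omega>"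
      then have x: "x \<noteq> 0" and g1: "g x \<noteq> 1" by (auto simp: frontier_iff)
      have "(\<psi> has_derivative (\<lambda>v. if g x < 1 then - (grd x \<bullet> v) else 0)) (at x)"
      proof (cases "g x < 1")
        case True
        have "((\<lambda>x. 1 - g x) has_derivative (\<lambda>v. - (grd x \<bullet> v))) (at x)"
          using g_has_derivative[OF x] by (auto intro!: derivative_eq_intros)
        moreover have "open {x. g x < 1}" by (rule open_Collect_less[OF g_cont continuous_on_const])
        ultimately have "(\<psi> has_derivative (\<lambda>v. - (grd x \<bullet> v))) (at x)"
          using True by (elim has_derivative_transform_within_open) (auto simp: \<psi>_def)
        then show ?thesis using True by simp
      next
        case False
        have "open {x. 1 < g x}" by (rule open_Collect_less[OF continuous_on_const g_cont])
        moreover have "((\<lambda>x. 0 :: real) has_derivative (\<lambda>v. 0)) (at x)" by (rule has_derivative_const)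
        ultimately have "(\<psi> has_derivative (\<lambda>v. 0)) (at x)"
          using False g1 by (elim has_derivative_transform_within_open) (auto simp: \<psi>_def)
        then show ?thesis using False by simp
      qed
      moreover have "((\<lambda>t. t *\<^sub>R w + x) has_derivative (\<lambda>t. t *\<^sub>R w)) (at (0::real))"
        by (auto intro!: derivative_eq_intros)
      ultimately have "((\<lambda>t. \<psi> (t *\<^sub>R w + x)) has_derivative (\<lambda>t. if g x < 1 then - (grd x \<bullet> (t *\<^sub>R w)) else 0)) (at 0)"
        by (intro has_derivative_compose[of "\<lambda>t. t *\<^sub>R w + x" "\<lambda>t. t *\<^sub>R w" 0 UNIV \<psi>]) simp_all
      moreover have "(\<lambda>t. if g x < 1 then - (grd x \<bullet> (t *\<^sub>R w)) else 0) = (*) (F x)"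
        using x g1 by (auto simp: F_def indicator_def fun_eq_iff g_le_1_iff[symmetric])
      ultimately have "((\<lambda>t. \<psi> (t *\<^sub>R w + x)) has_real_derivative F x) (at 0)"
        by (simp add: has_field_derivative_def)
      then have "((\<lambda>t. (\<psi> (t *\<^sub>R w + x) - \<psi> x) / t) \<longlongrightarrow> F x) (at 0)"
        by (simp add: DERIV_def)
      moreover have "filterlim (\<lambda>k. 1 / real (Suc k)) (at 0) sequentially"
        using LIMSEQ_inverse_real_of_nat by (auto simp: filterlim_at inverse_eq_divide)
      ultimately show "(\<lambda>k. d k x) \<longlonglongrightarrow> F x"
        unfolding d_def by (rule filterlim_compose)
    qed
  qed
  then have "(\<integral>x. F x \<partial>lborel) = 0" using d_int by (simp add: LIMSEQ_const_iff)
  then show ?thesis by (simp add: F_def)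
qed

text \<open>The integrand depends on the direction of \<open>y\<close> only, so this is a surface
  integral in cone form. It is the first-order condition for an entropy maximum at the origin, since
  moving the base point by \<open>w\<close> lowers the support function at x by the pairing of x
  with \<open>w\<close>.\<close>

lemma integral_sphere_zero: "(\<integral>y. indicator (unit_ball - {0}) y * ((sgn y \<bullet> w) / h (sgn y)) \<partial>lborel) = 0"
proof -
  have "(\<integral>y. indicator (unit_ball - {0}) y * ((sgn y \<bullet> w) / h (sgn y)) \<partial>lborel)
      = (\<integral>x. indicator (\<Omega> - {0}) x * ((sgn (\<Phi> x) \<bullet> w) / h (sgn (\<Phi> x))) \<partial>lborel)"
    by (rule integral_\<Phi>) measurable
  also have "\<dots> = (\<integral>x. indicator (\<Omega> - {0}) x * (grd x \<bullet> w) \<partial>lborel)"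
  proof (intro Bochner_Integration.integral_cong refl)
    fix x
    show "indicator (\<Omega> - {0}) x * ((sgn (\<Phi> x) \<bullet> w) / h (sgn (\<Phi> x))) = indicator (\<Omega> - {0}) x * (grd x \<bullet> w)"
      by (cases "x = 0") (simp_all add: sgn_\<Phi> grd_def divide_inverse mult.commute)
  qed
  finally show ?thesis using integral_grd_zero by simp
qed

lemma emeasure_polar: "emeasure lborel {y. h y \<le> 1} = (\<integral>\<^sup>+x. indicator (\<Omega> - {0}) x * ennreal ((1 / h (nrm x)) ^ DIM(real ^ 'n)) \<partial>lborel)"
proof -
  have "emeasure lborel {y. h y \<le> 1} = (\<integral>\<^sup>+y. indicator {y. norm y \<le> 1} y * ennreal ((norm y / h y) ^ DIM(real ^ 'n)) \<partial>lborel)"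
    by (rule emeasure_homogeneous_sublevel) (auto intro: h_pos simp: h_scale)
  also have "\<dots> = (\<integral>\<^sup>+y. indicator (unit_ball - {0}) y * ennreal ((norm y / h y) ^ DIM(real ^ 'n)) \<partial>lborel)"
    by (rule nn_integral_cong_AE, rule AE_mp[OF AE_lborel_singleton[of 0]], rule AE_I2) (auto simp: indicator_def)
  also have "\<dots> = (\<integral>\<^sup>+x. indicator (\<Omega> - {0}) x * ennreal ((norm (\<Phi> x) / h (\<Phi> x)) ^ DIM(real ^ 'n)) \<partial>lborel)"
    by (rule nn_integral_\<Phi>) measurable
  also have "\<dots> = (\<integral>\<^sup>+x. indicator (\<Omega> - {0}) x * ennreal ((1 / h (nrm x)) ^ DIM(real ^ 'n)) \<partial>lborel)"
  proof (rule nn_integral_cong)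
    fix x
    have "norm (\<Phi> x) / h (\<Phi> x) = 1 / h (nrm x)" if "x \<noteq> 0"
      using norm_\<Phi>[OF that] g_pos[OF that] by (simp add: \<Phi>_def h_scale)
    then show "indicator (\<Omega> - {0}) x * ennreal ((norm (\<Phi> x) / h (\<Phi> x)) ^ DIM(real ^ 'n))
        = indicator (\<Omega> - {0}) x * ennreal ((1 / h (nrm x)) ^ DIM(real ^ 'n))"
      by (cases "x = 0") (auto simp: indicator_def)
  qed
  finally show ?thesis .
qed

lemma emeasure_unit_ball: "emeasure lborel unit_ball = (\<integral>\<^sup>+x. indicator (\<Omega> - {0}) x * ennreal ((1 / norm (bd x)) ^ DIM(real ^ 'n)) \<partial>lborel)"
proof -
  have "{x :: real ^ 'n. norm x \<le> 1} = unit_ball" by auto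
  then have "emeasure lborel unit_ball = emeasure lborel {x :: real ^ 'n. norm x \<le> 1}" by simp
  also have "\<dots> = (\<integral>\<^sup>+x. indicator {x. g x \<le> 1} x * ennreal ((g x / norm x) ^ DIM(real ^ 'n)) \<partial>lborel)"
    by (rule emeasure_homogeneous_sublevel) (auto intro: g_pos simp: g_scale)
  also have "\<dots> = (\<integral>\<^sup>+x. indicator (\<Omega> - {0}) x * ennreal ((1 / norm (bd x)) ^ DIM(real ^ 'n)) \<partial>lborel)"
  proof (rule nn_integral_cong_AE, rule AE_mp[OF AE_lborel_singleton[of 0]], rule AE_I2, rule impI)
    fix x :: "real ^ 'n" assume x: "x \<noteq> 0"
    have "g x / norm x = 1 / norm (bd x)" using g_pos[OF x] by (simp add: bd_def field_simps)
    then show "indicator {x. g x \<le> 1} x * ennreal ((g x / norm x) ^ DIM(real ^ 'n))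
        = indicator (\<Omega> - {0}) x * ennreal ((1 / norm (bd x)) ^ DIM(real ^ 'n))"
      using x by (simp add: indicator_def g_le_1_iff)
  qed
  finally show ?thesis .
qed

lemma h_nrm_le: assumes "x \<noteq> 0" shows "h (nrm x) \<le> norm (bd x)"
  using h_nrm[OF assms] norm_cauchy_schwarz[of "nrm x" "bd x"] norm_nrm[OF assms] by simp

lemma density_le:
  assumes "x \<noteq> 0" shows "(1 / norm (bd x)) ^ DIM(real ^ 'n) \<le> (1 / h (nrm x)) ^ DIM(real ^ 'n)"
  using h_nrm_le[OF assms] h_nrm_pos[OF assms]
  by (intro power_mono divide_left_mono mult_pos_pos) auto

lemma emeasure_polar_ge: "emeasure lborel unit_ball \<le> emeasure lborel {y. h y \<le> 1}"
  unfolding emeasure_polar emeasure_unit_ball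
proof (rule nn_integral_mono)
  fix x
  show "indicator (\<Omega> - {0}) x * ennreal ((1 / norm (bd x)) ^ DIM(real ^ 'n))
      \<le> indicator (\<Omega> - {0}) x * ennreal ((1 / h (nrm x)) ^ DIM(real ^ 'n))"
    using density_le[of x] by (cases "x = 0") (auto intro!: mult_left_mono ennreal_leI)
qed

end

section \<open>Entropy, polar volume and rigidity\<close>

lemma space_sphere_measure: "space sphere_measure = sphere 0 1"
  by (simp add: sphere_measure_def space_restrict_space)

lemma sgn_measurable_sphere:
  "sgn \<in> restrict_space lborel (cball 0 1 - {0}) \<rightarrow>\<^sub>M restrict_space borel (sphere 0 1 :: (real ^ 'n) set)"
  by (rule measurable_restrict_space2) (auto simp: space_restrict_space norm_sgn intro!: measurable_restrict_space1)

lemma sphere_measure_integral: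
  fixes \<phi> :: "real ^ 'n \<Rightarrow> real"
  assumes [measurable]: "\<phi> \<in> borel_measurable borel"
  shows "integrable sphere_measure \<phi> \<longleftrightarrow> integrable lborel (\<lambda>y. indicator (cball 0 1 - {0}) y * \<phi> (sgn y))"
    and "(\<integral>x. \<phi> x \<partial>sphere_measure) = CARD('n) * (\<integral>y. indicator (cball 0 1 - {0}) y * \<phi> (sgn y) \<partial>lborel)"
proof -
  define D where "D = distr (restrict_space lborel (cball 0 1 - {0 :: real ^ 'n})) (restrict_space borel (sphere 0 1)) sgn"
  have sm: "sphere_measure = density D (\<lambda>_. ennreal (real CARD('n)))"
    by (simp only: sphere_measure_def D_def ennreal_of_nat_eq_real_of_nat)
  have \<phi>: "\<phi> \<in> borel_measurable (restrict_space borel (sphere 0 1))"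
    by (rule measurable_restrict_space1) measurable
  then have \<phi>D: "\<phi> \<in> borel_measurable D" by (simp add: D_def)
  have B: "(cball 0 1 - {0 :: real ^ 'n}) \<inter> space lborel \<in> sets lborel" by simp
  show "integrable sphere_measure \<phi> \<longleftrightarrow> integrable lborel (\<lambda>y. indicator (cball 0 1 - {0}) y * \<phi> (sgn y))"
    unfolding sm
    by (subst integrable_density) (use \<phi>D in \<open>auto simp: D_def integrable_distr_eq[OF sgn_measurable_sphere \<phi>] integrable_restrict_space[OF B]\<close>)
  show "(\<integral>x. \<phi> x \<partial>sphere_measure) = CARD('n) * (\<integral>y. indicator (cball 0 1 - {0}) y * \<phi> (sgn y) \<partial>lborel)"
    unfolding sm
    by (subst integral_density) (use \<phi>D in \<open>auto simp: D_def integral_distr[OF sgn_measurable_sphere \<phi>] integral_restrict_space[OF B]\<close>)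
qed

lemma AE_sphere_measure:
  fixes P :: "real ^ 'n \<Rightarrow> bool"
  assumes [measurable]: "Measurable.pred borel P" and AE: "AE x in sphere_measure. P x"
  shows "AE y in lborel. y \<in> cball 0 1 - {0} \<longrightarrow> P (sgn y)"
proof -
  have P: "{x \<in> space (restrict_space borel (sphere 0 1)). P x} \<in> sets (restrict_space borel (sphere 0 1))"
    by (auto simp: space_restrict_space sets_restrict_space)
  have B: "(cball 0 1 - {0 :: real ^ 'n}) \<inter> space lborel \<in> sets lborel" by simp
  have "AE x in distr (restrict_space lborel (cball 0 1 - {0})) (restrict_space borel (sphere 0 1)) sgn. P x"
    using AE unfolding sphere_measure_def by (subst (asm) AE_density) auto
  then have "AE y in restrict_space lborel (cball 0 1 - {0}). P (sgn y)"
    by (subst (asm) AE_distr_iff[OF sgn_measurable_sphere P])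
  then show ?thesis by (subst (asm) AE_restrict_space_iff[OF B])
qed

lemma measure_sphere_pos: "0 < measure sphere_measure (sphere 0 1 :: (real ^ 'n) set)"
proof -
  have "measure sphere_measure (sphere 0 1 :: (real ^ 'n) set) = (\<integral>x. 1 \<partial>(sphere_measure :: (real ^ 'n) measure))"
    by (simp add: space_sphere_measure)
  also have "\<dots> = CARD('n) * (\<integral>y. indicat_real (cball 0 1 - {0 :: real ^ 'n}) y * 1 \<partial>lborel)"
    by (rule sphere_measure_integral(2)) simp
  also have "(\<integral>y. indicat_real (cball 0 1 - {0 :: real ^ 'n}) y * 1 \<partial>lborel) = (\<integral>y. indicat_real (cball 0 1 :: (real ^ 'n) set) y \<partial>lborel)"
  proof (rule integral_cong_AE)
    show "AE y in lborel. indicat_real (cball 0 1 - {0 :: real ^ 'n}) y * 1 = indicat_real (cball 0 1) y"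
      using AE_lborel_singleton[of 0] by eventually_elim (simp add: indicator_def)
  qed (auto intro!: borel_measurable_indicator borel_measurable_times)
  also have "\<dots> = measure lborel (cball 0 1 :: (real ^ 'n) set)" by simp
  finally show ?thesis by simp
qed

context soliton_body
begin

lemma bounded_sphere_integrable:
  assumes "continuous_on (sphere 0 1) \<phi>" and [measurable]: "\<phi> \<in> borel_measurable borel"
  shows "integrable lborel (\<lambda>y. indicator (unit_ball - {0}) y * (\<phi> (sgn y) :: real))"
proof -
  have "bounded (\<phi> ` sphere 0 1)"
    by (rule compact_imp_bounded[OF compact_continuous_image[OF assms(1) compact_sphere]])
  then obtain C where C: "\<forall>x\<in>sphere 0 1. norm (\<phi> x) \<le> C" by (auto simp: bounded_iff)
  have "emeasure lborel unit_ball < \<infinity>" by (rule emeasure_lborel_cball_finite)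
  then have "integrable lborel (\<lambda>y. C * indicat_real unit_ball y)" by simp
  moreover have "(\<lambda>y. \<phi> (sgn y)) \<in> borel_measurable borel" by measurable
  then have "(\<lambda>y. indicator (unit_ball - {0}) y * \<phi> (sgn y)) \<in> borel_measurable lborel"
    by (intro borel_measurable_times borel_measurable_indicator) auto
  ultimately show ?thesis
  proof (rule Bochner_Integration.integrable_bound)
    show "AE y in lborel. norm (indicator (unit_ball - {0}) y * \<phi> (sgn y)) \<le> norm (C * indicat_real unit_ball y)"
    proof (rule AE_I2)
      fix y :: "real ^ 'n"
      show "norm (indicator (unit_ball - {0}) y * \<phi> (sgn y)) \<le> norm (C * indicat_real unit_ball y)"
      proof (cases "y \<in> unit_ball - {0}")
        case True
        then have "sgn y \<in> sphere 0 1" by (simp add: norm_sgn)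
        then have "\<bar>\<phi> (sgn y)\<bar> \<le> \<bar>C\<bar>" using C by fastforce
        then show ?thesis using True by simp
      qed simp
    qed
  qed
qed

text \<open>Strictness comes from the equality case of ln t \<le> t - 1: it forces t = 1, hence a
  direction orthogonal to \<open>w\<close>, and such directions fill only a null set of the
  ball.\<close>

lemma entropy_less:
  assumes w: "w \<in> \<Omega>" "w \<noteq> 0"
  shows "entropy \<Omega> w < entropy \<Omega> 0"
proof -
  have h_pos_sphere: "0 < h x" if "x \<in> sphere 0 1" for x using that by (intro h_pos) auto
  have ln_h_cont: "continuous_on (sphere 0 1) (\<lambda>x. ln (h x))"
    by (intro continuous_intros h_cont) (use h_pos_sphere in force)
  have int0: "integrable lborel (\<lambda>y. indicator (unit_ball - {0}) y * ln (h (sgn y)))"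
    using bounded_sphere_integrable[OF ln_h_cont] by simp
  then have "integrable sphere_measure (\<lambda>x. ln (h x))" by (subst sphere_measure_integral(1)) simp_all
  moreover have "AE x in sphere_measure. 0 < h x"
    by (rule AE_I2) (use h_pos_sphere in \<open>simp add: space_sphere_measure\<close>)
  ultimately have ent0: "entropy \<Omega> 0 = ereal (1 / measure sphere_measure (sphere 0 1 :: (real ^ 'n) set) * (\<integral>x. ln (h x) \<partial>sphere_measure))"
    by (simp add: entropy_def)
  show ?thesis
  proof (cases "(AE x in sphere_measure. 0 < support_fun \<Omega> w x) \<and> integrable sphere_measure (\<lambda>x. ln (support_fun \<Omega> w x))")
    case False
    then have "entropy \<Omega> w = -\<infinity>" unfolding entropy_def by (rule if_not_P)
    then show ?thesis by (simp add: ent0)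
  next
    case True
    define k where "k = support_fun \<Omega> w"
    have [measurable]: "k \<in> borel_measurable borel" unfolding k_def
      by (rule borel_measurable_continuous_onI[OF continuous_on_support_fun[OF compact_K K_nonempty]])
    have k: "k x = h x - x \<bullet> w" for x unfolding k_def by (rule support_fun_shift[OF compact_K K_nonempty])
    have entw: "entropy \<Omega> w = ereal (1 / measure sphere_measure (sphere 0 1 :: (real ^ 'n) set) * (\<integral>x. ln (k x) \<partial>sphere_measure))"
      unfolding entropy_def k_def by (rule if_P[OF True])
    have intw: "integrable lborel (\<lambda>y. indicator (unit_ball - {0}) y * ln (k (sgn y)))"
      using True unfolding k_def[symmetric] by (subst (asm) sphere_measure_integral(1)) simp_all
    have "AE y in lborel. y \<in> unit_ball - {0} \<longrightarrow> 0 < k (sgn y)"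
      using True unfolding k_def[symmetric] by (intro AE_sphere_measure) simp_all
    then have k_pos: "AE y in lborel. y \<in> unit_ball - {0} \<longrightarrow> 0 < k (sgn y)" .
    have "continuous_on (sphere 0 1) (\<lambda>x. (x \<bullet> w) / h x)"
      by (intro continuous_intros h_cont) (use h_pos_sphere in force)
    then have intq: "integrable lborel (\<lambda>y. indicator (unit_ball - {0}) y * ((sgn y \<bullet> w) / h (sgn y)))"
      by (rule bounded_sphere_integrable) measurable
    \<comment> \<open>With t = k / h this is the defect t - 1 - ln t on the punctured ball. Its
      linear term integrates to zero by \<open>integral_sphere_zero\<close>, so its integral is the
      entropy gap up to a positive factor.\<close>
    define p where "p y = indicator (unit_ball - {0}) y * ln (h (sgn y)) - indicator (unit_ball - {0}) y * ln (k (sgn y))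
        - indicator (unit_ball - {0}) y * ((sgn y \<bullet> w) / h (sgn y))" for y
    have intp: "integrable lborel p" unfolding p_def by (intro Bochner_Integration.integrable_diff int0 intw intq)
    define I0 where "I0 = (\<integral>y. indicator (unit_ball - {0}) y * ln (h (sgn y)) \<partial>lborel)"
    define Iw where "Iw = (\<integral>y. indicator (unit_ball - {0}) y * ln (k (sgn y)) \<partial>lborel)"
    have p_val: "(\<integral>y. p y \<partial>lborel) = I0 - Iw"
      unfolding p_def I0_def Iw_def using int0 intw intq integral_sphere_zero[of w]
      by (simp add: Bochner_Integration.integral_diff)
    have p_pt: "0 \<le> p y" "p y = 0 \<Longrightarrow> y \<in> unit_ball - {0} \<Longrightarrow> y \<bullet> w = 0"
      if "y \<in> unit_ball - {0} \<longrightarrow> 0 < k (sgn y)" for y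
    proof -
      have *: "0 \<le> p y \<and> (p y = 0 \<longrightarrow> y \<bullet> w = 0)" if y: "y \<in> unit_ball - {0}"
      proof -
        define s where "s = sgn y"
        have "s \<in> sphere 0 1" using y by (simp add: s_def norm_sgn)
        then have hs: "0 < h s" by (rule h_pos_sphere)
        have ks: "0 < k s" using \<open>_ \<longrightarrow> 0 < k (sgn y)\<close> y by (simp add: s_def)
        have q: "0 < k s / h s" "k s / h s = 1 - (s \<bullet> w) / h s" using hs ks by (simp_all add: k diff_divide_distrib)
        have py: "p y = k s / h s - 1 - ln (k s / h s)"
        proof -
          have "p y = ln (h s) - ln (k s) - (s \<bullet> w) / h s" using y by (simp add: p_def s_def[symmetric])
          moreover have "ln (k s / h s) = ln (k s) - ln (h s)" by (rule ln_divide_pos[OF ks hs])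
          ultimately show ?thesis using q(2) by linarith
        qed
        have "ln (k s / h s) \<le> k s / h s - 1" by (rule ln_le_minus_one[OF q(1)])
        moreover have "y \<bullet> w = 0" if "p y = 0"
        proof -
          have "k s / h s = 1" using that py by (intro ln_eq_minus_one[OF q(1)]) simp
          then have "s \<bullet> w = 0" using q(2) hs by simp
          moreover have "y = norm y *\<^sub>R s" using y by (simp add: s_def sgn_div_norm)
          ultimately show ?thesis by (metis inner_scaleR_left mult_zero_right)
        qed
        ultimately show ?thesis using py by simp
      qed
      show "0 \<le> p y" using * by (cases "y \<in> unit_ball - {0}") (auto simp: p_def)
      show "p y = 0 \<Longrightarrow> y \<in> unit_ball - {0} \<Longrightarrow> y \<bullet> w = 0" using * by blast
    qed
    have p_nn: "AE y in lborel. 0 \<le> p y" using k_pos by eventually_elim (rule p_pt(1))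
    have "Iw < I0"
    proof (rule ccontr)
      assume "\<not> Iw < I0"
      then have "(\<integral>y. p y \<partial>lborel) = 0"
        using integral_nonneg_AE[OF p_nn] p_val by simp
      then have p0: "AE y in lborel. p y = 0"
        using integral_nonneg_eq_0_iff_AE[OF intp p_nn] by simp
      have "negligible {y. w \<bullet> y = 0}" using w(2) by (intro negligible_hyperplane) auto
      then have "{y. w \<bullet> y = 0} \<in> null_sets lborel" by (simp add: negligible_iff_null_sets null_sets_completion_iff)
      from AE_not_in[OF this] have "AE y in lborel. y \<bullet> w \<noteq> 0" by (simp add: inner_commute)
      with p0 k_pos AE_lborel_singleton[of 0] have "AE y in lborel. y \<notin> unit_ball"
      proof eventually_elim
        case (elim y)
        then show ?case using p_pt(2)[of y] by blast
      qed
      then have "emeasure lborel unit_ball = 0"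
        by (subst (asm) AE_iff_measurable[where N=unit_ball]) auto
      then show False using emeasure_cball_pos_finite(1) by blast
    qed
    then have "(\<integral>x. ln (k x) \<partial>sphere_measure) < (\<integral>x. ln (h x) \<partial>sphere_measure)"
      by (subst (1 2) sphere_measure_integral(2)) (simp_all add: I0_def Iw_def)
    then show ?thesis unfolding ent0 entw using measure_sphere_pos[where 'n='n] by (simp add: divide_strict_right_mono)
  qed
qed

section \<open>The polar volume and its equality case\<close>

lemma polar_finite: "emeasure lborel {y. h y \<le> 1} < \<infinity>"
proof -
  obtain e where e: "0 < e" "cball 0 e \<subseteq> \<Omega>" using zero_interior unfolding mem_interior_cball by blast
  have "{y. h y \<le> 1} \<subseteq> cball 0 (1 / e)"
  proof
    fix y assume "y \<in> {y. h y \<le> 1}"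
    then have y: "h y \<le> 1" by simp
    have "e * norm y \<le> h y"
    proof (cases "y = 0")
      case False
      have "(e / norm y) *\<^sub>R y \<in> \<Omega>" using e False by (intro subsetD[OF e(2)]) simp
      from h_upper[OF this, of y] show ?thesis using False by (simp add: dot_square_norm power2_eq_square)
    qed (simp add: h_nonneg)
    then show "y \<in> cball 0 (1 / e)" using y e(1) by (simp add: field_simps)
  qed
  then have "emeasure lborel {y. h y \<le> 1} \<le> emeasure lborel (cball (0 :: real ^ 'n) (1 / e))" by (intro emeasure_mono) auto
  then show ?thesis using emeasure_lborel_cball_finite[of "0 :: real ^ 'n" "1 / e"] by (rule le_less_trans)
qed

text \<open>Equality of the two integrals makes the ordered densities agree almost everywhere. The
  set \<open>T\<close> of strict inequality inside the body is open by continuity of the normal, and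
  a null open set is empty.\<close>

lemma h_nrm_eq_norm_bd:
  assumes le: "emeasure lborel {y. h y \<le> 1} \<le> emeasure lborel unit_ball" and x: "x \<noteq> 0"
  shows "h (nrm x) = norm (bd x)"
proof -
  define N where "N = DIM(real ^ 'n)"
  have N: "0 < N" unfolding N_def by (rule DIM_positive)
  define f1 where "f1 x = indicator (\<Omega> - {0}) x * ennreal ((1 / norm (bd x)) ^ N)" for x
  define f2 where "f2 x = indicator (\<Omega> - {0}) x * ennreal ((1 / h (nrm x)) ^ N)" for x
  have meas: "(\<lambda>x. indicator (\<Omega> - {0}) x * ennreal ((1 / k x) ^ N)) \<in> borel_measurable borel"
    if "continuous_on (-{0}) k" for k :: "real ^ 'n \<Rightarrow> real"
  proof -
    have "(\<lambda>x. indicator (\<Omega> - {0}) x * ennreal ((1 / k x) ^ N))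
        = (\<lambda>x. indicator (\<Omega> - {0}) x * ennreal ((1 / (indicator (-{0}) x *\<^sub>R k x)) ^ N))"
      by (auto simp: indicator_def fun_eq_iff)
    moreover have "\<dots> \<in> borel_measurable borel" using borel_measurable_punctured[OF that] by measurable
    ultimately show ?thesis by simp
  qed
  have [measurable]: "f1 \<in> borel_measurable borel"
    unfolding f1_def[abs_def] by (rule meas) (intro continuous_intros bd_cont)
  have [measurable]: "f2 \<in> borel_measurable borel"
    unfolding f2_def[abs_def] by (rule meas[OF h_nrm_cont])
  have f12: "f1 x \<le> f2 x" for x
    unfolding f1_def f2_def N_def using density_le[of x] by (cases "x = 0") (auto intro!: mult_left_mono ennreal_leI)
  have i1: "(\<integral>\<^sup>+x. f1 x \<partial>lborel) = emeasure lborel unit_ball" unfolding f1_def N_def by (rule emeasure_unit_ball[symmetric])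
  have i2: "(\<integral>\<^sup>+x. f2 x \<partial>lborel) = emeasure lborel {y. h y \<le> 1}" unfolding f2_def N_def by (rule emeasure_polar[symmetric])
  have "(\<integral>\<^sup>+x. f2 x - f1 x \<partial>lborel) = (\<integral>\<^sup>+x. f2 x \<partial>lborel) - (\<integral>\<^sup>+x. f1 x \<partial>lborel)"
    using emeasure_cball_pos_finite(2)[where 'a="real ^ 'n"] f12 by (intro nn_integral_diff) (auto simp: i1)
  also have "\<dots> = 0" unfolding i1 i2 using le polar_finite by (simp add: diff_eq_0_iff_ennreal)
  finally have "AE x in lborel. f2 x - f1 x = 0" by (simp add: nn_integral_0_iff_AE)
  then have AEle: "AE x in lborel. f2 x \<le> f1 x"
    by eventually_elim (auto simp: diff_eq_0_iff_ennreal f1_def f2_def ennreal_mult_eq_top_iff indicator_def)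
  define T where "T = {x \<in> interior \<Omega> - {0}. h (nrm x) < norm (bd x)}"
  have openT: "open T"
  proof -
    have "open ((interior \<Omega> - {0}) \<inter> (\<lambda>x. norm (bd x) - h (nrm x)) -` {0<..})"
      by (rule continuous_open_preimage)
         (auto intro!: continuous_intros continuous_on_subset[OF bd_cont] continuous_on_subset[OF h_nrm_cont])
    also have "\<dots> = T" by (auto simp: T_def)
    finally show ?thesis .
  qed
  have "AE x in lborel. x \<notin> T" using AEle
  proof eventually_elim
    case (elim x)
    show ?case
    proof
      assume "x \<in> T"
      then have x: "x \<in> \<Omega>" "x \<noteq> 0" "h (nrm x) < norm (bd x)" using interior_subset by (auto simp: T_def)
      have hp: "0 < h (nrm x)" by (rule h_nrm_pos[OF x(2)])
      have "1 / norm (bd x) < 1 / h (nrm x)" using x(3) hp by (intro divide_strict_left_mono mult_pos_pos) auto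
      then have "(1 / norm (bd x)) ^ N < (1 / h (nrm x)) ^ N" using N by (intro power_strict_mono) auto
      then have "f1 x < f2 x" using x(1,2) by (simp add: f1_def f2_def ennreal_less_iff)
      then show False using elim by simp
    qed
  qed
  moreover have "T \<in> sets lborel" using openT by simp
  ultimately have "T \<in> null_sets lborel" by (simp add: AE_iff_null_sets)
  then have "negligible T" by (simp add: negligible_iff_null_sets null_sets_completionI)
  then have T0: "T = {}" using open_not_negligible[OF openT] by blast
  \<comment> \<open>Both \<open>bd\<close> and \<open>nrm\<close> are constant along rays, so
    \<open>x\<close> may be moved into the interior; this factor gives it gauge 1 / 2.\<close>
  define t where "t = 1 / (2 * g x)"
  have t: "0 < t" using g_pos[OF x] by (simp add: t_def)
  have "g (t *\<^sub>R x) < 1" using g_pos[OF x] t by (simp add: g_scale t_def)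
  then have "t *\<^sub>R x \<in> interior \<Omega> - {0}" using t x by (simp add: g_less_1_iff)
  moreover have "bd (t *\<^sub>R x) = bd x" using t by (simp add: bd_def g_scale)
  ultimately have "\<not> h (nrm x) < norm (bd x)" using T0 by (auto simp: T_def nrm_def)
  then show ?thesis using h_nrm_le[OF x] by simp
qed

text \<open>Equality in Cauchy-Schwarz makes the normal parallel to the position vector, so
  \<open>grd x\<close> is a multiple of \<open>x\<close>; pairing it with \<open>x\<close> fixes the
  factor. The derivative of the quotient of gauge and norm then vanishes everywhere off the
  origin.\<close>

lemma gauge_eq_norm:
  assumes le: "emeasure lborel {y. h y \<le> 1} \<le> emeasure lborel unit_ball" and dim: "2 \<le> CARD('n)"
  obtains c where "0 < c" "\<And>x. g x = c * norm x"
proof -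
  have grd: "grd x = (g x / (norm x)\<^sup>2) *\<^sub>R x" if x: "x \<noteq> 0" for x
  proof -
    have gp: "0 < g x" by (rule g_pos[OF x])
    have nb: "norm (bd x) = norm x / g x" using gp by (simp add: bd_def divide_inverse mult.commute)
    have hb: "h (nrm x) = norm (bd x)" by (rule h_nrm_eq_norm_bd[OF le x])
    have "nrm x \<bullet> bd x = norm (nrm x) * norm (bd x)" using h_nrm[OF x] hb norm_nrm[OF x] by simp
    then have "norm (nrm x) *\<^sub>R bd x = norm (bd x) *\<^sub>R nrm x" by (simp only: norm_cauchy_schwarz_eq)
    then have "bd x = norm (bd x) *\<^sub>R nrm x" using norm_nrm[OF x] by simp
    then have "bd x = (norm (bd x))\<^sup>2 *\<^sub>R grd x" using nrm_eq[OF x] hb by (metis power2_eq_square scaleR_scaleR)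
    then have "inverse ((norm (bd x))\<^sup>2) *\<^sub>R bd x = inverse ((norm (bd x))\<^sup>2) *\<^sub>R ((norm (bd x))\<^sup>2 *\<^sub>R grd x)"
      by (rule arg_cong)
    moreover have "(norm (bd x))\<^sup>2 \<noteq> 0" using nb gp x by simp
    ultimately have "grd x = inverse ((norm (bd x))\<^sup>2) *\<^sub>R bd x" by simp
    then show ?thesis using gp x by (simp add: nb bd_def field_simps power2_eq_square)
  qed
  have der: "((\<lambda>x. g x * inverse (norm x)) has_derivative (\<lambda>v. 0)) (at x)" if "x \<in> -{0}" for x
  proof -
    have x: "x \<noteq> 0" using that by simp
    have 1: "((\<lambda>x. inverse (norm x)) has_derivative (\<lambda>v. - (inverse (norm x) * (sgn x \<bullet> v) * inverse (norm x)))) (at x)"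
    proof -
      have "(norm has_derivative (\<lambda>v. v \<bullet> sgn x)) (at x)" by (rule has_derivative_norm[OF x])
      then have "(norm has_derivative (\<lambda>v. sgn x \<bullet> v)) (at x)" by (simp add: inner_commute)
      moreover have "norm x \<noteq> 0" using x by simp
      ultimately show ?thesis by (rule Deriv.has_derivative_inverse[rotated])
    qed
    have "((\<lambda>x. g x * inverse (norm x)) has_derivative
        (\<lambda>v. g x * (- (inverse (norm x) * (sgn x \<bullet> v) * inverse (norm x))) + (grd x \<bullet> v) * inverse (norm x))) (at x)"
      by (rule has_derivative_mult[OF g_has_derivative[OF x] 1])
    moreover have "(\<lambda>v. g x * (- (inverse (norm x) * (sgn x \<bullet> v) * inverse (norm x))) + (grd x \<bullet> v) * inverse (norm x)) = (\<lambda>v. 0)"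
      using x by (intro ext) (simp add: grd[OF x] sgn_div_norm field_simps power2_eq_square)
    ultimately show ?thesis by (simp only:)
  qed
  \<comment> \<open>On a line the two rays from the origin would be separate components and could
    carry different constants; this is where dimension at least 2 enters.\<close>
  have conn: "connected (- {0 :: real ^ 'n})" using dim by (intro connected_punctured_universe) simp
  define x0 where "x0 = (axis undefined 1 :: real ^ 'n)"
  have x0: "x0 \<noteq> 0" by (simp add: x0_def axis_eq_0_iff)
  define c where "c = g x0 * inverse (norm x0)"
  have const: "g x * inverse (norm x) = c" if "x \<noteq> 0" for x
    unfolding c_def by (rule has_derivative_zero_unique_connected[OF _ conn der]) (use that x0 in auto)
  have "g x = c * norm x" for x
    using const[of x] g_0 by (cases "x = 0") (auto simp: field_simps)
  moreover have "0 < c" unfolding c_def using g_pos[OF x0] x0 by simp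
  ultimately show thesis using that by blast
qed

lemma body_eq_ball:
  assumes le: "emeasure lborel {y. h y \<le> 1} \<le> emeasure lborel unit_ball" and dim: "2 \<le> CARD('n)"
    and vol: "measure lborel \<Omega> = measure lborel unit_ball"
  shows "\<Omega> = unit_ball"
proof -
  obtain c where c: "0 < c" "\<And>x. g x = c * norm x" using gauge_eq_norm[OF le dim] by blast
  have \<Omega>: "\<Omega> = cball 0 (1 / c)"
    using c by (auto simp: g_le_1_iff[symmetric] field_simps)
  have "unit_ball_vol (real DIM(real ^ 'n)) * (1 / c) ^ DIM(real ^ 'n) = unit_ball_vol (real DIM(real ^ 'n)) * 1 ^ DIM(real ^ 'n)"
    using vol content_cball[of "1 / c" "0 :: real ^ 'n"] content_cball[of 1 "0 :: real ^ 'n"] c(1) unfolding \<Omega> by simp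
  moreover have "unit_ball_vol (real DIM(real ^ 'n)) \<noteq> 0"
    by (metis less_irrefl of_nat_0_le_iff unit_ball_vol_pos)
  ultimately have "(1 / c) ^ DIM(real ^ 'n) = 1" by simp
  then have "1 / c = 1" using c(1) power_eq_imp_eq_base[of "1 / c" "DIM(real ^ 'n)" 1] by simp
  then show ?thesis using \<Omega> by simp
qed

lemma polar_dual_0: "polar_dual \<Omega> 0 = {y. h y \<le> 1}"
  by (simp add: polar_dual_def)

lemma measure_polar_dual_0: "measure lebesgue (polar_dual \<Omega> 0) = measure lborel {y. h y \<le> 1}"
  unfolding polar_dual_0 by (rule measure_completion) measurable

end

theorem proposition3p7:
  fixes \<Omega> :: "(real ^ 'n) set"
  assumes dim: "CARD('n) \<ge> 2"
    and body: "convex_body \<Omega>"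
    and smooth: "smooth_boundary \<Omega>"
    and curvature_pos: "\<forall>p\<in>frontier \<Omega>. gauss_curvature \<Omega> p > 0"
    and origin: "0 \<in> \<Omega>"
    and volume: "measure lebesgue \<Omega> = measure lebesgue (cball 0 1 :: (real ^ 'n) set)"
    and soliton: "\<forall>x\<in>sphere 0 1. support_fun \<Omega> 0 x = gauss_curvature_on_sphere \<Omega> x"
  shows "is_entropy_point \<Omega> 0 \<and>
    measure lebesgue (polar_dual \<Omega> 0) \<ge> measure lebesgue (cball 0 1 :: (real ^ 'n) set) \<and>
    (is_santalo_point \<Omega> 0 \<longrightarrow> \<Omega> = cball 0 1)"
proof -
  interpret soliton_body \<Omega>
    by (intro soliton_body.intro smooth_body.intro soliton_body_axioms.intro body smooth curvature_pos soliton)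
  have ball: "measure lebesgue unit_ball = measure lborel unit_ball" by (rule measure_completion) simp
  have vol: "measure lborel \<Omega> = measure lborel unit_ball"
    using volume measure_completion[of \<Omega> lborel] ball by simp
  have ge: "measure lebesgue (polar_dual \<Omega> 0) \<ge> measure lebesgue unit_ball"
  proof -
    have "measure lborel unit_ball \<le> measure lborel {y. h y \<le> 1}"
      unfolding measure_def using polar_finite by (intro enn2real_mono emeasure_polar_ge) simp
    then show ?thesis by (simp only: measure_polar_dual_0 ball)
  qed
  have "\<Omega> = unit_ball" if san: "is_santalo_point \<Omega> 0"
  proof -
    obtain w where w: "w \<in> interior \<Omega>"
      "measure lebesgue \<Omega> * measure lebesgue (polar_dual \<Omega> w) \<le> (measure lebesgue unit_ball)\<^sup>2"
      using blaschke_santalo[OF body] by blast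
    have pos: "0 < measure lebesgue unit_ball" unfolding ball by simp
    \<comment> \<open>Minimality at the Santalo point compares the origin with the point
      \<open>w\<close> of the Blaschke-Santalo inequality; the volume normalization then cancels one
      factor of the ball.\<close>
    have "measure lebesgue (polar_dual \<Omega> 0) \<le> measure lebesgue (polar_dual \<Omega> w)"
      using san w(1) unfolding is_santalo_point_def by (cases "w = 0") (auto intro: less_imp_le)
    also have "\<dots> \<le> measure lebesgue unit_ball"
      using w(2) pos unfolding volume power2_eq_square by simp
    finally have "measure lborel {y. h y \<le> 1} \<le> measure lborel unit_ball"
      unfolding measure_polar_dual_0 ball .
    then have "emeasure lborel {y. h y \<le> 1} \<le> emeasure lborel unit_ball"
      using polar_finite emeasure_cball_pos_finite(2)[where 'a="real ^ 'n"]
      by (simp add: emeasure_eq_ennreal_measure ennreal_leI less_top)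
    then show ?thesis using dim vol by (rule body_eq_ball)
  qed
  moreover have "is_entropy_point \<Omega> 0"
    unfolding is_entropy_point_def using origin entropy_less by blast
  ultimately show ?thesis using ge by blast
qed

end
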